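(* Consider the unit-weight \textsc{Spanner} problem parameterized by removed edges: given a connected undirected graph $G=(V,E)$ with $n=|V|$, $m=|E|$, unit edge weights $w(e)=1$ for all $e\in E$, edge lengths $\ell\colon E\to\mathbb{N}_{\ge1}$, a stretch factor $\alpha\ge1$ and $\varrho\in\mathbb{N}$, decide whether $G$ has an $\alpha$-spanner $H=(V,F)$ obtained by removing at least $\varrho$ nontrivial edges from $G$. (i) There is an algorithm that is FPT w.r.t. $(\varrho,\tau)$, where $\tau$ is the tightness of the instance, which decides this problem in time $$\mathcal{T}\in\mathcal{O}\big(\varrho^{2\varrho+1}\tau^{2\varrho}\cdot\mathrm{SPSP}(n,m)+\mathrm{APSP}_2(n,m)\big)$$ and identifies a witness (if it exists) in $\mathcal{O}(\mathcal{T}+n^2m^2)$ time. (ii) For basic instances (i.e., additionally $\ell(e)=1$ for all $e\in E$), there is an algorithm that is FPT w.r.t. $(\varrho,\alpha)$ only; it decides the problem, including finding a witness if it exists, in $\mathcal{O}\big(\varrho^{2\varrho+1}\alpha^{2\varrho}\cdot m+nm\big)$ time.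
   Context: For a subgraph $G'\subseteq G$ and $u,v\in V$, $\ell_{G'}[u,v]$ is the length of a shortest $u$-$v$-path in $G'$ w.r.t. $\ell$. A subgraph $H=(V,F)$, $F\subseteq E$, is an $\alpha$-spanner of $G$ if $\ell_H[u,v]\le\alpha\,\ell_G[u,v]$ for all $u,v\in V$; equivalently, for all $\{u,v\}\in E$. The set of terminal pairs is $K=E$. For $\{u,v\}\in E$, a simple $u$-$v$-path $P$ is settling if $\ell(P)\le\alpha\,\ell_G[u,v]$; it is alternative if it does not contain the edge $\{u,v\}$. $\mathcal{P}_{uv}$ is the set of all settling $u$-$v$-paths. As a preprocessing convention, edges that do not settle themselves (i.e., $\ell(\{u,v\})>\alpha\,\ell_G[u,v]$) are assumed to have been removed from the instance. An edge $\{u,v\}$ is mandatory if $\mathcal{P}_{uv}$ contains no alternative path. The trivial edges $T\subseteq E$ are the mandatory edges and the edges of weight $0$ (none of the latter exist for unit weights); the nontrivial edges are $N=E\setminus T$. A terminal pair $\{u,v\}\in E$ is critical if no settling $u$-$v$-path consists only of trivial edges; $C$ denotes the set of critical terminal pairs ($C\subseteq N$). For $\{u,v\}\in C$, the tightest alternative path $A_{uv}\in\mathcal{P}_{uv}$ is an alternative settling path with the minimum number of nontrivial edges, and $A^N_{uv}=A_{uv}\cap N$. The tightness of the instance is $\tau=\max\{|A^N_{uv}| : \{u,v\}\in C\}$. $\mathrm{SPSP}(n,m)$ and $\mathrm{APSP}_2(n,m)$ denote the running time of suitable algorithms for the single-pair shortest path problem and for the all-pairs-2-shortest-paths problem (two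 shortest paths for each node pair), respectively, on a graph with $n$ nodes and $m$ edges; $\mathrm{APSP}_2(n,m)\in\mathcal{O}(nm+n^2\log n)$. An algorithm is FPT w.r.t. a (possibly combined) parameter $k$ if on instance $I$ it runs in $\mathcal{O}(f(k)\cdot p(\langle I\rangle))$ time for a computable function $f$ and a polynomial $p$ in the encoding length $\langle I\rangle$. *)

theory Defs
  imports
    Complex_Main
    "HOL-Library.Extended_Real"
    "HOL-Library.Log_Nat"
    "HOL-Computational_Algebra.Polynomial"
begin

section \<open>Machine model\<close>

text \<open>
  Algorithms are programs of a deeply embedded imperative language over natural numbers with
  the cost measure of a word RAM.  A state consists of scalar registers and of arrays, both
  addressed by fixed names.  The parameter \<open>W\<close> of the semantics bounds every constant and every
  result of an operation, including intermediate results: a computation that exceeds it, or that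
  accesses an array out of bounds, is stuck and has no derivation.
  Expressions are part of the fixed program text, so that charging one unit per
  executed command instead of one unit per operation only changes constant factors.
  Operations that are not elementary (allocating an array, passing arrays to and from a
  subprogram) are charged by the lengths of the arrays involved.
\<close>

datatype binop = Plus | Minus | Times | Divide | Less | Equal

datatype exp =
    Const nat
  | Reg nat
  | Len nat
  | Read nat exp
  | Op binop exp exp

datatype com =
    Assign nat exp
  | New nat exp
  | Write nat exp exp
  | Seq com com
  | If exp com com
  | While exp com
  | Call nat com nat

type_synonym state = "(nat \<Rightarrow> nat) \<times> (nat \<Rightarrow> nat list)"

fun apply_op :: "binop \<Rightarrow> nat \<Rightarrow> nat \<Rightarrow> nat" where
  "apply_op Plus x y = x + y"
| "apply_op Minus x y = x - y"
| "apply_op Times x y = x * y"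
| "apply_op Divide x y = x div y"
| "apply_op Less x y = (if x < y then 1 else 0)"
| "apply_op Equal x y = (if x = y then 1 else 0)"

definition word :: "nat \<Rightarrow> nat \<Rightarrow> nat option" where
  "word W x = (if x \<le> W then Some x else None)"

fun eval_exp :: "nat \<Rightarrow> state \<Rightarrow> exp \<Rightarrow> nat option" where
  "eval_exp W s (Const k) = word W k"
| "eval_exp W s (Reg x) = word W (fst s x)"
| "eval_exp W s (Len a) = word W (length (snd s a))"
| "eval_exp W s (Read a e) =
     Option.bind (eval_exp W s e)
       (\<lambda>i. if i < length (snd s a) then word W (snd s a ! i) else None)"
| "eval_exp W s (Op f e1 e2) =
     Option.bind (eval_exp W s e1)
       (\<lambda>x. Option.bind (eval_exp W s e2) (\<lambda>y. word W (apply_op f x y)))"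

text \<open>A program, and likewise a called subprogram, starts with its input in array 0 and with all
  other storage cleared; it leaves its output in array 0.\<close>

definition init :: "nat list \<Rightarrow> state" where
  "init xs = (\<lambda>_. 0, (\<lambda>_. [])(0 := xs))"

abbreviation result :: "state \<Rightarrow> nat list" where
  "result s \<equiv> snd s 0"

text \<open>\<open>exec W c s t s'\<close>: started in \<open>s\<close>, the program \<open>c\<close> terminates in \<open>s'\<close> after \<open>t\<close> steps.\<close>

inductive exec :: "nat \<Rightarrow> com \<Rightarrow> state \<Rightarrow> nat \<Rightarrow> state \<Rightarrow> bool" for W where
  Assign: "eval_exp W s e = Some x \<Longrightarrow>
    exec W (Assign r e) s 1 ((fst s)(r := x), snd s)"
| New: "eval_exp W s e = Some k \<Longrightarrow>
    exec W (New a e) s (1 + k) (fst s, (snd s)(a := replicate k 0))"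
| Write: "eval_exp W s e1 = Some i \<Longrightarrow> eval_exp W s e2 = Some x \<Longrightarrow> i < length (snd s a) \<Longrightarrow>
    exec W (Write a e1 e2) s 1 (fst s, (snd s)(a := (snd s a)[i := x]))"
| Seq: "exec W c1 s1 t1 s2 \<Longrightarrow> exec W c2 s2 t2 s3 \<Longrightarrow>
    exec W (Seq c1 c2) s1 (t1 + t2) s3"
| IfTrue: "eval_exp W s e = Some x \<Longrightarrow> x \<noteq> 0 \<Longrightarrow> exec W c1 s t s' \<Longrightarrow>
    exec W (If e c1 c2) s (1 + t) s'"
| IfFalse: "eval_exp W s e = Some 0 \<Longrightarrow> exec W c2 s t s' \<Longrightarrow>
    exec W (If e c1 c2) s (1 + t) s'"
| WhileFalse: "eval_exp W s e = Some 0 \<Longrightarrow>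
    exec W (While e c) s 1 s"
| WhileTrue: "eval_exp W s1 e = Some x \<Longrightarrow> x \<noteq> 0 \<Longrightarrow> exec W c s1 t1 s2 \<Longrightarrow>
    exec W (While e c) s2 t2 s3 \<Longrightarrow>
    exec W (While e c) s1 (1 + t1 + t2) s3"
| Call: "exec W c (init (snd s a)) t s' \<Longrightarrow>
    exec W (Call b c a) s (1 + length (snd s a) + t + length (result s'))
      (fst s, (snd s)(b := result s'))"

text \<open>Words have \<open>O(log N)\<close> bits, where \<open>N\<close> is the maximum of the length of the input and of the
  numbers occurring in it; \<open>d\<close> is the constant hidden in this \<open>O\<close>.\<close>

definition word_bound :: "nat \<Rightarrow> nat list \<Rightarrow> nat" where
  "word_bound d xs = (2 + length xs + Max (insert 0 (set xs))) ^ d"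

text \<open>The running time includes reading the input and writing the output.\<close>

definition runs_within :: "com \<Rightarrow> nat \<Rightarrow> nat list \<Rightarrow> real \<Rightarrow> (nat list \<Rightarrow> bool) \<Rightarrow> bool" where
  "runs_within c d xs t Q \<longleftrightarrow>
     (\<exists>k s. exec (word_bound d xs) c (init xs) k s \<and>
        real (length xs + k + length (result s)) \<le> t \<and> Q (result s))"

definition computable :: "(nat list \<Rightarrow> nat) \<Rightarrow> bool" where
  "computable f \<longleftrightarrow> (\<exists>c. \<forall>xs. \<exists>W t s. exec W c (init xs) t s \<and> result s = [f xs])"

text \<open>The length of the binary encoding, with one separator symbol per number.\<close>

definition enc_length :: "nat list \<Rightarrow> nat" where
  "enc_length xs = (\<Sum>x\<leftarrow>xs. Suc (floorlog 2 x))"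


section \<open>Graphs and shortest paths\<close>

text \<open>Graphs have the nodes \<open>0, \<dots>, n - 1\<close>; edges are two-element sets of nodes.\<close>

definition ugraph :: "nat \<Rightarrow> nat set set \<Rightarrow> bool" where
  "ugraph n E \<longleftrightarrow> (\<forall>e\<in>E. \<exists>u v. u < n \<and> v < n \<and> u \<noteq> v \<and> e = {u, v})"

definition path_edges :: "nat list \<Rightarrow> nat set list" where
  "path_edges p = map (\<lambda>(x, y). {x, y}) (zip p (tl p))"

definition simple_path :: "nat set set \<Rightarrow> nat \<Rightarrow> nat \<Rightarrow> nat list \<Rightarrow> bool" where
  "simple_path E u v p \<longleftrightarrow>
     p \<noteq> [] \<and> hd p = u \<and> last p = v \<and> distinct p \<and> set (path_edges p) \<subseteq> E"

definition connected_graph :: "nat \<Rightarrow> nat set set \<Rightarrow> bool" where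
  "connected_graph n E \<longleftrightarrow>
     0 < n \<and> ugraph n E \<and> (\<forall>u<n. \<forall>v<n. \<exists>p. simple_path E u v p)"

definition path_length :: "(nat set \<Rightarrow> nat) \<Rightarrow> nat list \<Rightarrow> nat" where
  "path_length l p = (\<Sum>e\<leftarrow>path_edges p. l e)"

text \<open>The distance is \<open>\<infinity>\<close> if there is no path.\<close>

definition path_dist :: "nat set set \<Rightarrow> (nat set \<Rightarrow> nat) \<Rightarrow> nat \<Rightarrow> nat \<Rightarrow> ereal" where
  "path_dist E l u v = (INF p\<in>{p. simple_path E u v p}. ereal (real (path_length l p)))"

definition lists_edges :: "(nat \<times> nat) list \<Rightarrow> nat set set \<Rightarrow> bool" where
  "lists_edges es E \<longleftrightarrow>
     distinct (map (\<lambda>(u, v). {u, v}) es) \<and> set (map (\<lambda>(u, v). {u, v}) es) = E"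

definition edge_code :: "(nat set \<Rightarrow> nat) \<Rightarrow> (nat \<times> nat) list \<Rightarrow> nat list" where
  "edge_code l es = concat (map (\<lambda>(u, v). [u, v, l {u, v}]) es)"

text \<open>\<open>S n m\<close> is an upper bound for the running time of some algorithm for the single-pair
  shortest path problem.\<close>

definition spsp_time :: "(nat \<Rightarrow> nat \<Rightarrow> nat) \<Rightarrow> bool" where
  "spsp_time S \<longleftrightarrow>
     (\<exists>c d. \<forall>n E l es s t.
        connected_graph n E \<and> (\<forall>e\<in>E. 1 \<le> l e) \<and> lists_edges es E \<and> s < n \<and> t < n \<longrightarrow>
        runs_within c d ([n, length es, s, t] @ edge_code l es) (real (S n (card E)))
          (\<lambda>ys. \<exists>k. ys = [k] \<and> ereal (real k) = path_dist E l s t))"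

text \<open>\<open>a\<close> and \<open>b\<close> are the lengths of a shortest and of a second shortest simple path; \<open>b = 0\<close>
  indicates that there is only one path (lengths of nontrivial paths are positive).\<close>

definition two_shortest ::
  "nat set set \<Rightarrow> (nat set \<Rightarrow> nat) \<Rightarrow> nat \<Rightarrow> nat \<Rightarrow> nat \<Rightarrow> nat \<Rightarrow> bool" where
  "two_shortest E l u v a b \<longleftrightarrow>
     (\<exists>p. simple_path E u v p \<and> path_length l p = a \<and>
        (\<forall>q. simple_path E u v q \<longrightarrow> a \<le> path_length l q) \<and>
        ((\<exists>q. simple_path E u v q \<and> q \<noteq> p \<and> path_length l q = b \<and>
            (\<forall>r. simple_path E u v r \<and> r \<noteq> p \<longrightarrow> b \<le> path_length l r)) \<or>
         (b = 0 \<and> (\<forall>q. simple_path E u v q \<longrightarrow> q = p))))"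

definition apsp2_time :: "(nat \<Rightarrow> nat \<Rightarrow> nat) \<Rightarrow> bool" where
  "apsp2_time A \<longleftrightarrow>
     (\<exists>c d. \<forall>n E l es.
        connected_graph n E \<and> (\<forall>e\<in>E. 1 \<le> l e) \<and> lists_edges es E \<longrightarrow>
        runs_within c d ([n, length es] @ edge_code l es) (real (A n (card E)))
          (\<lambda>ys. length ys = 2 * n * n \<and>
             (\<forall>u<n. \<forall>v<n. two_shortest E l u v
                (ys ! (2 * (u * n + v))) (ys ! (2 * (u * n + v) + 1)))))"

definition polynomially_bounded :: "(nat \<Rightarrow> nat \<Rightarrow> nat) \<Rightarrow> bool" where
  "polynomially_bounded g \<longleftrightarrow> (\<exists>p :: nat poly. \<forall>n m. g n m \<le> poly p (n + m))"


section \<open>Spanners\<close>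

record spanner_inst =
  nodes :: nat
  edges :: "nat set set"
  weight :: "nat set \<Rightarrow> nat"
  len :: "nat set \<Rightarrow> nat"
  stretch :: rat
  removals :: nat

definition is_spanner :: "spanner_inst \<Rightarrow> nat set set \<Rightarrow> bool" where
  "is_spanner I F \<longleftrightarrow> F \<subseteq> edges I \<and>
     (\<forall>u<nodes I. \<forall>v<nodes I.
        path_dist F (len I) u v
          \<le> ereal (real_of_rat (stretch I)) * path_dist (edges I) (len I) u v)"

definition settling :: "spanner_inst \<Rightarrow> nat \<Rightarrow> nat \<Rightarrow> nat list \<Rightarrow> bool" where
  "settling I u v p \<longleftrightarrow> simple_path (edges I) u v p \<and>
     ereal (real (path_length (len I) p))
       \<le> ereal (real_of_rat (stretch I)) * path_dist (edges I) (len I) u v"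

definition alternative :: "nat \<Rightarrow> nat \<Rightarrow> nat list \<Rightarrow> bool" where
  "alternative u v p \<longleftrightarrow> {u, v} \<notin> set (path_edges p)"

definition mandatory_edges :: "spanner_inst \<Rightarrow> nat set set" where
  "mandatory_edges I =
     {e \<in> edges I. \<forall>u v. e = {u, v} \<longrightarrow> (\<nexists>p. settling I u v p \<and> alternative u v p)}"

definition trivial_edges :: "spanner_inst \<Rightarrow> nat set set" where
  "trivial_edges I = mandatory_edges I \<union> {e \<in> edges I. weight I e = 0}"

definition nontrivial_edges :: "spanner_inst \<Rightarrow> nat set set" where
  "nontrivial_edges I = edges I - trivial_edges I"

definition critical_pairs :: "spanner_inst \<Rightarrow> nat set set" where
  "critical_pairs I =
     {e \<in> edges I. \<forall>u v. e = {u, v} \<longrightarrow>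
        (\<nexists>p. settling I u v p \<and> set (path_edges p) \<subseteq> trivial_edges I)}"

definition nontrivial_part :: "spanner_inst \<Rightarrow> nat list \<Rightarrow> nat set set" where
  "nontrivial_part I p = set (path_edges p) \<inter> nontrivial_edges I"

definition tightest_path :: "spanner_inst \<Rightarrow> nat \<Rightarrow> nat \<Rightarrow> nat list" where
  "tightest_path I u v =
     (ARG_MIN (\<lambda>p. card (nontrivial_part I p)) p. settling I u v p \<and> alternative u v p)"

text \<open>The maximum is taken to be 0 if there are no critical pairs.\<close>

definition tightness :: "spanner_inst \<Rightarrow> nat" where
  "tightness I =
     Max (insert 0 {card (nontrivial_part I (tightest_path I u v)) | u v.
       {u, v} \<in> critical_pairs I})"

text \<open>The last condition is the convention that edges that do not settle themselves have been
  removed from the instance.\<close>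

definition unit_weight_inst :: "spanner_inst \<Rightarrow> bool" where
  "unit_weight_inst I \<longleftrightarrow>
     connected_graph (nodes I) (edges I) \<and>
     (\<forall>e\<in>edges I. weight I e = 1) \<and>
     (\<forall>e\<in>edges I. 1 \<le> len I e) \<and>
     1 \<le> stretch I \<and>
     (\<forall>u v. {u, v} \<in> edges I \<longrightarrow>
        ereal (real (len I {u, v}))
          \<le> ereal (real_of_rat (stretch I)) * path_dist (edges I) (len I) u v)"

definition basic_inst :: "spanner_inst \<Rightarrow> bool" where
  "basic_inst I \<longleftrightarrow> unit_weight_inst I \<and> (\<forall>e\<in>edges I. len I e = 1)"

definition solution :: "spanner_inst \<Rightarrow> nat set set \<Rightarrow> bool" where
  "solution I F \<longleftrightarrow> is_spanner I F \<and> removals I \<le> card (nontrivial_edges I - F)"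


section \<open>Algorithms for the spanner problem\<close>

definition rat_code :: "rat \<Rightarrow> nat list" where
  "rat_code a = [nat (fst (quotient_of a)), nat (snd (quotient_of a))]"

definition inst_code :: "spanner_inst \<Rightarrow> (nat \<times> nat) list \<Rightarrow> nat list" where
  "inst_code I es =
     [nodes I, length es, removals I] @ rat_code (stretch I) @ edge_code (len I) es"

text \<open>Asymptotic bounds hold uniformly for all instances; the summand 1 only matters where the
  bound vanishes.\<close>

definition decides_in ::
  "com \<Rightarrow> (spanner_inst \<Rightarrow> bool) \<Rightarrow> (spanner_inst \<Rightarrow> real) \<Rightarrow> bool" where
  "decides_in c X T \<longleftrightarrow>
     (\<exists>d K. \<forall>I es. X I \<and> lists_edges es (edges I) \<longrightarrow>
        runs_within c d (inst_code I es) (K * (T I + 1))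
          (\<lambda>ys. ys = [if \<exists>F. solution I F then 1 else 0]))"

text \<open>A witness is reported by the indicator function of \<open>F\<close>, in the order in which the edges occur
  in the input.\<close>

definition finds_witness_in ::
  "com \<Rightarrow> (spanner_inst \<Rightarrow> bool) \<Rightarrow> (spanner_inst \<Rightarrow> real) \<Rightarrow> bool" where
  "finds_witness_in c X T \<longleftrightarrow>
     (\<exists>d K. \<forall>I es. X I \<and> lists_edges es (edges I) \<longrightarrow>
        runs_within c d (inst_code I es) (K * (T I + 1))
          (\<lambda>ys. if \<exists>F. solution I F
             then \<exists>F. solution I F \<and> ys = 1 # map (\<lambda>(u, v). if {u, v} \<in> F then 1 else 0) es
             else ys = [0]))"

definition fpt ::
  "com \<Rightarrow> (spanner_inst \<Rightarrow> bool) \<Rightarrow> (spanner_inst \<Rightarrow> nat list) \<Rightarrow> bool" where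
  "fpt c X param \<longleftrightarrow>
     (\<exists>d f p. computable f \<and>
        (\<forall>I es. X I \<and> lists_edges es (edges I) \<longrightarrow>
           runs_within c d (inst_code I es)
             (real (f (param I) * poly p (enc_length (inst_code I es)))) (\<lambda>_. True)))"

end

theory Submission
  imports Defs
begin

text \<open>
  With unit weights the trivial edges are the mandatory ones.  Every nontrivial edge has an
  alternative settling path with at most \<open>\<tau>\<close> nontrivial edges, and a digraph with out-degree at most
  \<open>\<tau>\<close> on \<open>\<rho> (2 \<tau> + 1)\<close> nodes has an independent set of size \<open>\<rho>\<close>; hence among any
  \<open>\<rho> (2 \<tau> + 1)\<close> nontrivial edges there are \<open>\<rho>\<close> that can be removed together.  Enumerating the
  \<open>\<rho>\<close>-subsets of the nontrivial edges in colexicographic order therefore either finds a solution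
  among the first \<open>\<rho> (2 \<tau> + 1)\<close> choose \<open>\<rho>\<close> subsets or runs out of subsets before that, without
  knowing \<open>\<tau>\<close>.  To test a subset, each of its critical edges needs one shortest path computation in
  the graph in which the removed edges are not deleted but made too long to be used, so that it stays
  connected.  An edge is nontrivial iff its second shortest path is settling.  Noncritical edges are
  found by a second call for two shortest paths, with all nontrivial edges lengthened, and never need
  a test; so no shortest path is computed if \<open>\<tau> = 0\<close>.

  For unit lengths, one breadth-first search from \<open>s\<close> that labels every node with its branch replaces
  two shortest paths: an alternative path from \<open>s\<close> to a neighbour \<open>w\<close> has to enter the branch of \<open>w\<close>
  through an edge between two branches.
\<close>

section \<open>A program logic for the machine\<close>

text \<open>Three demands shape the proof. First, the programs know \<open>\<rho>\<close> but not
  \<open>\<tau>\<close>, and finding \<open>\<tau>\<close> would be a path problem with two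
  criteria. In colexicographic order the subsets of the first \<open>k0\<close> candidates precede
  all others, whatever \<open>k0\<close> is, so \<open>k0\<close> occurs in the analysis only.
  Second, an oracle is specified only for connected graphs with positive lengths, and its time
  bounds for different numbers of edges are unrelated. Making edges long instead of deleting them
  keeps nodes, edges and hence the bound fixed, at the price of lengths up to the cube of the word
  base. Third, the time bounds have to pay for the overhead of the caller. The running time of an
  oracle includes reading its input and writing its output, so it dominates \<open>m\<close>, and
  for all pairs also \<open>n ^ 2\<close>. For \<open>\<tau> = 0\<close> only the all-pairs term is
  left, which is why noncritical edges are sorted out beforehand. The factor
  \<open>2 * \<tau> + 1\<close> counts a node of the digraph together with at most
  \<open>\<tau>\<close> successors and \<open>\<tau>\<close> predecessors.\<close>

lemma word_mono: "word W x = Some y \<Longrightarrow> W \<le> W' \<Longrightarrow> word W' x = Some y"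
  by (simp add: word_def split: if_splits)

lemma eval_exp_mono:
  assumes "eval_exp W s e = Some x" "W \<le> W'"
  shows "eval_exp W' s e = Some x"
  using assms(1)
proof (induction e arbitrary: x)
  case (Read a e)
  then obtain i where "eval_exp W s e = Some i" "i < length (snd s a)" "word W (snd s a ! i) = Some x"
    by (auto simp: bind_eq_Some_conv split: if_splits)
  then show ?case using Read.IH word_mono[OF _ assms(2)] by simp
next
  case (Op f e1 e2)
  then obtain y z where "eval_exp W s e1 = Some y" "eval_exp W s e2 = Some z"
    "word W (apply_op f y z) = Some x"
    by (auto simp: bind_eq_Some_conv)
  then show ?case using Op.IH word_mono[OF _ assms(2)] by simp
qed (simp_all add: word_mono[OF _ assms(2)])

text \<open>An oracle program is specified for the word bound of its own input; monotonicity lets it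
  run inside a caller with larger words.\<close>

lemma exec_mono:
  assumes "exec W c s t s'" "W \<le> W'"
  shows "exec W' c s t s'"
  using assms(1)
proof induction
  case (IfFalse s e c2 t s' c1)
  then show ?case by (intro exec.IfFalse eval_exp_mono[OF _ assms(2)])
next
  case (WhileFalse s e c)
  then show ?case by (intro exec.WhileFalse eval_exp_mono[OF _ assms(2)])
qed (rule exec.Assign exec.New exec.Write exec.Seq exec.IfTrue exec.WhileTrue exec.Call;
     (assumption | erule eval_exp_mono[OF _ assms(2)]))+

text \<open>Total evaluation, so that the simplifier can compute with it. The two ways to get stuck
  are split off: array bounds into \<open>in_range\<close>, overflow into the purely syntactic
  \<open>deg_within\<close>.\<close>

fun val :: "state \<Rightarrow> exp \<Rightarrow> nat" where
  "val s (Const k) = k"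
| "val s (Reg x) = fst s x"
| "val s (Len a) = length (snd s a)"
| "val s (Read a e) = snd s a ! val s e"
| "val s (Op f e1 e2) = apply_op f (val s e1) (val s e2)"

fun in_range :: "state \<Rightarrow> exp \<Rightarrow> bool" where
  "in_range s (Read a e) \<longleftrightarrow> in_range s e \<and> val s e < length (snd s a)"
| "in_range s (Op f e1 e2) \<longleftrightarrow> in_range s e1 \<and> in_range s e2"
| "in_range s _ \<longleftrightarrow> True"

text \<open>If all stored values are at most \<open>M\<close>, then the value of \<open>e\<close> is at most
  \<open>(M + 2) ^ exp_deg e\<close>.\<close>

fun exp_deg :: "exp \<Rightarrow> nat" where
  "exp_deg (Const k) = k"
| "exp_deg (Op Plus e1 e2) = Suc (max (exp_deg e1) (exp_deg e2))"
| "exp_deg (Op Times e1 e2) = exp_deg e1 + exp_deg e2"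
| "exp_deg (Op Minus e1 e2) = exp_deg e1"
| "exp_deg (Op Divide e1 e2) = exp_deg e1"
| "exp_deg _ = 1"

text \<open>The semantics checks intermediate results against the word bound as well, so every
  subexpression is constrained.\<close>

fun deg_within :: "nat \<Rightarrow> exp \<Rightarrow> bool" where
  "deg_within D (Read a e) \<longleftrightarrow> 1 \<le> D \<and> deg_within D e"
| "deg_within D (Op f e1 e2) \<longleftrightarrow> exp_deg (Op f e1 e2) \<le> D \<and> deg_within D e1 \<and> deg_within D e2"
| "deg_within D e \<longleftrightarrow> exp_deg e \<le> D"

definition bounded_state :: "nat \<Rightarrow> state \<Rightarrow> bool" where
  "bounded_state M s \<longleftrightarrow> (\<forall>r. fst s r \<le> M) \<and>
     (\<forall>a. length (snd s a) \<le> M \<and> (\<forall>x\<in>set (snd s a). x \<le> M))"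

text \<open>The base is at least 2: \<open>k < 2 ^ k\<close> makes a constant its own degree, and a
  sum of two powers needs only one factor more than the larger of them.\<close>

lemma val_le:
  assumes "bounded_state M s" "in_range s e"
  shows "val s e \<le> (M + 2) ^ exp_deg e"
  using assms(2)
proof (induction e)
  case (Const k)
  have "k < 2 ^ k" by simp
  also have "(2::nat) ^ k \<le> (M + 2) ^ k" by (intro power_mono) auto
  finally show ?case by simp
next
  case (Op f e1 e2)
  let ?B = "M + 2"
  have 1: "val s e1 \<le> ?B ^ exp_deg e1" and 2: "val s e2 \<le> ?B ^ exp_deg e2"
    using Op by auto
  show ?case
  proof (cases f)
    case Plus
    have "val s e1 + val s e2 \<le> ?B ^ max (exp_deg e1) (exp_deg e2) + ?B ^ max (exp_deg e1) (exp_deg e2)"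
      using 1 2 by (intro add_mono order.trans[OF 1] order.trans[OF 2] power_increasing) auto
    also have "\<dots> \<le> ?B * ?B ^ max (exp_deg e1) (exp_deg e2)" by (simp add: algebra_simps)
    finally show ?thesis using Plus by simp
  next
    case Divide
    then show ?thesis using 1 div_le_dividend[of "val s e1" "val s e2"] by (simp del: div_le_dividend)
  qed (use 1 2 in \<open>auto simp: power_add intro: mult_mono\<close>)
next
  case (Read a e)
  then have "snd s a ! val s e \<in> set (snd s a)" by simp
  then have "snd s a ! val s e \<le> M" using assms(1) unfolding bounded_state_def by blast
  then show ?case by simp
qed (use assms(1) in \<open>auto simp: bounded_state_def intro: le_SucI\<close>)

text \<open>Unlike in \<open>runs_within\<close>, the word bound is a free parameter and the lengths
  of input and output are not charged, so that the notion suits subprograms; \<open>wp_Call\<close>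
  charges these lengths.\<close>

definition computes :: "nat \<Rightarrow> com \<Rightarrow> nat list \<Rightarrow> nat \<Rightarrow> (nat list \<Rightarrow> bool) \<Rightarrow> bool" where
  "computes W c xs t Q \<longleftrightarrow> (\<exists>k s. exec W c (init xs) k s \<and> k \<le> t \<and> Q (result s))"

lemma computes_mono:
  assumes "computes W c xs t Q" "W \<le> W'" "t \<le> t'" "\<And>ys. Q ys \<Longrightarrow> Q' ys"
  shows "computes W' c xs t' Q'"
  using assms exec_mono[OF _ assms(2)] unfolding computes_def by (blast intro: le_trans)

text \<open>\<open>M\<close> bounds all stored values, \<open>W\<close> also all intermediate results.\<close>

locale machine =
  fixes M W :: nat
  assumes word_large: "(M + 2) ^ 12 \<le> W"
begin

text \<open>The exponent 12 leaves room for every expression of the programs below. As a constant is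
  its own degree, it also limits the constants in their text.\<close>

lemma eval_exp_val:
  assumes "bounded_state M s" "in_range s e" "deg_within 12 e"
  shows "eval_exp W s e = Some (val s e)"
proof -
  have le: "val s e' \<le> W" if "in_range s e'" "exp_deg e' \<le> 12" for e'
  proof -
    have "val s e' \<le> (M + 2) ^ exp_deg e'" using val_le assms(1) that(1) .
    also have "\<dots> \<le> (M + 2) ^ 12" using that(2) by (intro power_increasing) auto
    finally show ?thesis using word_large by simp
  qed
  show ?thesis
    using assms(2,3)
  proof (induction e)
    case (Op f e1 e2)
    then show ?case using le[of "Op f e1 e2"] by (auto simp: word_def)
  qed (use le[of "Const _"] le[of "Reg _"] le[of "Len _"] le[of "Read _ _"] in
      \<open>auto simp: word_def\<close>)
qed

text \<open>A weakest precondition for total correctness whose postcondition sees the number of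
  steps. Boundedness of the state is carried along by the definition, so that each rule only has to
  justify newly stored values.\<close>

definition wp :: "com \<Rightarrow> state \<Rightarrow> (nat \<Rightarrow> state \<Rightarrow> bool) \<Rightarrow> bool" where
  "wp c s Q \<longleftrightarrow> (bounded_state M s \<longrightarrow>
     (\<exists>k s'. exec W c s k s' \<and> bounded_state M s' \<and> Q k s'))"

lemma wp_conseq:
  assumes "wp c s Q" "\<And>k s'. bounded_state M s' \<Longrightarrow> Q k s' \<Longrightarrow> Q' k s'"
  shows "wp c s Q'"
  using assms unfolding wp_def by blast

lemma wp_Assign:
  assumes "Q 1 ((fst s)(r := val s e), snd s)" "deg_within 12 e" "in_range s e" "val s e \<le> M"
  shows "wp (Assign r e) s Q"
  unfolding wp_def
proof
  assume b: "bounded_state M s"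
  have "bounded_state M ((fst s)(r := val s e), snd s)"
    using b assms(4) by (auto simp: bounded_state_def)
  then show "\<exists>k s'. exec W (Assign r e) s k s' \<and> bounded_state M s' \<and> Q k s'"
    using exec.Assign[OF eval_exp_val[OF b assms(3,2)]] assms(1) by blast
qed

lemma wp_New:
  assumes "Q (1 + val s e) (fst s, (snd s)(a := replicate (val s e) 0))"
    "deg_within 12 e" "in_range s e" "val s e \<le> M"
  shows "wp (New a e) s Q"
  unfolding wp_def
proof
  assume b: "bounded_state M s"
  have "bounded_state M (fst s, (snd s)(a := replicate (val s e) 0))"
    using b assms(4) by (auto simp: bounded_state_def)
  then show "\<exists>k s'. exec W (New a e) s k s' \<and> bounded_state M s' \<and> Q k s'"
    using exec.New[OF eval_exp_val[OF b assms(3,2)]] assms(1) by blast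
qed

lemma wp_Write:
  assumes "Q 1 (fst s, (snd s)(a := (snd s a)[val s e1 := val s e2]))"
    "deg_within 12 e1" "in_range s e1" "deg_within 12 e2" "in_range s e2"
    "val s e1 < length (snd s a)" "val s e2 \<le> M"
  shows "wp (Write a e1 e2) s Q"
  unfolding wp_def
proof
  assume b: "bounded_state M s"
  have "bounded_state M (fst s, (snd s)(a := (snd s a)[val s e1 := val s e2]))"
    using b assms(7) set_update_subset_insert[of "snd s a"]
    by (fastforce simp: bounded_state_def)
  then show "\<exists>k s'. exec W (Write a e1 e2) s k s' \<and> bounded_state M s' \<and> Q k s'"
    using exec.Write[OF eval_exp_val[OF b assms(3,2)] eval_exp_val[OF b assms(5,4)] assms(6)] assms(1)
    by blast
qed

lemma wp_Seq:
  assumes "wp c1 s (\<lambda>k s'. wp c2 s' (\<lambda>k'. Q (k + k')))"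
  shows "wp (Seq c1 c2) s Q"
  unfolding wp_def
proof
  assume "bounded_state M s"
  then obtain k s1 where 1: "exec W c1 s k s1" "bounded_state M s1" "wp c2 s1 (\<lambda>k'. Q (k + k'))"
    using assms unfolding wp_def by blast
  then obtain k' s2 where "exec W c2 s1 k' s2" "bounded_state M s2" "Q (k + k') s2"
    unfolding wp_def by blast
  then show "\<exists>k s'. exec W (Seq c1 c2) s k s' \<and> bounded_state M s' \<and> Q k s'"
    using exec.Seq[OF 1(1)] by blast
qed

lemma wp_If:
  assumes "val s e \<noteq> 0 \<Longrightarrow> wp c1 s (\<lambda>k. Q (1 + k))" "val s e = 0 \<Longrightarrow> wp c2 s (\<lambda>k. Q (1 + k))"
    "deg_within 12 e" "in_range s e"
  shows "wp (If e c1 c2) s Q"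
  unfolding wp_def
proof
  assume b: "bounded_state M s"
  note ev = eval_exp_val[OF b assms(4,3)]
  show "\<exists>k s'. exec W (If e c1 c2) s k s' \<and> bounded_state M s' \<and> Q k s'"
  proof (cases "val s e = 0")
    case True
    then obtain k s' where "exec W c2 s k s'" "bounded_state M s'" "Q (1 + k) s'"
      using assms(2) b unfolding wp_def by blast
    then show ?thesis using exec.IfFalse[of W s e c2 k s' c1] ev True by metis
  next
    case False
    then obtain k s' where "exec W c1 s k s'" "bounded_state M s'" "Q (1 + k) s'"
      using assms(1) b unfolding wp_def by blast
    then show ?thesis using exec.IfTrue[OF ev False] by blast
  qed
qed

text \<open>\<open>\<Phi>\<close> is a potential that pays for the remaining iterations.\<close>

lemma wp_While:
  assumes "I s" "deg_within 12 e"
    "\<And>s. bounded_state M s \<Longrightarrow> I s \<Longrightarrow> in_range s e"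
    "\<And>s. bounded_state M s \<Longrightarrow> I s \<Longrightarrow> val s e \<noteq> 0 \<Longrightarrow> wp c s (\<lambda>k s'. I s' \<and> k + 1 + \<Phi> s' \<le> \<Phi> s)"
    "\<And>k s'. bounded_state M s' \<Longrightarrow> I s' \<Longrightarrow> val s' e = 0 \<Longrightarrow> k + \<Phi> s' \<le> \<Phi> s + 1 \<Longrightarrow> Q k s'"
  shows "wp (While e c) s Q"
proof -
  have "\<exists>k s'. exec W (While e c) s k s' \<and> bounded_state M s' \<and> I s' \<and> val s' e = 0 \<and> k + \<Phi> s' \<le> \<Phi> s + 1"
    if "bounded_state M s" "I s" for s
    using that
  proof (induction "\<Phi> s" arbitrary: s rule: less_induct)
    case less
    note ev = eval_exp_val[OF less(2) assms(3)[OF less(2,3)] assms(2)]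
    show ?case
    proof (cases "val s e = 0")
      case True
      then have "exec W (While e c) s 1 s" using ev exec.WhileFalse by metis
      then show ?thesis using less True by (intro exI[of _ 1] exI[of _ s]) auto
    next
      case False
      from assms(4)[OF less(2,3) False] less(2) obtain k s1 where
        1: "exec W c s k s1" "bounded_state M s1" "I s1" "k + 1 + \<Phi> s1 \<le> \<Phi> s"
        unfolding wp_def by blast
      with less(1)[of s1] obtain k' s' where
        2: "exec W (While e c) s1 k' s'" "bounded_state M s'" "I s'" "val s' e = 0" "k' + \<Phi> s' \<le> \<Phi> s1 + 1"
        by fastforce
      have "exec W (While e c) s (1 + k + k') s'"
        using exec.WhileTrue[OF ev False 1(1) 2(1)] .
      then show ?thesis using 1 2 by (intro exI[of _ "1 + k + k'"] exI[of _ s']) auto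
    qed
  qed
  then show ?thesis using assms(1,5) unfolding wp_def by blast
qed

text \<open>Internally the callee may use words up to \<open>W\<close>; only what it returns must
  again be bounded by \<open>M\<close>.\<close>

lemma wp_Call:
  assumes "computes W c (snd s a) t P"
    "\<And>ys. P ys \<Longrightarrow> length ys \<le> M \<and> (\<forall>y\<in>set ys. y \<le> M)"
    "\<And>k ys. P ys \<Longrightarrow> k \<le> 1 + length (snd s a) + t + length ys \<Longrightarrow> Q k (fst s, (snd s)(b := ys))"
  shows "wp (Call b c a) s Q"
  unfolding wp_def
proof
  assume bd: "bounded_state M s"
  from assms(1) obtain k s' where e: "exec W c (init (snd s a)) k s'" "k \<le> t" "P (result s')"
    unfolding computes_def by blast
  have "bounded_state M (fst s, (snd s)(b := result s'))"
    using bd assms(2)[OF e(3)] by (auto simp: bounded_state_def)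
  then show "\<exists>k s'. exec W (Call b c a) s k s' \<and> bounded_state M s' \<and> Q k s'"
    using exec.Call[OF e(1), of b] assms(3)[OF e(3), of "1 + length (snd s a) + k + length (result s')"] e(2)
    by (meson add_le_mono le_refl)
qed

lemma computesI:
  assumes "wp c (init xs) (\<lambda>k s. k \<le> t \<and> Q (result s))" "length xs \<le> M" "\<forall>x\<in>set xs. x \<le> M"
  shows "computes W c xs t Q"
proof -
  have "bounded_state M (init xs)" using assms(2,3) by (auto simp: bounded_state_def init_def)
  then show ?thesis using assms(1) unfolding wp_def computes_def by blast
qed

text \<open>Variants with explicit values, which keep the states small in long sequences.\<close>

lemma wp_Assign_to:
  assumes "Q 1 (rs(r := x), as)" "val (rs, as) e = x" "deg_within 12 e" "in_range (rs, as) e" "x \<le> M"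
  shows "wp (Assign r e) (rs, as) Q"
  using assms by (intro wp_Assign) auto

lemma wp_New_to:
  assumes "Q (1 + k) (rs, as(a := replicate k 0))" "val (rs, as) e = k" "deg_within 12 e" "in_range (rs, as) e" "k \<le> M"
  shows "wp (New a e) (rs, as) Q"
  using assms by (intro wp_New) auto

lemma wp_Write_to:
  assumes "Q 1 (rs, as(a := ys))" "(as a)[i := x] = ys" "i < length (as a)" "x \<le> M"
    "val (rs, as) e1 = i" "val (rs, as) e2 = x" "deg_within 12 e1" "in_range (rs, as) e1"
    "deg_within 12 e2" "in_range (rs, as) e2"
  shows "wp (Write a e1 e2) (rs, as) Q"
  using assms by (intro wp_Write) auto

end

abbreviation (input) plus_exp (infixl "[+]" 65) where "a [+] b \<equiv> Op Plus a b"
abbreviation (input) minus_exp (infixl "[-]" 65) where "a [-] b \<equiv> Op Minus a b"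
abbreviation (input) times_exp (infixl "[*]" 70) where "a [*] b \<equiv> Op Times a b"
abbreviation (input) less_exp (infix "[<]" 50) where "a [<] b \<equiv> Op Less a b"
abbreviation (input) equal_exp (infix "[=]" 50) where "a [=] b \<equiv> Op Equal a b"
abbreviation (input) seq_com (infixr ";;" 30) where "a ;; b \<equiv> Seq a b"
abbreviation (input) assign_com (infix "::=" 40) where "r ::= e \<equiv> Assign r e"
text \<open>No program below reads register 0, so overwriting it has no effect.\<close>

abbreviation (input) skip_com where "skip_com \<equiv> Assign 0 (Const 0)"
abbreviation (input) incr where "incr r \<equiv> Assign r (Op Plus (Reg r) (Const 1))"

context machine
begin

text \<open>Calling a program that does nothing copies an array.\<close>

lemma computes_skip: "computes W skip_com xs 1 (\<lambda>ys. ys = xs)"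
  unfolding computes_def
proof (intro exI conjI)
  show "exec W skip_com (init xs) 1 ((fst (init xs))(0 := 0), snd (init xs))"
    by (rule exec.Assign) (simp add: word_def)
qed (auto simp: init_def)

end

section \<open>Enumerating subsets of a given size\<close>

text \<open>The position of a strictly increasing list in the colexicographic order (combinatorial
  number system).\<close>

fun rank_from :: "nat \<Rightarrow> nat list \<Rightarrow> nat" where
  "rank_from i [] = 0"
| "rank_from i (x # xs) = (x choose Suc i) + rank_from (Suc i) xs"

abbreviation "rank \<equiv> rank_from 0"

lemma rank_from_append: "rank_from i (xs @ ys) = rank_from i xs + rank_from (i + length xs) ys"
  by (induction xs arbitrary: i) auto

definition combination :: "nat \<Rightarrow> nat \<Rightarrow> nat list \<Rightarrow> bool" where
  "combination k r c \<longleftrightarrow> length c = r \<and> sorted_wrt (<) c \<and> (\<forall>x\<in>set c. x < k)"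

text \<open>Induction on the largest entry \<open>x\<close>: the remaining entries have rank below
  \<open>x choose length c\<close>, and Pascal's rule adds this to the contribution
  \<open>x choose Suc (length c)\<close> of \<open>x\<close>.\<close>

lemma rank_less:
  assumes "sorted_wrt (<) c" "\<forall>x\<in>set c. x < k"
  shows "rank c < k choose length c"
  using assms
proof (induction c arbitrary: k rule: rev_induct)
  case (snoc x c)
  then have "rank c < x choose length c" by (auto simp: sorted_wrt_append)
  then have "rank (c @ [x]) < Suc x choose Suc (length c)" by (simp add: rank_from_append)
  also have "\<dots> \<le> k choose Suc (length c)" using snoc.prems by (intro binomial_right_mono) auto
  finally show ?case by simp
qed simp

text \<open>By \<open>rank_less\<close> the largest entry dominates the rank, so equal ranks force
  equal largest entries, and the rest follows by induction.\<close>

lemma rank_inj: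
  assumes "length c = length c'" "sorted_wrt (<) c" "sorted_wrt (<) c'" "rank c = rank c'"
  shows "c = c'"
  using assms
proof (induction c arbitrary: c' rule: rev_induct)
  case (snoc x c)
  then obtain d y where c': "c' = d @ [y]" by (metis length_append_singleton length_Suc_conv_rev)
  have len: "length d = length c" using snoc c' by simp
  have less: "rank (a @ [u]) < rank (b @ [v])"
    if "sorted_wrt (<) (a @ [u])" "length a = length b" "u < v" for a b u v
  proof -
    have "rank (a @ [u]) < Suc u choose Suc (length a)"
      using rank_less[OF that(1), of "Suc u"] that(1) by (auto simp: sorted_wrt_append less_Suc_eq)
    also have "\<dots> \<le> v choose Suc (length b)" unfolding that(2)
      using that(3) by (intro binomial_right_mono) simp
    also have "\<dots> \<le> rank (b @ [v])" by (simp add: rank_from_append)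
    finally show ?thesis .
  qed
  have "x = y"
    using less[of c x d y] less[of d y c x] snoc.prems len c' by (metis linorder_neqE_nat nat_neq_iff)
  then show ?case using snoc len c' by (auto simp: rank_from_append sorted_wrt_append)
qed simp

text \<open>The hockey-stick identity. The missing 1 is what advancing to the next combination
  gains.\<close>

lemma rank_upt: "rank [a..<a + j] + 1 = (a + j) choose j"
proof (induction j)
  case (Suc j)
  have "[a..<a + Suc j] = [a..<a + j] @ [a + j]" by simp
  then show ?case using Suc by (simp add: rank_from_append)
qed simp

section \<open>Successors in colexicographic order\<close>

definition run_of :: "nat \<Rightarrow> nat list \<Rightarrow> nat \<Rightarrow> bool" where
  "run_of k c j \<longleftrightarrow> (\<forall>i<j. c ! i + 1 = (c @ [k]) ! (i + 1))"

lemma run_of_take: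
  assumes "run_of k c j" "j < length c"
  shows "take (Suc j) c = [c ! 0..<c ! 0 + Suc j]"
proof (rule nth_equalityI)
  have nth: "c ! i = c ! 0 + i" if "i \<le> j" for i
    using that
  proof (induction i)
    case (Suc i)
    have "c ! i + 1 = (c @ [k]) ! (i + 1)" using assms(1) Suc(2) unfolding run_of_def by simp
    moreover have "(c @ [k]) ! (i + 1) = c ! Suc i" using Suc(2) assms(2) by (simp add: nth_append)
    ultimately show ?case using Suc by simp
  qed simp
  show "take (Suc j) c ! i = [c ! 0..<c ! 0 + Suc j] ! i" if "i < length (take (Suc j) c)" for i
    using that assms(2) nth[of i] by (simp del: upt_Suc)
qed (use assms(2) in auto)

text \<open>The usual successor rule: the first entry that can grow grows by one, and all smaller
  entries fall back to the least possible values.\<close>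

definition next_comb :: "nat list \<Rightarrow> nat \<Rightarrow> nat list" where
  "next_comb c j = [0..<j] @ (c ! j + 1) # drop (Suc j) c"

lemma sorted_wrt_le_nth: "sorted_wrt (<) c \<Longrightarrow> i < length c \<Longrightarrow> i \<le> (c ! i :: nat)"
proof (induction i)
  case (Suc i)
  then have "c ! i < c ! Suc i" by (simp add: sorted_wrt_nth_less)
  with Suc show ?case by simp
qed simp

text \<open>The replaced prefix is a run ending in \<open>c ! j\<close>, so by
  \<open>rank_upt\<close> its rank is one less than \<open>c ! j + 1 choose Suc j\<close>. This is
  the rank of the new prefix, since \<open>[0..<j]\<close> contributes 0.\<close>

lemma next_comb:
  assumes c: "combination k r c" and run: "run_of k c j" and j: "j < r"
    and stop: "c ! j + 1 \<noteq> (c @ [k]) ! (j + 1)"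
  shows "combination k r (next_comb c j)" "rank (next_comb c j) = Suc (rank c)"
proof -
  have len: "length c = r" and sorted: "sorted_wrt (<) c" and lt: "\<forall>x\<in>set c. x < k"
    using c by (auto simp: combination_def)
  have below: "c ! j + 1 < x" if x: "x \<in> set (drop (Suc j) c)" for x
  proof -
    obtain l where l: "l < length (drop (Suc j) c)" "x = drop (Suc j) c ! l"
      using x unfolding in_set_conv_nth by blast
    define i where "i = Suc j + l"
    have i: "Suc j \<le> i" "i < r" "x = c ! i"
      using l len by (auto simp: i_def)
    have "c ! j < c ! Suc j" using i j len sorted by (simp add: sorted_wrt_nth_less)
    moreover have "c ! Suc j \<le> c ! i"
      using i len sorted_wrt_nth_less[OF sorted, of "Suc j" i] by (cases "Suc j = i") auto
    ultimately show ?thesis using stop i j len by (simp add: nth_append)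
  qed
  have "c ! j + 1 < k \<or> Suc j < r"
  proof (cases "Suc j < r")
    case False
    then have "c ! j + 1 \<noteq> k" using stop j len by (simp add: nth_append)
    moreover have "c ! j < k" using lt j len by simp
    ultimately show ?thesis by simp
  qed simp
  then have ltk: "c ! j + 1 < k"
  proof
    assume "Suc j < r"
    then have "c ! Suc j \<in> set (drop (Suc j) c)" using len by (metis Cons_nth_drop_Suc list.set_intros(1))
    then show ?thesis using below lt len \<open>Suc j < r\<close> by (meson less_trans nth_mem)
  qed
  have 1: "sorted_wrt (<) (drop (Suc j) c)" using sorted by (rule sorted_wrt_drop)
  have 2: "x < y" if "x < j" "y \<in> set (drop (Suc j) c)" for x y
    using below[OF that(2)] that(1) sorted_wrt_le_nth[OF sorted, of j] j len by linarith
  have 3: "x < c ! j + 1" "x < k" if "x < j" for x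
    using sorted_wrt_le_nth[OF sorted, of j] ltk that j len by auto
  have 4: "x < k" if "x \<in> set (drop (Suc j) c)" for x
    using that lt by (meson in_set_dropD)
  have "sorted_wrt (<) (next_comb c j)"
    unfolding next_comb_def sorted_wrt_append list.set sorted_wrt.simps
    using 1 2 3(1) below by force
  moreover have "\<forall>x\<in>set (next_comb c j). x < k"
    unfolding next_comb_def set_append list.set using 3(2) 4 ltk by fastforce
  moreover have "length (next_comb c j) = r" using j len by (simp add: next_comb_def)
  ultimately show "combination k r (next_comb c j)" by (simp add: combination_def)
  have "rank (next_comb c j) = rank [0..<j] + (c ! j + 1 choose Suc j) + rank_from (Suc j) (drop (Suc j) c)"
    by (simp add: next_comb_def rank_from_append)
  also have "rank [0..<j] = 0" using rank_upt[of 0 j] by simp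
  finally have 1: "rank (next_comb c j) = (c ! j + 1 choose Suc j) + rank_from (Suc j) (drop (Suc j) c)" by simp
  have "rank c = rank (take (Suc j) c) + rank_from (Suc j) (drop (Suc j) c)"
    using rank_from_append[of 0 "take (Suc j) c" "drop (Suc j) c"] j len by simp
  moreover have "c ! j = c ! 0 + j"
  proof -
    have "take (Suc j) c ! j = c ! 0 + j"
      unfolding run_of_take[OF run j[folded len]] by (simp del: upt_Suc)
    then show ?thesis by simp
  qed
  ultimately show "rank (next_comb c j) = Suc (rank c)"
    using 1 rank_upt[of "c ! 0" "Suc j"] arg_cong[OF run_of_take[OF run], of rank] j len by simp
qed

text \<open>A run that extends to the sentinel \<open>k\<close> behind the last entry is
  \<open>[k - r..<k]\<close>, whose rank is given by \<open>rank_upt\<close>.\<close>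

lemma last_comb:
  assumes c: "combination k r c" and run: "run_of k c r"
  shows "Suc (rank c) = k choose r"
proof (cases r)
  case 0
  then show ?thesis using c by (simp add: combination_def)
next
  case (Suc j)
  have len: "length c = Suc j" using c Suc by (simp add: combination_def)
  have run': "run_of k c j" using run Suc by (simp add: run_of_def)
  have t: "c = [c ! 0..<c ! 0 + Suc j]" using run_of_take[OF run'] len by simp
  have "c ! j + 1 = k" using run len Suc by (auto simp: run_of_def nth_append)
  moreover have "c ! j = c ! 0 + j" using arg_cong[OF t, of "\<lambda>l. l ! j"] nth_upt[of "c ! 0" j "c ! 0 + Suc j"] by linarith
  ultimately have "c ! 0 + Suc j = k" by simp
  then show ?thesis using rank_upt[of "c ! 0" "Suc j"] arg_cong[OF t, of rank] Suc by simp
qed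

lemma combination_rank_less: "combination k r c \<Longrightarrow> rank c < k choose r"
  using rank_less by (auto simp: combination_def)

lemma combination_of_set:
  assumes "A \<subseteq> {..<k}"
  shows "combination k (card A) (sorted_list_of_set A)"
  using assms finite_subset[OF assms] by (auto simp: combination_def)

lemma combination_upt: "r \<le> k \<Longrightarrow> combination k r [0..<r]"
  by (auto simp: combination_def)

lemma rank_upt_0: "rank [0..<r] = 0"
  using rank_upt[of 0 r] by simp

section \<open>Counting loops and indicator arrays\<close>

definition For :: "nat \<Rightarrow> exp \<Rightarrow> exp \<Rightarrow> com \<Rightarrow> com" where
  "For i a e c = (i ::= a ;; While (Reg i [<] e) (c ;; incr i))"

text \<open>The body must establish the next invariant for the state with \<open>i\<close> already
  advanced, because \<open>incr\<close> follows it. Test and increment add 2 to the cost of each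
  iteration; the final 2 is the initial assignment and the failing test.\<close>

lemma (in machine) wp_For:
  assumes body: "\<And>j s. bounded_state M s \<Longrightarrow> I j s \<Longrightarrow> fst s i = j \<Longrightarrow> a \<le> j \<Longrightarrow> j < n \<Longrightarrow>
      wp c s (\<lambda>k s'. k \<le> b \<and> fst s' i = j \<and> I (Suc j) ((fst s')(i := Suc j), snd s'))"
    and post: "\<And>k s'. bounded_state M s' \<Longrightarrow> I n s' \<Longrightarrow> fst s' i = n \<Longrightarrow> k \<le> (b + 2) * (n - a) + 2 \<Longrightarrow> Q k s'"
    and init: "I a ((fst s)(i := a), snd s)"
    and a: "deg_within 12 ea" "in_range s ea" "val s ea = a" "a \<le> n" "n \<le> M"
    and e: "deg_within 12 e" "\<And>j s. I j s \<Longrightarrow> in_range s e \<and> val s e = n"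
  shows "wp (For i ea e c) s Q"
  unfolding For_def
proof (rule wp_Seq, rule wp_Assign)
  let ?I = "\<lambda>s. a \<le> fst s i \<and> fst s i \<le> n \<and> I (fst s i) s"
  let ?\<Phi> = "\<lambda>s. (b + 2) * (n - fst s i)"
  let ?s = "((fst s)(i := val s ea), snd s)"
  show "wp (While (Reg i [<] e) (c ;; incr i)) ?s (\<lambda>k'. Q (1 + k'))"
  proof (rule wp_While[where I = ?I and \<Phi> = ?\<Phi>])
    show "?I ?s" using a init by simp
    show "deg_within 12 (Reg i [<] e)" using e by simp
  next
    fix s assume b: "bounded_state M s" and I: "?I s" and "val s (Reg i [<] e) \<noteq> 0"
    then have lt: "fst s i < n" using e(2)[of "fst s i" s] by (auto split: if_splits)
    show "wp (c ;; incr i) s (\<lambda>k s'. ?I s' \<and> k + 1 + ?\<Phi> s' \<le> ?\<Phi> s)"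
    proof (rule wp_Seq, rule wp_conseq[OF body[of s "fst s i"]])
      fix k s' assume *: "k \<le> b \<and> fst s' i = fst s i \<and> I (Suc (fst s i)) ((fst s')(i := Suc (fst s i)), snd s')"
      have "k + 2 + (b + 2) * d \<le> (b + 2) * Suc d" for d using * by simp
      moreover have "n - fst s i = Suc (n - Suc (fst s i))" using lt by simp
      ultimately have "k + 2 + (b + 2) * (n - Suc (fst s i)) \<le> (b + 2) * (n - fst s i)" by metis
      then show "wp (incr i) s' (\<lambda>k' s'. ?I s' \<and> k + k' + 1 + ?\<Phi> s' \<le> ?\<Phi> s)"
        using * I lt a(5) by (intro wp_Assign) auto
    qed (use b I lt in auto)
  next
    fix k s' assume b: "bounded_state M s'" and I: "?I s'" and "val s' (Reg i [<] e) = 0"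
      and k: "k + ?\<Phi> s' \<le> ?\<Phi> ?s + 1"
    then have "fst s' i = n" using e(2)[of "fst s' i" s'] by (auto split: if_splits)
    then show "Q (1 + k) s'" using post[OF b] I k a(3) by simp
  qed (use e(2) in auto)
qed (use a in auto)

definition indicator_list :: "nat \<Rightarrow> nat set \<Rightarrow> nat list" where
  "indicator_list m A = map (\<lambda>i. if i \<in> A then 1 else 0) [0..<m]"

lemma length_indicator_list [simp]: "length (indicator_list m A) = m"
  by (simp add: indicator_list_def)

lemma nth_indicator_list [simp]: "i < m \<Longrightarrow> indicator_list m A ! i = (if i \<in> A then 1 else 0)"
  by (simp add: indicator_list_def)

lemma indicator_list_update:
  assumes "i < m"
  shows "(indicator_list m A)[i := Suc 0] = indicator_list m (insert i A)"
    "(indicator_list m A)[i := 0] = indicator_list m (A - {i})"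
  using assms by (auto intro!: nth_equalityI simp: nth_list_update)

lemma indicator_list_empty: "indicator_list m {} = replicate m 0"
  by (auto intro!: nth_equalityI)

section \<open>Searching for a subset of a given size\<close>

text \<open>Register 2 holds \<open>m\<close>, 3 the subset size, 4 the number of candidates, 7 the
  verdict on the current set, 8 whether to continue, and 10 the length of the input, which is the
  offset of the indicator in array 5.\<close>

definition mark_com :: "exp \<Rightarrow> com" where
  "mark_com v = For 5 (Const 0) (Reg 3) (Write 5 (Reg 10 [+] Read 3 (Read 4 (Reg 5))) v)"

definition test_com :: "com \<Rightarrow> com" where
  "test_com cc = (7 ::= Const 1 ;;
     For 5 (Const 0) (Reg 3) (
       6 ::= Read 3 (Read 4 (Reg 5)) ;;
       If (Read 2 (Reg 6) [=] Const 1)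
         (Write 5 (Reg 10 [+] Reg 2) (Reg 6) ;;
          Call 6 cc 5 ;;
          If (Read 6 (Const 0)) skip_com (7 ::= Const 0))
         skip_com))"

text \<open>The entries of the run can be reset while it is scanned, since the comparison only looks
  ahead. The second sentinel 0 stops the loop at position \<open>r\<close>, because 0 is not a
  successor.\<close>

definition next_com :: com where
  "next_com = (5 ::= Const 0 ;;
     While (Read 4 (Reg 5) [+] Const 1 [=] Read 4 (Reg 5 [+] Const 1))
       (Write 4 (Reg 5) (Reg 5) ;; incr 5) ;;
     If (Reg 5 [<] Reg 3) (Write 4 (Reg 5) (Read 4 (Reg 5) [+] Const 1)) (8 ::= Const 0))"

text \<open>Only the marked positions are cleared again, so a subset without elements to check costs
  a time linear in its size, independently of \<open>m\<close>.\<close>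

definition enum_com :: "com \<Rightarrow> com" where
  "enum_com cc = While (Reg 8)
     (mark_com (Const 1) ;;
      test_com cc ;;
      If (Reg 7) (8 ::= Const 0) (mark_com (Const 0) ;; next_com))"

definition select_com :: com where
  "select_com = (New 3 (Reg 2) ;; 4 ::= Const 0 ;;
     For 5 (Const 0) (Reg 2)
       (If (Read 2 (Reg 5)) (Write 3 (Reg 4) (Reg 5) ;; incr 4) skip_com))"

definition start_com :: com where
  "start_com = (
     New 4 (Reg 3 [+] Const 2) ;;
     For 5 (Const 0) (Reg 3) (Write 4 (Reg 5) (Reg 5)) ;;
     Write 4 (Reg 3) (Reg 4) ;;
     10 ::= Len 0 ;;
     New 5 (Reg 10 [+] Reg 2 [+] Const 1) ;;
     For 5 (Const 0) (Reg 10) (Write 5 (Reg 5) (Read 0 (Reg 5))) ;;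
     8 ::= Const 1)"

definition output_com :: com where
  "output_com = If (Reg 7)
     (New 0 (Reg 2 [+] Const 1) ;; Write 0 (Const 0) (Const 1) ;;
      For 5 (Const 0) (Reg 2)
        (Write 0 (Reg 5 [+] Const 1) (Const 1 [-] Read 5 (Reg 10 [+] Reg 5))))
     (New 0 (Const 1))"

text \<open>Array 2 holds the flags, array 3 the candidates, array 4 the current combination followed by
  the sentinels \<open>k\<close> and 0, and array 5 the input, the indicator of the current set, and the
  position of the element to be checked.\<close>

definition search_com :: "com \<Rightarrow> com \<Rightarrow> com" where
  "search_com cf cc = (Call 2 cf 0 ;;
     2 ::= Read 0 (Const 1) ;; 3 ::= Read 0 (Const 2) ;;
     select_com ;;
     If (Reg 4 [<] Reg 3) (New 0 (Const 1))
       (start_com ;; enum_com cc ;; output_com))"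

text \<open>The search is abstracted from graphs: elements with flag 1 are checked by
  \<open>cc\<close>, those with larger flags are taken for granted. The bound \<open>CC\<close> has
  to pay for a check only if some element has flag 1, so it may be 0 otherwise.\<close>

locale subset_search = machine +
  fixes xs fl :: "nat list" and m r :: nat and chk :: "nat set \<Rightarrow> nat \<Rightarrow> bool"
    and cc :: com and tc CC :: nat
  assumes xs: "2 < length xs" "xs ! 1 = m" "xs ! 2 = r" "length xs + m + 1 \<le> M" "\<forall>x\<in>set xs. x + 2 \<le> M"
    and fl: "length fl = m" "\<forall>x\<in>set fl. x \<le> M"
    and M2: "2 \<le> M"
    and check: "\<And>A e. A \<subseteq> {i. i < m \<and> fl ! i \<noteq> 0} \<Longrightarrow> card A = r \<Longrightarrow> e \<in> A \<Longrightarrow> fl ! e = 1 \<Longrightarrow>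
       computes W cc (xs @ indicator_list m A @ [e]) tc (\<lambda>ys. ys = [if chk A e then 1 else 0])"
    and CC: "\<And>e. e < m \<Longrightarrow> fl ! e = 1 \<Longrightarrow> tc + length xs + m + 10 \<le> CC"
begin

section \<open>Candidates and the sets encoded by combinations\<close>

definition cands :: "nat list" where "cands = filter (\<lambda>i. fl ! i \<noteq> 0) [0..<m]"
abbreviation "k \<equiv> length cands"

definition chosen :: "nat list \<Rightarrow> nat set" where "chosen c = (\<lambda>j. cands ! j) ` set c"

definition good :: "nat set \<Rightarrow> bool" where "good A \<longleftrightarrow> (\<forall>e\<in>A. fl ! e = 1 \<longrightarrow> chk A e)"

definition base :: "state \<Rightarrow> bool" where
  "base s \<longleftrightarrow> snd s 0 = xs \<and> snd s 2 = fl \<and> snd s 3 = cands @ replicate (m - k) 0 \<and>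
     fst s 2 = m \<and> fst s 3 = r \<and> fst s 4 = k"

text \<open>The last cell \<open>z\<close> of array 5 passes the element to the checker and may hold
  anything between calls.\<close>

definition ready :: "nat list \<Rightarrow> nat set \<Rightarrow> state \<Rightarrow> bool" where
  "ready c A s \<longleftrightarrow> base s \<and> fst s 10 = length xs \<and> fst s 8 = 1 \<and> snd s 4 = c @ [k, 0] \<and>
     (\<exists>z. snd s 5 = xs @ indicator_list m A @ [z])"

lemma k_le: "k \<le> m"
  unfolding cands_def using length_filter_le[of "\<lambda>i. fl ! i \<noteq> 0" "[0..<m]"] by simp

lemma r_le: "r + 2 \<le> M"
  using xs(1,3,5) nth_mem by blast

lemma set_cands: "set cands = {i. i < m \<and> fl ! i \<noteq> 0}"
  by (auto simp: cands_def)

lemma distinct_cands: "distinct cands"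
  by (simp add: cands_def)

lemma cand_less: "j < k \<Longrightarrow> cands ! j < m"
  using set_cands nth_mem by fastforce

lemma chosen_subset: "combination k r c \<Longrightarrow> chosen c \<subseteq> {i. i < m \<and> fl ! i \<noteq> 0}"
  using set_cands by (auto simp: chosen_def combination_def)

lemma card_chosen:
  assumes "combination k r c"
  shows "card (chosen c) = r"
proof -
  have "distinct c" "length c = r" using assms
    by (auto simp: combination_def strict_sorted_iff)
  moreover have "inj_on ((!) cands) (set c)"
    using assms distinct_cands by (auto simp: combination_def inj_on_def nth_eq_iff_index_eq)
  ultimately show ?thesis by (simp add: chosen_def card_image distinct_card)
qed

text \<open>The second bound \<open>k'\<close> places the set early in the order: its rank is below
  \<open>k' choose r\<close>.\<close>

lemma combination_chosen:
  assumes "A \<subseteq> set (take k' cands)" "card A = r"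
  obtains c where "combination k r c" "combination k' r c" "chosen c = A"
proof -
  define J where "J = {j. j < k \<and> j < k' \<and> cands ! j \<in> A}"
  have A: "A = (!) cands ` J"
  proof
    show "A \<subseteq> (!) cands ` J"
    proof
      fix a assume "a \<in> A"
      then obtain j where "j < length (take k' cands)" "a = take k' cands ! j"
        using assms(1) by (metis in_set_conv_nth subsetD)
      then show "a \<in> (!) cands ` J" using \<open>a \<in> A\<close> by (auto simp: J_def)
    qed
  qed (auto simp: J_def)
  have "inj_on ((!) cands) J"
    using distinct_cands by (auto simp: J_def inj_on_def nth_eq_iff_index_eq)
  then have "card J = r" using A assms(2) by (metis card_image)
  moreover have "finite J" by (simp add: J_def)
  moreover have "J \<subseteq> {..<k}" "J \<subseteq> {..<k'}" by (auto simp: J_def)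
  moreover have "chosen (sorted_list_of_set J) = A"
    unfolding chosen_def set_sorted_list_of_set[OF \<open>finite J\<close>] by (rule A[symmetric])
  ultimately have "combination k r (sorted_list_of_set J)" "combination k' r (sorted_list_of_set J)"
    "chosen (sorted_list_of_set J) = A"
    using combination_of_set[of J k] combination_of_set[of J k'] by auto
  then show thesis by (rule that)
qed

section \<open>Marking, testing and advancing\<close>

lemma wp_mark:
  assumes c: "combination k r c" and s: "ready c A s"
    and v: "v \<le> 1"
    and post: "\<And>t s'. ready c (if v = 1 then A \<union> chosen c else A - chosen c) s' \<Longrightarrow>
       fst s' 7 = fst s 7 \<Longrightarrow> t \<le> 3 * r + 2 \<Longrightarrow> Q t s'"
  shows "wp (mark_com (Const v)) s Q"
proof -
  let ?A = "\<lambda>j. if v = 1 then A \<union> chosen (take j c) else A - chosen (take j c)"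
  have len: "length c = r" using c by (simp add: combination_def)
  have cj: "c ! j < k" if "j < r" for j using c that by (simp add: combination_def)
  have step: "(if v = 1 then insert (cands ! (c ! j)) (?A j) else ?A j - {cands ! (c ! j)}) = ?A (Suc j)"
    if "j < r" for j
    using that len by (auto simp: chosen_def take_Suc_conv_app_nth)
  show ?thesis
    unfolding mark_com_def
  proof (rule wp_For[where I = "\<lambda>j s'. ready c (?A j) s' \<and> fst s' 7 = fst s 7" and n = r and a = 0 and b = 1])
    fix j s' assume *: "ready c (?A j) s' \<and> fst s' 7 = fst s 7" "fst s' 5 = j" "j < r"
    then have cm: "cands ! (c ! j) < m" using cand_less[OF cj] by simp
    note st = step[OF *(3)]
    have upd: "(indicator_list m (?A j))[cands ! (c ! j) := v] = indicator_list m (?A (Suc j))"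
      using indicator_list_update[OF cm] st v by (cases "v = 0") (auto simp: le_Suc_eq)
    show "wp (Write 5 (Reg 10 [+] Read 3 (Read 4 (Reg 5))) (Const v)) s'
        (\<lambda>t s'. t \<le> 1 \<and> fst s' 5 = j \<and> ready c (?A (Suc j)) ((fst s')(5 := Suc j), snd s') \<and>
          fst ((fst s')(5 := Suc j), snd s') 7 = fst s 7)"
      using * v cm cj[OF *(3)] len upd M2 k_le
      by (intro wp_Write) (auto simp: ready_def base_def nth_append list_update_append simp del: One_nat_def split del: if_split)
  qed (use s len r_le post in \<open>auto simp: ready_def base_def chosen_def\<close>)
qed

lemma wp_test:
  assumes c: "combination k r c" and s: "ready c (chosen c) s"
    and post: "\<And>t s'. ready c (chosen c) s' \<Longrightarrow> fst s' 7 = (if good (chosen c) then 1 else 0) \<Longrightarrow>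
       t \<le> (7 + CC) * r + 3 \<Longrightarrow> Q t s'"
  shows "wp (test_com cc) s Q"
proof -
  let ?A = "chosen c"
  let ?e = "\<lambda>j. cands ! (c ! j)"
  let ?ok = "\<lambda>j. \<forall>i<j. fl ! ?e i = 1 \<longrightarrow> chk ?A (?e i)"
  have len: "length c = r" using c by (simp add: combination_def)
  have cj: "c ! j < k" if "j < r" for j using c that by (simp add: combination_def)
  have good: "good ?A \<longleftrightarrow> ?ok r"
    unfolding good_def chosen_def len[symmetric]
    using all_set_conv_all_nth[of c "\<lambda>e. fl ! (cands ! e) = 1 \<longrightarrow> chk ((!) cands ` set c) (cands ! e)"]
    by simp
  have eA: "?e j \<in> ?A" if "j < r" for j using that len by (auto simp: chosen_def)
  show ?thesis
    unfolding test_com_def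
  proof (rule wp_Seq, rule wp_Assign)
    let ?I = "\<lambda>j (s :: state). ready c ?A s \<and> fst s 7 = (if ?ok j then 1 else 0)"
    show "wp (For 5 (Const 0) (Reg 3)
           (6 ::= Read 3 (Read 4 (Reg 5)) ;;
            com.If (Read 2 (Reg 6) [=] Const 1)
              (Write 5 (Reg 10 [+] Reg 2) (Reg 6) ;;
               Call 6 cc 5 ;; com.If (Read 6 (Const 0)) skip_com (7 ::= Const 0)) skip_com))
        ((fst s)(7 := val s (Const 1)), snd s) (\<lambda>k'. Q (1 + k'))"
    proof (rule wp_For[where I = ?I and n = r and a = 0 and b = "5 + CC"])
      fix j :: nat and s :: state assume *: "?I j s" "fst s 5 = j" "j < r"
      then have cm: "?e j < m" using cand_less[OF cj] by simp
      have em: "?e j \<le> M" using cm xs(4) by simp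
      let ?P = "\<lambda>t s'. t \<le> 5 + CC \<and> fst s' 5 = j \<and> ?I (Suc j) ((fst s')(5 := Suc j), snd s')"
      have e6: "val s (Read 3 (Read 4 (Reg 5))) = ?e j"
        using * len cj[OF *(3)] by (simp add: ready_def base_def nth_append)
      have ok_Suc: "?ok (Suc j) \<longleftrightarrow> ?ok j \<and> (fl ! ?e j = 1 \<longrightarrow> chk ?A (?e j))"
        by (auto simp: less_Suc_eq)
      let ?s = "((fst s)(6 := ?e j), snd s)"
      show "wp (6 ::= Read 3 (Read 4 (Reg 5)) ;;
            com.If (Read 2 (Reg 6) [=] Const 1)
              (Write 5 (Reg 10 [+] Reg 2) (Reg 6) ;;
               Call 6 cc 5 ;; com.If (Read 6 (Const 0)) skip_com (7 ::= Const 0)) skip_com) s ?P"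
      proof (rule wp_Seq, rule wp_Assign, unfold e6, rule wp_If)
        assume "val ?s (Read 2 (Reg 6) [=] Const 1) \<noteq> 0"
        then have fl1: "fl ! ?e j = 1" using * by (simp add: ready_def base_def split: if_splits)
        obtain z where z: "snd s 5 = xs @ indicator_list m ?A @ [z]" using * by (auto simp: ready_def)
        show "wp (Write 5 (Reg 10 [+] Reg 2) (Reg 6) ;;
               Call 6 cc 5 ;; com.If (Read 6 (Const 0)) skip_com (7 ::= Const 0)) ?s (\<lambda>k. ?P (1 + (1 + k)))"
        proof (rule wp_Seq, rule wp_Write)
          let ?ys = "xs @ indicator_list m ?A @ [?e j]"
          let ?s' = "(fst ?s, (snd s)(5 := ?ys))"
          have upd: "(snd ?s 5)[val ?s (Reg 10 [+] Reg 2) := val ?s (Reg 6)] = ?ys"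
            using * z by (simp add: ready_def base_def list_update_append)
          show "wp (Call 6 cc 5 ;; com.If (Read 6 (Const 0)) skip_com (7 ::= Const 0))
              (fst ?s, (snd ?s)(5 := (snd ?s 5)[val ?s (Reg 10 [+] Reg 2) := val ?s (Reg 6)]))
              (\<lambda>k. ?P (1 + (1 + (1 + k))))"
            unfolding upd
          proof (rule wp_Seq, rule wp_Call)
            show "computes W cc (snd (fst ?s, (snd ?s)(5 := ?ys)) 5) tc (\<lambda>ys. ys = [if chk ?A (?e j) then 1 else 0])"
              using check[OF chosen_subset[OF c] card_chosen[OF c] eA[OF *(3)] fl1] by simp
          next
            fix t :: nat and ys :: "nat list" assume ys: "ys = [if chk ?A (?e j) then 1 else 0]"
              and "t \<le> 1 + length (snd (fst ?s, (snd ?s)(5 := ?ys)) 5) + tc + length ys"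
            then have t: "t + 7 \<le> CC" using CC[OF cm fl1] by simp
            show "wp (com.If (Read 6 (Const 0)) skip_com (7 ::= Const 0))
                (fst (fst ?s, (snd ?s)(5 := ?ys)), (snd (fst ?s, (snd ?s)(5 := ?ys)))(6 := ys))
                (\<lambda>k'. ?P (1 + (1 + (1 + (t + k')))))"
              using * ys t fl1 ok_Suc
              by (intro wp_If wp_Assign) (auto simp: ready_def base_def)
          qed (use M2 in auto)
        qed (use * z em in \<open>auto simp: ready_def base_def\<close>)
      next
        assume "val ?s (Read 2 (Reg 6) [=] Const 1) = 0"
        then have fl1: "fl ! ?e j \<noteq> 1" using * by (simp add: ready_def base_def split: if_splits)
        show "wp skip_com ?s (\<lambda>k. ?P (1 + (1 + k)))"
          using * fl1 ok_Suc by (intro wp_Assign) (auto simp: ready_def base_def)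
      qed (use * len cj[OF *(3)] cm em fl k_le in \<open>auto simp: ready_def base_def nth_append\<close>)
    qed (use s len r_le post good M2 in \<open>auto simp: ready_def base_def\<close>)
  qed (use M2 in auto)
qed

lemma wp_next:
  assumes c: "combination k r c" and s: "ready c {} s"
    and succ: "\<And>t s' c'. combination k r c' \<Longrightarrow> rank c' = Suc (rank c) \<Longrightarrow> ready c' {} s' \<Longrightarrow>
       fst s' 7 = fst s 7 \<Longrightarrow> t \<le> 3 * r + 5 \<Longrightarrow> Q t s'"
    and stop: "\<And>t s'. Suc (rank c) = k choose r \<Longrightarrow> fst s' 8 = 0 \<Longrightarrow> base s' \<Longrightarrow> fst s' 7 = fst s 7 \<Longrightarrow>
       fst s' 10 = length xs \<Longrightarrow> t \<le> 3 * r + 5 \<Longrightarrow> Q t s'"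
  shows "wp next_com s Q"
proof -
  have len: "length c = r" using c by (simp add: combination_def)
  have cj: "c ! j < k" if "j < r" for j using c that by (simp add: combination_def)
  obtain z where z: "snd s 5 = xs @ indicator_list m {} @ [z]" using s by (auto simp: ready_def)
  let ?I = "\<lambda>s'. base s' \<and> fst s' 10 = length xs \<and> fst s' 8 = 1 \<and> snd s' 5 = xs @ indicator_list m {} @ [z] \<and>
     fst s' 7 = fst s 7 \<and> fst s' 5 \<le> r \<and> run_of k c (fst s' 5) \<and>
     snd s' 4 = [0..<fst s' 5] @ drop (fst s' 5) (c @ [k, 0])"
  \<comment> \<open>Position \<open>r\<close> holds the sentinel \<open>k\<close> and position
    \<open>r + 1\<close> the sentinel 0, hence the special case \<open>j = r\<close>.\<close>
  have arr: "([0..<j] @ drop j (c @ [k, 0])) ! j = (c @ [k]) ! j"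
     "([0..<j] @ drop j (c @ [k, 0])) ! Suc j = (if j = r then 0 else (c @ [k]) ! Suc j)"
    if "j \<le> r" for j
    using that len by (auto simp: nth_append)
  have upd: "([0..<j] @ drop j (c @ [k, 0]))[j := j] = [0..<Suc j] @ drop (Suc j) (c @ [k, 0])" if "j < r" for j
    using that len by (intro nth_equalityI) (auto simp: nth_append nth_list_update)
  have upd': "([0..<j] @ drop j (c @ [k, 0]))[j := Suc (c ! j)] = next_comb c j @ [k, 0]" if "j < r" for j
    using that len unfolding next_comb_def
    by (intro nth_equalityI) (auto simp: nth_append nth_list_update nth_Cons' )
  show ?thesis
    unfolding next_com_def
  proof (rule wp_Seq, rule wp_Assign, rule wp_Seq, rule wp_While[where I = ?I and \<Phi> = "\<lambda>s. 3 * (r - fst s 5)"])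
    fix s assume *: "?I s"
      and "val s (Read 4 (Reg 5) [+] Const 1 [=] Read 4 (Reg 5 [+] Const 1)) \<noteq> 0"
    then have eq: "Suc ((c @ [k]) ! fst s 5) = (if fst s 5 = r then 0 else (c @ [k]) ! Suc (fst s 5))"
      using arr[of "fst s 5"] by (simp split: if_splits)
    then have lt: "fst s 5 < r" using * by (auto split: if_splits simp: le_less)
    have run: "run_of k c (Suc (fst s 5))"
      using * eq lt len by (auto simp: run_of_def less_Suc_eq nth_append)
    show "wp (Write 4 (Reg 5) (Reg 5) ;; incr 5) s (\<lambda>t s'. ?I s' \<and> t + 1 + 3 * (r - fst s' 5) \<le> 3 * (r - fst s 5))"
      using * lt run upd[OF lt] r_le len
      by (intro wp_Seq wp_Write wp_Assign) (auto simp: base_def simp del: upt_Suc)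
  next
    fix t s' assume *: "?I s'"
      and v: "val s' (Read 4 (Reg 5) [+] Const 1 [=] Read 4 (Reg 5 [+] Const 1)) = 0"
      and t: "t + 3 * (r - fst s' 5) \<le> 3 * (r - fst ((fst s)(5 := val s (Const 0)), snd s) 5) + 1"
    let ?j = "fst s' 5"
    show "wp (com.If (Reg 5 [<] Reg 3) (Write 4 (Reg 5) (Read 4 (Reg 5) [+] Const 1)) (8 ::= Const 0)) s'
        (\<lambda>k'. Q (1 + (t + k')))"
    proof (rule wp_If)
      assume "val s' (Reg 5 [<] Reg 3) \<noteq> 0"
      then have lt: "?j < r" using * by (auto simp: base_def split: if_splits)
      have ne: "c ! ?j + 1 \<noteq> (c @ [k]) ! (?j + 1)"
        using v arr[of ?j] lt * len by (auto simp: nth_append split: if_splits)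
      note nc = next_comb[OF c _ lt ne]
      have "snd s' 4 ! ?j = c ! ?j" using * arr(1)[of ?j] lt len by (simp add: nth_append)
      then show "wp (Write 4 (Reg 5) (Read 4 (Reg 5) [+] Const 1)) s' (\<lambda>k. Q (1 + (t + (1 + k))))"
        using * lt len cj[OF lt] k_le xs(4) upd'[OF lt] t
        by (intro wp_Write succ[OF nc]) (auto simp: ready_def base_def)
    next
      assume "val s' (Reg 5 [<] Reg 3) = 0"
      then have "?j = r" using * by (auto simp: base_def split: if_splits)
      then have "run_of k c r" using * by simp
      then show "wp (8 ::= Const 0) s' (\<lambda>k. Q (1 + (t + (1 + k))))"
        using * t last_comb[OF c] by (intro wp_Assign stop) (auto simp: base_def)
    qed (use * in auto)
  qed (use s z len in \<open>auto simp: ready_def base_def run_of_def\<close>)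
qed

section \<open>Progress of the enumeration\<close>

definition solvable :: bool where
  "solvable \<longleftrightarrow> (\<exists>A. A \<subseteq> set cands \<and> card A = r \<and> good A)"

definition finished :: "state \<Rightarrow> bool" where
  "finished s \<longleftrightarrow> base s \<and> fst s 10 = length xs \<and> fst s 7 = (if solvable then 1 else 0) \<and>
     (solvable \<longrightarrow> (\<exists>A z. A \<subseteq> set cands \<and> card A = r \<and> good A \<and> snd s 5 = xs @ indicator_list m A @ [z]))"

definition none_below :: "nat \<Rightarrow> bool" where
  "none_below i \<longleftrightarrow> (\<forall>c. combination k r c \<and> rank c < i \<longrightarrow> \<not> good (chosen c))"

lemma none_below_Suc:
  assumes "none_below (rank c)" "combination k r c" "\<not> good (chosen c)"
  shows "none_below (Suc (rank c))"
  unfolding none_below_def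
proof (intro allI impI)
  fix c' assume c': "combination k r c' \<and> rank c' < Suc (rank c)"
  show "\<not> good (chosen c')"
  proof (cases "rank c' = rank c")
    case True
    then have "c' = c" using rank_inj[of c' c] c' assms(2) by (auto simp: combination_def)
    then show ?thesis using assms(3) by simp
  qed (use c' assms(1) in \<open>auto simp: none_below_def\<close>)
qed

lemma not_solvable:
  assumes "none_below (k choose r)"
  shows "\<not> solvable"
proof
  assume solvable
  then obtain A where A: "A \<subseteq> set (take k cands)" "card A = r" "good A" by (auto simp: solvable_def)
  then obtain c where "combination k r c" "chosen c = A" using combination_chosen[of A k] by blast
  then show False using assms A combination_rank_less by (auto simp: none_below_def)
qed

text \<open>This is where the colexicographic order matters. All combinations within the first
  \<open>k0\<close> candidates have rank less than \<open>k0 choose r\<close>, so a good set among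
  them has not been passed yet. With fewer than \<open>k0\<close> candidates the bound holds for
  every combination.\<close>

lemma rank_below:
  assumes "combination k r c" "none_below (rank c)"
    and k0: "k0 \<le> k \<Longrightarrow> \<exists>A. A \<subseteq> set (take k0 cands) \<and> card A = r \<and> good A"
  shows "rank c < k0 choose r"
proof (cases "k0 \<le> k")
  case True
  then obtain A where A: "A \<subseteq> set (take k0 cands)" "card A = r" "good A" using k0 by blast
  then obtain c' where c': "combination k r c'" "combination k0 r c'" "chosen c' = A"
    using combination_chosen[of A k0] by blast
  then have "\<not> rank c' < rank c" using assms(2) A(3) unfolding none_below_def by blast
  then show ?thesis using combination_rank_less[OF c'(2)] by linarith
next
  case False
  then have "k choose r \<le> k0 choose r" by (intro binomial_right_mono) simp
  then show ?thesis using combination_rank_less[OF assms(1)] by simp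
qed

lemma finished_found:
  assumes "ready c (chosen c) s" "combination k r c" "good (chosen c)" "fst s 7 = 1"
  shows "finished ((fst s)(8 := 0), snd s)"
proof -
  obtain z where z: "snd s 5 = xs @ indicator_list m (chosen c) @ [z]" using assms(1) by (auto simp: ready_def)
  have A: "chosen c \<subseteq> set cands \<and> card (chosen c) = r \<and> good (chosen c)"
    using chosen_subset[OF assms(2)] card_chosen[OF assms(2)] assms(3) set_cands by simp
  then have "solvable" unfolding solvable_def by blast
  then show ?thesis
    unfolding finished_def using assms A z by (auto simp: ready_def base_def)
qed

text \<open>The potential is the number of ranks below \<open>k0 choose r\<close> that are still to
  be tried, times the cost of one iteration. The program itself does not depend on
  \<open>k0\<close>.\<close>

lemma wp_enum:
  assumes "r \<le> k" and s: "ready [0..<r] {} s"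
    and k0: "k0 \<le> k \<Longrightarrow> \<exists>A. A \<subseteq> set (take k0 cands) \<and> card A = r \<and> good A"
    and post: "\<And>t s'. finished s' \<Longrightarrow> t \<le> (k0 choose r) * ((16 + CC) * r + 14) + 1 \<Longrightarrow> Q t s'"
  shows "wp (enum_com cc) s Q"
  unfolding enum_com_def
proof -
  \<comment> \<open>Marking and unmarking cost \<open>3 * r + 2\<close> each, testing
    \<open>(7 + CC) * r + 3\<close>, advancing \<open>3 * r + 5\<close>, and the branch and the loop
    test 1 each.\<close>
  let ?b = "(16 + CC) * r + 14"
  let ?\<Phi> = "\<lambda>s. if fst s 8 = 0 then 0 else ((k0 choose r) - rank (take r (snd s 4))) * ?b"
  let ?J = "\<lambda>c s. combination k r c \<and> ready c {} s \<and> none_below (rank c)"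
  let ?I = "\<lambda>s. if fst s 8 = 0 then finished s else (\<exists>c. ?J c s)"
  have take_c: "take r (snd s 4) = c" if "ready c A s" "combination k r c" for c A s
    using that by (auto simp: ready_def combination_def)
  let ?body = "mark_com (Const 1) ;; test_com cc ;;
      com.If (Reg 7) (8 ::= Const 0) (mark_com (Const 0) ;; next_com)"
  show "wp (While (Reg 8) ?body) s Q"
  proof (rule wp_While[where I = ?I and \<Phi> = ?\<Phi>])
    have "none_below (rank [0..<r])" by (simp add: none_below_def rank_upt_0)
    then show "?I s" using s combination_upt[OF assms(1)] by (auto simp: ready_def)
  next
    fix s assume "?I s" "val s (Reg 8) \<noteq> 0"
    then obtain c where c: "combination k r c" and rd: "ready c {} s" and nb: "none_below (rank c)" by auto
    note lt = rank_below[OF c nb k0]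
    have \<Phi>: "?\<Phi> s = ((k0 choose r) - rank c) * ?b"
      using rd take_c[OF rd c] by (simp add: ready_def)
    have \<Phi>_ge: "?\<Phi> s \<ge> ?b" unfolding \<Phi> using lt by simp
    let ?P = "\<lambda>t s'. ?I s' \<and> t + 1 + ?\<Phi> s' \<le> ?\<Phi> s"
    show "wp ?body s ?P"
    proof (rule wp_Seq, rule wp_mark[OF c rd], simp)
      fix t1 s1 assume "ready c (if (1::nat) = 1 then {} \<union> chosen c else {} - chosen c) s1" and t1: "t1 \<le> 3 * r + 2"
      then have rd1: "ready c (chosen c) s1" by simp
      show "wp (test_com cc ;; com.If (Reg 7) (8 ::= Const 0) (mark_com (Const 0) ;; next_com)) s1
          (\<lambda>k'. ?P (t1 + k'))"
      proof (rule wp_Seq, rule wp_test[OF c rd1])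
        fix t2 s2 assume rd2: "ready c (chosen c) s2" and ok: "fst s2 7 = (if good (chosen c) then 1 else 0)"
          and t2: "t2 \<le> (7 + CC) * r + 3"
        show "wp (com.If (Reg 7) (8 ::= Const 0) (mark_com (Const 0) ;; next_com)) s2 (\<lambda>k'. ?P (t1 + (t2 + k')))"
        proof (rule wp_If)
          assume "val s2 (Reg 7) \<noteq> 0"
          then have g: "good (chosen c)" "fst s2 7 = 1" using ok by (auto split: if_splits)
          show "wp (8 ::= Const 0) s2 (\<lambda>k. ?P (t1 + (t2 + (1 + k))))"
            using finished_found[OF rd2 c g] t1 t2 \<Phi>_ge
            by (intro wp_Assign) (auto simp: algebra_simps)
        next
          assume "val s2 (Reg 7) = 0"
          then have ng: "\<not> good (chosen c)" and 7: "fst s2 7 = 0" using ok by (auto split: if_splits)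
          note nb' = none_below_Suc[OF nb c ng]
          show "wp (mark_com (Const 0) ;; next_com) s2 (\<lambda>k. ?P (t1 + (t2 + (1 + k))))"
          proof (rule wp_Seq, rule wp_mark[OF c rd2], simp)
            fix t3 s3 assume "ready c (if (0::nat) = 1 then chosen c \<union> chosen c else chosen c - chosen c) s3"
              and s37: "fst s3 7 = fst s2 7" and t3: "t3 \<le> 3 * r + 2"
            then have rd3: "ready c {} s3" by simp
            show "wp next_com s3 (\<lambda>k'. ?P (t1 + (t2 + (1 + (t3 + k')))))"
            proof (rule wp_next[OF c rd3])
              fix t4 s4 c' assume c': "combination k r c'" "rank c' = Suc (rank c)" "ready c' {} s4"
                and t4: "t4 \<le> 3 * r + 5"
              have "?J c' s4" using c' nb' by simp
              moreover have "?\<Phi> s4 + ?b \<le> ?\<Phi> s"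
              proof -
                have "fst s4 8 \<noteq> 0" using c' by (simp add: ready_def)
                then have "?\<Phi> s4 = ((k0 choose r) - Suc (rank c)) * ?b"
                  using take_c[OF c'(3,1)] c'(2) by simp
                moreover have "(k0 choose r) - rank c = Suc ((k0 choose r) - Suc (rank c))" using lt by simp
                ultimately show ?thesis unfolding \<Phi> by simp
              qed
              ultimately show "?P (t1 + (t2 + (1 + (t3 + t4)))) s4"
                using t1 t2 t3 t4 c'(3) by (auto simp: ready_def algebra_simps)
            next
              fix t4 s4 assume st: "Suc (rank c) = k choose r" "fst s4 8 = 0" "base s4" "fst s4 7 = fst s3 7" "fst s4 10 = length xs"
                and t4: "t4 \<le> 3 * r + 5"
              have "\<not> solvable" using not_solvable nb' st(1) by simp
              then have "finished s4" using st 7 s37 by (simp add: finished_def)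
              then show "?P (t1 + (t2 + (1 + (t3 + t4)))) s4"
                using t1 t2 t3 t4 st(2) \<Phi>_ge by (auto simp: algebra_simps)
            qed
          qed
        qed auto
      qed
    qed
  next
    fix t s' assume "?I s'" "val s' (Reg 8) = 0" "t + ?\<Phi> s' \<le> ?\<Phi> s + 1"
    moreover have "?\<Phi> s \<le> (k0 choose r) * ?b" by simp
    ultimately show "Q t s'" by (intro post) auto
  qed auto
qed

lemma wp_select:
  assumes "snd s 0 = xs" "snd s 2 = fl" "fst s 2 = m" "fst s 3 = r"
    and post: "\<And>t s'. base s' \<Longrightarrow> t \<le> 6 * m + 4 \<Longrightarrow> Q t s'"
  shows "wp select_com s Q"
  unfolding select_com_def
proof (rule wp_Seq, rule wp_New, rule wp_Seq, rule wp_Assign)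
  let ?F = "\<lambda>j. filter (\<lambda>i. fl ! i \<noteq> 0) [0..<j]"
  let ?I = "\<lambda>j (s :: state). snd s 0 = xs \<and> snd s 2 = fl \<and> fst s 2 = m \<and> fst s 3 = r \<and>
     fst s 4 = length (?F j) \<and> snd s 3 = ?F j @ replicate (m - length (?F j)) 0"
  let ?s = "(fst s, (snd s)(3 := replicate (val s (Reg 2)) 0))"
  let ?s' = "((fst ?s)(4 := val ?s (Const 0)), snd ?s)"
  show "wp (For 5 (Const 0) (Reg 2) (com.If (Read 2 (Reg 5)) (Write 3 (Reg 4) (Reg 5) ;; incr 4) skip_com)) ?s'
     (\<lambda>k'. Q (1 + val s (Reg 2) + (1 + k')))"
  proof (rule wp_For[where I = ?I and n = m and a = 0 and b = 3])
    fix j :: nat and s :: state assume *: "?I j s" "fst s 5 = j" "j < m"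
    have le: "length (?F j) \<le> j" using length_filter_le[of "\<lambda>i. fl ! i \<noteq> 0" "[0..<j]"] by simp
    have "replicate (m - length (?F j)) (0::nat) = 0 # replicate (m - Suc (length (?F j))) 0"
      using le *(3) by (simp flip: replicate_Suc add: Suc_diff_Suc)
    then show "wp (com.If (Read 2 (Reg 5)) (Write 3 (Reg 4) (Reg 5) ;; incr 4) skip_com) s
       (\<lambda>k s'. k \<le> 3 \<and> fst s' 5 = j \<and> ?I (Suc j) ((fst s')(5 := Suc j), snd s'))"
      using * le fl xs(4) by (intro wp_If wp_Seq wp_Write wp_Assign) (auto simp: list_update_append)
  qed (use assms xs(4) post in \<open>auto simp: base_def cands_def\<close>)
qed (use assms xs(4) in auto)

lemma wp_start:
  assumes "r \<le> k" and s: "base s"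
    and post: "\<And>t s'. ready [0..<r] {} s' \<Longrightarrow> t \<le> 4 * r + 4 * length xs + m + 14 \<Longrightarrow> Q t s'"
  shows "wp start_com s Q"
  unfolding start_com_def
proof (rule wp_Seq, rule wp_New, rule wp_Seq)
  let ?s = "(fst s, (snd s)(4 := replicate (val s (Reg 3 [+] Const 2)) 0))"
  let ?t = "1 + val s (Reg 3 [+] Const 2)"
  let ?c2 = "Write 4 (Reg 3) (Reg 4) ;; 10 ::= Len 0 ;; New 5 (Reg 10 [+] Reg 2 [+] Const 1) ;;
     For 5 (Const 0) (Reg 10) (Write 5 (Reg 5) (Read 0 (Reg 5))) ;; 8 ::= Const 1"
  have le: "r \<le> M" "k \<le> M" using r_le k_le xs(4) by auto
  show "wp (For 5 (Const 0) (Reg 3) (Write 4 (Reg 5) (Reg 5))) ?s (\<lambda>k s. wp ?c2 s (\<lambda>k'. Q (?t + (k + k'))))"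
  proof (rule wp_For[where I = "\<lambda>j s. base s \<and> snd s 4 = [0..<j] @ replicate (r + 2 - j) 0" and n = r and a = 0 and b = 1])
    fix j :: nat and s :: state assume *: "base s \<and> snd s 4 = [0..<j] @ replicate (r + 2 - j) 0" "fst s 5 = j" "j < r"
    have "replicate (r + 2 - j) (0::nat) = 0 # replicate (r + 2 - Suc j) 0"
      using *(3) by (simp flip: replicate_Suc add: Suc_diff_le)
    then show "wp (Write 4 (Reg 5) (Reg 5)) s (\<lambda>k s'. k \<le> 1 \<and> fst s' 5 = j \<and>
        (base ((fst s')(5 := Suc j), snd s') \<and>
         snd ((fst s')(5 := Suc j), snd s') 4 = [0..<Suc j] @ replicate (r + 2 - Suc j) 0))"
      using * le by (intro wp_Write) (auto simp: base_def list_update_append)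
  next
    fix t s assume "base s \<and> snd s 4 = [0..<r] @ replicate (r + 2 - r) 0" and "t \<le> (1 + 2) * (r - 0) + 2"
    then have b: "base s" "snd s 4 = [0..<r] @ [0, 0]" and t: "t \<le> 3 * r + 2" by (auto simp: numeral_2_eq_2)
    have len: "length xs + m + 1 \<le> M" using xs by simp
    show "wp ?c2 s (\<lambda>k'. Q (?t + (t + k')))"
    proof (rule wp_Seq, rule wp_Write, rule wp_Seq, rule wp_Assign, rule wp_Seq, rule wp_New, rule wp_Seq)
      let ?I = "\<lambda>j (s :: state). base s \<and> snd s 4 = [0..<r] @ [k, 0] \<and> fst s 10 = length xs \<and>
        snd s 5 = take j xs @ replicate (length xs + m + 1 - j) 0"
      let ?s1 = "(fst s, (snd s)(4 := (snd s 4)[val s (Reg 3) := val s (Reg 4)]))"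
      let ?s2 = "((fst ?s1)(10 := val ?s1 (Len 0)), snd ?s1)"
      let ?n = "val ?s2 (Reg 10 [+] Reg 2 [+] Const 1)"
      let ?s3 = "(fst ?s2, (snd ?s2)(5 := replicate ?n 0))"
      show "wp (For 5 (Const 0) (Reg 10) (Write 5 (Reg 5) (Read 0 (Reg 5)))) ?s3
         (\<lambda>k s. wp (8 ::= Const 1) s (\<lambda>k'. Q (?t + (t + (1 + (1 + (1 + ?n + (k + k'))))))))"
      proof (rule wp_For[where I = ?I and n = "length xs" and a = 0 and b = 1])
        fix j :: nat and s :: state assume *: "?I j s" "fst s 5 = j" "j < length xs"
        have "replicate (length xs + m + 1 - j) (0::nat) = 0 # replicate (length xs + m + 1 - Suc j) 0"
          using *(3) by (simp flip: replicate_Suc add: Suc_diff_le)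
        moreover have "xs ! j \<le> M" using xs(5) nth_mem[OF *(3)] by fastforce
        ultimately show "wp (Write 5 (Reg 5) (Read 0 (Reg 5))) s
            (\<lambda>k s'. k \<le> 1 \<and> fst s' 5 = j \<and> ?I (Suc j) ((fst s')(5 := Suc j), snd s'))"
          using * by (intro wp_Write) (auto simp: base_def list_update_append take_Suc_conv_app_nth)
      next
        fix t' s' assume "?I (length xs) s'" and t': "t' \<le> (1 + 2) * (length xs - 0) + 2"
        moreover have "replicate (length xs + m + 1 - length xs) (0::nat) = indicator_list m {} @ [0]"
          by (simp add: indicator_list_empty replicate_append_same)
        ultimately have "ready [0..<r] {} ((fst s')(8 := 1), snd s')"
          unfolding ready_def base_def by auto
        moreover have "?n = length xs + m + 1" using b by (simp add: base_def)
        moreover have "?t = r + 3" using s by (simp add: base_def)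
        ultimately show "wp (8 ::= Const 1) s' (\<lambda>k'. Q (?t + (t + (1 + (1 + (1 + ?n + (t' + k')))))))"
          using t t' M2 by (intro wp_Assign post) auto
      qed (use b len in \<open>auto simp: base_def list_update_append\<close>)
    qed (use b len le in \<open>auto simp: base_def\<close>)
  qed (use s le in \<open>auto simp: base_def\<close>)
qed (use s r_le in \<open>auto simp: base_def\<close>)

text \<open>The search finds the elements to remove, whereas the answer indicates those that are
  kept.\<close>

definition outcome :: "nat list \<Rightarrow> bool" where
  "outcome ys \<longleftrightarrow> (if solvable
     then \<exists>A. A \<subseteq> set cands \<and> card A = r \<and> good A \<and> ys = 1 # map (\<lambda>i. if i \<in> A then 0 else 1) [0..<m]
     else ys = [0])"

lemma wp_output:
  assumes s: "finished s"
    and post: "\<And>t s'. outcome (result s') \<Longrightarrow> t \<le> 4 * m + 6 \<Longrightarrow> Q t s'"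
  shows "wp output_com s Q"
  unfolding output_com_def
proof (rule wp_If)
  assume "val s (Reg 7) \<noteq> 0"
  then have sol: solvable using s by (auto simp: finished_def split: if_splits)
  then obtain A z where A: "A \<subseteq> set cands" "card A = r" "good A" "snd s 5 = xs @ indicator_list m A @ [z]"
    using s unfolding finished_def by blast
  let ?v = "\<lambda>i. if i \<in> A then 0 else 1 :: nat"
  let ?I = "\<lambda>j (s :: state). fst s 2 = m \<and> fst s 10 = length xs \<and> snd s 5 = xs @ indicator_list m A @ [z] \<and>
    result s = (1 # map ?v [0..<j]) @ replicate (m - j) 0"
  show "wp (New 0 (Reg 2 [+] Const 1) ;; Write 0 (Const 0) (Const 1) ;;
      For 5 (Const 0) (Reg 2) (Write 0 (Reg 5 [+] Const 1) (Const 1 [-] Read 5 (Reg 10 [+] Reg 5)))) s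
      (\<lambda>k. Q (1 + k))"
  proof (rule wp_Seq, rule wp_New, rule wp_Seq, rule wp_Write,
      rule wp_For[where I = ?I and n = m and a = 0 and b = 1])
    fix j :: nat and s :: state assume *: "?I j s" "fst s 5 = j" "j < m"
    have "replicate (m - j) (0::nat) = 0 # replicate (m - Suc j) 0"
      using *(3) by (simp flip: replicate_Suc add: Suc_diff_le)
    then show "wp (Write 0 (Reg 5 [+] Const 1) (Const 1 [-] Read 5 (Reg 10 [+] Reg 5))) s
       (\<lambda>k s'. k \<le> 1 \<and> fst s' 5 = j \<and> ?I (Suc j) ((fst s')(5 := Suc j), snd s'))"
      using * M2 by (intro wp_Write) (auto simp: list_update_append nth_append)
  next
    fix t s' assume "?I m s'" and t: "t \<le> (1 + 2) * (m - 0) + 2"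
    then have "outcome (result s')" using A sol by (auto simp: outcome_def)
    moreover have "val s (Reg 2 [+] Const 1) = m + 1" using s by (simp add: finished_def base_def)
    ultimately show "Q (1 + (1 + val s (Reg 2 [+] Const 1) + (1 + t))) s'"
      using t by (intro post) auto
  qed (use s A xs(4) M2 in \<open>auto simp: finished_def base_def\<close>)
next
  assume "val s (Reg 7) = 0"
  then have "\<not> solvable" using s by (auto simp: finished_def split: if_splits)
  then show "wp (New 0 (Const 1)) s (\<lambda>k. Q (1 + k))"
    using M2 by (intro wp_New post) (auto simp: outcome_def)
qed auto

text \<open>Nothing is enumerated if \<open>r\<close> exceeds the number of candidates. The case
  distinction in the bound is needed by the caller: without it a term proportional to
  \<open>r\<close> would remain even if \<open>r\<close> is far larger than the graph.\<close>

lemma computes_search: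
  assumes cf: "computes W cf xs tf (\<lambda>ys. ys = fl)"
    and k0: "k0 \<le> k \<Longrightarrow> \<exists>A. A \<subseteq> set (take k0 cands) \<and> card A = r \<and> good A"
  shows "computes W (search_com cf cc) xs
     (tf + 5 * length xs + 17 * m + 40 + (if r \<le> k then (k0 choose r) * ((16 + CC) * r + 14) else 0)) outcome"
proof (rule computesI)
  let ?T = "tf + 5 * length xs + 17 * m + 40 + (if r \<le> k then (k0 choose r) * ((16 + CC) * r + 14) else 0)"
  let ?Q = "\<lambda>k s. k \<le> ?T \<and> outcome (result s)"
  let ?c4 = "com.If (Reg 4 [<] Reg 3) (New 0 (Const 1)) (start_com ;; enum_com cc ;; output_com)"
  let ?c3 = "select_com ;; ?c4"
  show "wp (search_com cf cc) (init xs) ?Q"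
    unfolding search_com_def
  proof (rule wp_Seq, rule wp_Call)
    show "computes W cf (snd (init xs) 0) tf (\<lambda>ys. ys = fl)" using cf by (simp add: init_def)
  next
    fix t and ys :: "nat list" assume ys: "ys = fl" and "t \<le> 1 + length (snd (init xs) 0) + tf + length ys"
    then have t: "t \<le> 1 + length xs + tf + m" using fl by (simp add: init_def)
    let ?s = "(fst (init xs), (snd (init xs))(2 := ys))"
    show "wp (2 ::= Read 0 (Const 1) ;; 3 ::= Read 0 (Const 2) ;; ?c3) ?s (\<lambda>k'. ?Q (t + k'))"
    proof (rule wp_Seq, rule wp_Assign, rule wp_Seq, rule wp_Assign, rule wp_Seq, rule wp_select)
      fix t1 s1 assume b: "base s1" and t1: "t1 \<le> 6 * m + 4"
      show "wp ?c4 s1 (\<lambda>k'. ?Q (t + (1 + (1 + (t1 + k')))))"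
      proof (rule wp_If)
        assume "val s1 (Reg 4 [<] Reg 3) \<noteq> 0"
        then have lt: "k < r" using b by (auto simp: base_def split: if_splits)
        have "\<not> solvable"
        proof
          assume solvable
          then obtain A where "A \<subseteq> set cands" "card A = r" by (auto simp: solvable_def)
          then have "r \<le> k" using card_mono[of "set cands" A] card_length[of cands] by simp
          then show False using lt by simp
        qed
        then show "wp (New 0 (Const 1)) s1 (\<lambda>k. ?Q (t + (1 + (1 + (t1 + (1 + k))))))"
          using t t1 M2 by (intro wp_New) (auto simp: outcome_def)
      next
        assume "val s1 (Reg 4 [<] Reg 3) = 0"
        then have le: "r \<le> k" using b by (auto simp: base_def split: if_splits)
        show "wp (start_com ;; enum_com cc ;; output_com) s1 (\<lambda>k. ?Q (t + (1 + (1 + (t1 + (1 + k))))))"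
        proof (rule wp_Seq, rule wp_start[OF le b], rule wp_Seq, rule wp_enum[OF le _ k0], assumption+, rule wp_output)
          fix t2 t3 t4 s4
          assume "t2 \<le> 4 * r + 4 * length xs + m + 14" "t3 \<le> (k0 choose r) * ((16 + CC) * r + 14) + 1"
            "t4 \<le> 4 * m + 6" "outcome (result s4)"
          then show "?Q (t + (1 + (1 + (t1 + (1 + (t2 + (t3 + t4))))))) s4"
            using t t1 le k_le by simp
        qed auto
      qed (use b in auto)
    qed (use ys xs r_le in \<open>auto simp: init_def\<close>)
  qed (use fl xs(4) in auto)
next
  show "length xs \<le> M" "\<forall>x\<in>set xs. x \<le> M" using xs by auto
qed

end

section \<open>Paths and spanners\<close>

text \<open>Unlike simple paths, walks can be concatenated; \<open>walk_imp_simple_path\<close>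
  leads back.\<close>

definition walk :: "nat set set \<Rightarrow> nat \<Rightarrow> nat \<Rightarrow> nat list \<Rightarrow> bool" where
  "walk E u v p \<longleftrightarrow> p \<noteq> [] \<and> hd p = u \<and> last p = v \<and> set (path_edges p) \<subseteq> E"

lemma simple_path_walk: "simple_path E u v p \<longleftrightarrow> walk E u v p \<and> distinct p"
  by (auto simp: simple_path_def walk_def)

lemma path_edges_simps [simp]:
  "path_edges [] = []" "path_edges [x] = []" "path_edges (x # y # p) = {x, y} # path_edges (y # p)"
  by (auto simp: path_edges_def)

lemma path_edges_append: "path_edges (xs @ y # ys) = path_edges (xs @ [y]) @ path_edges (y # ys)"
proof (induction xs)
  case (Cons x xs)
  then show ?case by (cases xs) auto
qed simp

lemma path_edges_rev: "path_edges (rev p) = rev (path_edges p)"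
proof (induction p rule: induct_list012)
  case (3 x y p)
  have "path_edges (rev (x # y # p)) = path_edges (rev p @ y # [x])" by simp
  also have "\<dots> = path_edges (rev (y # p)) @ [{y, x}]" by (subst path_edges_append) simp
  finally show ?case using 3 by (simp add: insert_commute)
qed auto

lemma length_path_edges: "length (path_edges p) = length p - 1"
  by (simp add: path_edges_def)

lemma path_length_simps [simp]:
  "path_length l [] = 0" "path_length l [x] = 0"
  "path_length l (x # y # p) = l {x, y} + path_length l (y # p)"
  by (auto simp: path_length_def)

lemma path_length_rev: "path_length l (rev p) = path_length l p"
  by (simp add: path_length_def path_edges_rev flip: rev_map)

lemma path_length_cong:
  "(\<And>e. e \<in> set (path_edges p) \<Longrightarrow> l e = l' e) \<Longrightarrow> path_length l p = path_length l' p"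
  unfolding path_length_def by (intro arg_cong[of _ _ sum_list] map_cong) auto

lemma path_length_ge: "e \<in> set (path_edges p) \<Longrightarrow> l e \<le> path_length l p"
  unfolding path_length_def by (intro member_le_sum_list) auto

lemma walk_rev: "walk E u v p \<Longrightarrow> walk E v u (rev p)"
  by (auto simp: walk_def path_edges_rev hd_rev last_rev)

lemma simple_path_rev: "simple_path E u v p \<Longrightarrow> simple_path E v u (rev p)"
  by (simp add: simple_path_walk walk_rev)

lemma walk_append:
  assumes "walk E u w p" "walk E w v q"
  shows "walk E u v (p @ tl q)" "path_edges (p @ tl q) = path_edges p @ path_edges q"
    "path_length l (p @ tl q) = path_length l p + path_length l q"
proof -
  obtain p' where p: "p = p' @ [w]" using assms(1) by (metis append_butlast_last_id walk_def)
  obtain q' where q: "q = w # q'" using assms(2) by (metis list.collapse walk_def)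
  show 1: "path_edges (p @ tl q) = path_edges p @ path_edges q"
    using p q path_edges_append[of p' w q'] by simp
  then show "walk E u v (p @ tl q)" "path_length l (p @ tl q) = path_length l p + path_length l q"
    using assms p q by (auto simp: walk_def path_length_def hd_append)
qed

text \<open>Cutting out the part between two visits of a node only drops edges, so edge set, length
  and number of nodes shrink together.\<close>

lemma walk_imp_simple_path:
  assumes "walk E u v p"
  obtains q where "simple_path E u v q" "set (path_edges q) \<subseteq> set (path_edges p)"
    "path_length l q \<le> path_length l p" "length q \<le> length p"
proof -
  have "\<exists>q. simple_path E u v q \<and> set (path_edges q) \<subseteq> set (path_edges p) \<and>
    path_length l q \<le> path_length l p \<and> length q \<le> length p"
    using assms
  proof (induction "length p" arbitrary: p rule: less_induct)
    case less
    show ?case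
    proof (cases "distinct p")
      case True
      then show ?thesis using less by (auto simp: simple_path_walk)
    next
      case False
      then obtain xs ys zs y where p: "p = xs @ [y] @ ys @ [y] @ zs"
        using not_distinct_decomp by blast
      let ?q = "xs @ y # zs"
      have pe: "path_edges p = path_edges (xs @ [y]) @ path_edges (y # ys @ [y]) @ path_edges (y # zs)"
        "path_edges ?q = path_edges (xs @ [y]) @ path_edges (y # zs)"
        using p path_edges_append[of xs y "ys @ y # zs"] path_edges_append[of "y # ys" y zs]
          path_edges_append[of xs y zs] by auto
      have "walk E u v ?q" using less(2) pe p unfolding walk_def by (auto simp: hd_append)
      moreover have "set (path_edges ?q) \<subseteq> set (path_edges p)" "path_length l ?q \<le> path_length l p"
        using pe by (auto simp: path_length_def)
      moreover have "length ?q < length p" using p by simp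
      ultimately show ?thesis using less(1)[of ?q] by (meson le_trans less_imp_le subset_trans)
    qed
  qed
  then show thesis using that by blast
qed

text \<open>Junk value unless \<open>u\<close> and \<open>v\<close> are connected.\<close>

definition nat_dist :: "nat set set \<Rightarrow> (nat set \<Rightarrow> nat) \<Rightarrow> nat \<Rightarrow> nat \<Rightarrow> nat" where
  "nat_dist E l u v = (LEAST k. \<exists>p. simple_path E u v p \<and> path_length l p = k)"

lemma nat_dist_le: "simple_path E u v p \<Longrightarrow> nat_dist E l u v \<le> path_length l p"
  unfolding nat_dist_def by (intro Least_le) blast

lemma nat_dist_attained:
  assumes "simple_path E u v p"
  obtains q where "simple_path E u v q" "path_length l q = nat_dist E l u v"
proof -
  let ?P = "\<lambda>k. \<exists>p. simple_path E u v p \<and> path_length l p = k"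
  have "?P (path_length l p)" using assms by blast
  then have "?P (Least ?P)" by (rule LeastI)
  then have "\<exists>q. simple_path E u v q \<and> path_length l q = nat_dist E l u v"
    unfolding nat_dist_def .
  then show thesis using that by blast
qed

lemma path_dist_eq:
  assumes "simple_path E u v p"
  shows "path_dist E l u v = ereal (real (nat_dist E l u v))"
  unfolding path_dist_def
proof (rule antisym)
  obtain q where "simple_path E u v q" "path_length l q = nat_dist E l u v"
    using nat_dist_attained[OF assms] .
  then show "(INF p\<in>{p. simple_path E u v p}. ereal (real (path_length l p))) \<le> ereal (real (nat_dist E l u v))"
    by (intro INF_lower2[of q]) auto
qed (auto intro!: INF_greatest nat_dist_le)

text \<open>Lengths are natural numbers, so the infimum is attained if there is a path; otherwise
  the distance is infinite and both sides fail.\<close>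

lemma path_dist_le_iff:
  "path_dist E l u v \<le> ereal x \<longleftrightarrow> (\<exists>p. simple_path E u v p \<and> real (path_length l p) \<le> x)"
proof (cases "\<exists>p. simple_path E u v p")
  case True
  then obtain p where p: "simple_path E u v p" by blast
  then obtain q where "simple_path E u v q" "path_length l q = nat_dist E l u v"
    using nat_dist_attained by blast
  then have "(\<exists>p. simple_path E u v p \<and> real (path_length l p) \<le> x) \<longleftrightarrow> real (nat_dist E l u v) \<le> x"
    using nat_dist_le[of E u v _ l] by (metis of_nat_le_iff order_trans)
  then show ?thesis unfolding path_dist_eq[OF p] by simp
next
  case False
  then show ?thesis by (simp add: path_dist_def top_ereal_def)
qed

lemma two_shortest_unique:
  assumes "two_shortest E l u v a b"
  shows "nat_dist E l u v = a"
proof -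
  obtain p where p: "simple_path E u v p" "path_length l p = a"
    "\<And>q. simple_path E u v q \<Longrightarrow> a \<le> path_length l q"
    using assms unfolding two_shortest_def by blast
  then show ?thesis using nat_dist_le[OF p(1)] nat_dist_attained[OF p(1)] by (metis le_antisym)
qed

text \<open>A vertex of small total degree exists by double counting; choose it and discard its neighbours.\<close>

lemma independent_subset:
  fixes out :: "'a \<Rightarrow> 'a set"
  assumes "finite S" "\<And>e. e \<in> S \<Longrightarrow> card (out e \<inter> S) \<le> t" "\<And>e. e \<in> S \<Longrightarrow> e \<notin> out e"
    "r * (2 * t + 1) \<le> card S"
  shows "\<exists>R\<subseteq>S. card R = r \<and> (\<forall>e\<in>R. out e \<inter> R = {})"
  using assms
proof (induction r arbitrary: S)
  case 0
  then show ?case by (intro exI[of _ "{}"]) auto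
next
  case (Suc r)
  have "S \<noteq> {}" using Suc.prems by auto
  have "\<exists>f\<in>S. card {e\<in>S. f \<in> out e} \<le> t"
  proof (rule ccontr)
    assume "\<not> ?thesis"
    then have gt: "t < card {e\<in>S. f \<in> out e}" if "f \<in> S" for f using that by force
    have "t * card S < (\<Sum>f\<in>S. card {e\<in>S. f \<in> out e})"
      using sum_strict_mono[of S "\<lambda>_. t" "\<lambda>f. card {e\<in>S. f \<in> out e}"] gt \<open>S \<noteq> {}\<close> Suc.prems(1)
      by (simp add: mult.commute)
    also have "\<dots> = (\<Sum>e\<in>S. card {f\<in>S. f \<in> out e})"
      using Suc.prems(1) by (intro sum_multicount_gen) auto
    also have "\<dots> \<le> (\<Sum>e\<in>S. t)"
    proof (rule sum_mono)
      fix e assume "e \<in> S"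
      moreover have "{f\<in>S. f \<in> out e} = out e \<inter> S" by auto
      ultimately show "card {f\<in>S. f \<in> out e} \<le> t" using Suc.prems(2) by simp
    qed
    finally show False by (simp add: mult.commute)
  qed
  then obtain f where f: "f \<in> S" "card {e\<in>S. f \<in> out e} \<le> t" by blast
  define D where "D = insert f ((out f \<inter> S) \<union> {e\<in>S. f \<in> out e})"
  have "card D \<le> Suc (card ((out f \<inter> S) \<union> {e\<in>S. f \<in> out e}))"
    unfolding D_def by (rule card_insert_le_m1) auto
  also have "\<dots> \<le> 2 * t + 1"
    using card_Un_le[of "out f \<inter> S" "{e\<in>S. f \<in> out e}"] Suc.prems(2)[OF f(1)] f(2) by simp
  finally have D: "card D \<le> 2 * t + 1" .
  have "finite D" "D \<subseteq> S" using Suc.prems(1) f by (auto simp: D_def)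
  then have "r * (2 * t + 1) \<le> card (S - D)"
    using Suc.prems(4) D by (simp add: card_Diff_subset)
  moreover have "card (out e \<inter> (S - D)) \<le> t" if "e \<in> S - D" for e
  proof -
    have "card (out e \<inter> (S - D)) \<le> card (out e \<inter> S)"
      using Suc.prems(1) by (intro card_mono) auto
    then show ?thesis using Suc.prems(2)[of e] that by simp
  qed
  ultimately obtain R where R: "R \<subseteq> S - D" "card R = r" "\<forall>e\<in>R. out e \<inter> R = {}"
    using Suc.IH[of "S - D"] Suc.prems(1,3) by blast
  have "f \<notin> R" "finite R" using R(1) Suc.prems(1) by (auto simp: D_def intro: finite_subset)
  then have "card (insert f R) = Suc r" using R(2) by simp
  moreover have "\<forall>e\<in>insert f R. out e \<inter> insert f R = {}"
    using R f Suc.prems(3) by (auto simp: D_def)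
  ultimately show ?case using R(1) f(1) by (intro exI[of _ "insert f R"]) auto
qed

lemma doubleton_eq: "{a, b} = {c, d} \<longleftrightarrow> (a = c \<and> b = d) \<or> (a = d \<and> b = c)"
  by (auto simp: doubleton_eq_iff)

locale spanner =
  fixes I :: spanner_inst
  assumes unit: "unit_weight_inst I"
begin

abbreviation "n \<equiv> nodes I"
abbreviation "E \<equiv> edges I"
abbreviation "l \<equiv> len I"
abbreviation "\<alpha> \<equiv> real_of_rat (stretch I)"
abbreviation "d \<equiv> nat_dist E l"
abbreviation "N \<equiv> nontrivial_edges I"

section \<open>Elementary properties of unit-weight instances\<close>

lemma alpha_ge: "1 \<le> \<alpha>"
  using unit by (simp add: unit_weight_inst_def one_le_of_rat_iff)

lemma len_pos: "e \<in> E \<Longrightarrow> 1 \<le> l e"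
  using unit by (simp add: unit_weight_inst_def)

lemma connected: "connected_graph n E"
  using unit by (simp add: unit_weight_inst_def)

lemma edge_nodes:
  assumes "{u, v} \<in> E"
  shows "u < n" "v < n" "u \<noteq> v"
  using connected assms unfolding connected_graph_def ugraph_def by (metis doubleton_eq)+

lemma finite_edges: "finite E"
proof -
  have "E \<subseteq> (\<lambda>(u, v). {u, v}) ` ({..<n} \<times> {..<n})"
    using connected by (fastforce simp: connected_graph_def ugraph_def)
  then show ?thesis by (rule finite_subset) simp
qed

lemma edgeE:
  assumes "e \<in> E"
  obtains u v where "e = {u, v}" "u < n" "v < n" "u \<noteq> v"
proof -
  have "\<exists>u v. u < n \<and> v < n \<and> u \<noteq> v \<and> e = {u, v}"
    using connected assms unfolding connected_graph_def ugraph_def by (elim conjE) (rule bspec)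
  then show thesis using that by blast
qed

lemma dist_eq: "u < n \<Longrightarrow> v < n \<Longrightarrow> path_dist E l u v = ereal (real (d u v))"
proof -
  assume "u < n" "v < n"
  then obtain p where "simple_path E u v p" using connected unfolding connected_graph_def by blast
  then show ?thesis by (rule path_dist_eq)
qed

lemma settling_iff:
  assumes "u < n" "v < n"
  shows "settling I u v p \<longleftrightarrow> simple_path E u v p \<and> real (path_length l p) \<le> \<alpha> * real (d u v)"
  by (simp add: settling_def dist_eq[OF assms])

lemma d_sym: "d u v = d v u"
  unfolding nat_dist_def by (metis path_length_rev simple_path_rev)

lemma simple_path_edge: "u \<noteq> v \<Longrightarrow> {u, v} \<in> E \<Longrightarrow> simple_path E u v [u, v]"
  by (simp add: simple_path_def)

lemma edge_settles:
  assumes "{u, v} \<in> E"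
  shows "settling I u v [u, v]"
  using assms edge_nodes[OF assms] unit simple_path_edge
  by (auto simp: settling_def unit_weight_inst_def)

lemma d_edge_le: "{u, v} \<in> E \<Longrightarrow> d u v \<le> l {u, v}"
  using nat_dist_le[OF simple_path_edge, of u v l] edge_nodes by fastforce

lemma settling_rev:
  assumes "{u, v} \<in> E" "settling I u v p"
  shows "settling I v u (rev p)"
  using assms edge_nodes[OF assms(1)] simple_path_rev d_sym
  by (simp add: settling_iff path_length_rev)

text \<open>The one predicate behind all notions of the problem: \<open>e\<close> is nontrivial iff
  it bypasses \<open>{e}\<close>, critical iff it does not bypass \<open>N\<close>, and a set can be
  removed iff each of its edges bypasses the set. The existential over \<open>u\<close> and
  \<open>v\<close> makes it independent of the orientation of \<open>e\<close>.\<close>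

definition bypass :: "nat set set \<Rightarrow> nat set \<Rightarrow> bool" where
  "bypass R e \<longleftrightarrow> (\<exists>u v p. e = {u, v} \<and> settling I u v p \<and> set (path_edges p) \<inter> R = {})"

lemma bypass_iff:
  assumes "{u, v} \<in> E"
  shows "bypass R {u, v} \<longleftrightarrow> (\<exists>p. settling I u v p \<and> set (path_edges p) \<inter> R = {})"
proof
  assume "bypass R {u, v}"
  then obtain x y p where p: "{u, v} = {x, y}" "settling I x y p" "set (path_edges p) \<inter> R = {}"
    by (auto simp: bypass_def)
  then have "(x = u \<and> y = v) \<or> (x = v \<and> y = u)" by (auto simp: doubleton_eq)
  then show "\<exists>p. settling I u v p \<and> set (path_edges p) \<inter> R = {}"
  proof
    assume "x = v \<and> y = u"
    then have "settling I u v (rev p)" "set (path_edges (rev p)) \<inter> R = {}"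
      using p settling_rev[of x y p] assms by (auto simp: path_edges_rev insert_commute)
    then show ?thesis by blast
  qed (use p in blast)
qed (auto simp: bypass_def)

lemma nontrivial_iff:
  assumes "{u, v} \<in> E"
  shows "{u, v} \<in> N \<longleftrightarrow> bypass {{u, v}} {u, v}"
proof -
  have "{u, v} \<in> N \<longleftrightarrow> (\<exists>x y. {u, v} = {x, y} \<and> (\<exists>p. settling I x y p \<and> alternative x y p))"
    using assms unit
    by (auto simp: nontrivial_edges_def trivial_edges_def mandatory_edges_def unit_weight_inst_def)
  also have "\<dots> \<longleftrightarrow> bypass {{u, v}} {u, v}"
    unfolding bypass_def alternative_def
    by (simp del: insert_iff add: insert_iff[of _ "{u, v}" "{}"]) metis
  finally show ?thesis .
qed

lemma N_subset: "N \<subseteq> E"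
  by (auto simp: nontrivial_edges_def)

lemma critical_iff: "e \<in> critical_pairs I \<longleftrightarrow> e \<in> E \<and> \<not> bypass N e"
proof -
  have "set (path_edges p) \<subseteq> trivial_edges I \<longleftrightarrow> set (path_edges p) \<inter> N = {}" if "settling I u v p" for u v p
  proof -
    have "set (path_edges p) \<subseteq> E" using that by (simp add: settling_def simple_path_def)
    moreover have "trivial_edges I \<subseteq> E" by (auto simp: trivial_edges_def mandatory_edges_def)
    ultimately show ?thesis unfolding nontrivial_edges_def by blast
  qed
  then show ?thesis unfolding critical_pairs_def bypass_def by blast
qed

lemma bypass_anti: "bypass R e \<Longrightarrow> S \<subseteq> R \<Longrightarrow> bypass S e"
  unfolding bypass_def by blast

text \<open>The reason why the spanner condition may be checked on edges only: stretching each edge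
  by at most \<open>\<alpha>\<close> stretches the sum by at most \<open>\<alpha>\<close>.\<close>

lemma replace_walk:
  assumes edge: "\<And>x y. {x, y} \<in> E \<Longrightarrow> \<exists>q. simple_path F x y q \<and> real (path_length l q) \<le> \<alpha> * real (l {x, y})"
    and "walk E u v p"
  shows "\<exists>q. walk F u v q \<and> real (path_length l q) \<le> \<alpha> * real (path_length l p)"
  using assms(2)
proof (induction p arbitrary: u rule: induct_list012)
  case (2 x)
  then show ?case by (intro exI[of _ "[x]"]) (auto simp: walk_def)
next
  case (3 x y p)
  then have "{x, y} \<in> E" "walk E y v (y # p)" "u = x" by (auto simp: walk_def)
  then obtain q1 q2 where q: "simple_path F x y q1" "real (path_length l q1) \<le> \<alpha> * real (l {x, y})"
    "walk F y v q2" "real (path_length l q2) \<le> \<alpha> * real (path_length l (y # p))"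
    using 3(2) edge by blast
  then have "walk F u v (q1 @ tl q2)"
    "real (path_length l (q1 @ tl q2)) \<le> \<alpha> * real (path_length l (x # y # p))"
    using walk_append[of F x y q1 v q2] \<open>u = x\<close> by (auto simp: simple_path_walk algebra_simps)
  then show ?case by blast
qed (simp add: walk_def)

lemma spanner_if_bypass:
  assumes R: "R \<subseteq> E" "\<And>e. e \<in> R \<Longrightarrow> bypass R e"
  shows "is_spanner I (E - R)"
  unfolding is_spanner_def
proof (intro conjI allI impI)
  have edge: "\<exists>q. simple_path (E - R) x y q \<and> real (path_length l q) \<le> \<alpha> * real (l {x, y})"
    if xy: "{x, y} \<in> E" for x y
  proof -
    \<comment> \<open>A kept edge bypasses \<open>R\<close> by itself, because every edge settles
      itself by the preprocessing convention.\<close>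
    have "bypass R {x, y}"
    proof (cases "{x, y} \<in> R")
      case False
      then show ?thesis using edge_settles[OF xy] unfolding bypass_iff[OF xy] by (intro exI[of _ "[x, y]"]) auto
    qed (use R in auto)
    then obtain p where p: "settling I x y p" "set (path_edges p) \<inter> R = {}" using bypass_iff[OF xy] by blast
    have "real (path_length l p) \<le> \<alpha> * real (d x y)" "simple_path E x y p"
      using p edge_nodes[OF xy] by (auto simp: settling_iff)
    moreover have "\<alpha> * real (d x y) \<le> \<alpha> * real (l {x, y})"
      using d_edge_le[OF xy] alpha_ge by (intro mult_left_mono) auto
    ultimately show ?thesis using p(2) by (intro exI[of _ p]) (auto simp: simple_path_def)
  qed
  fix u v assume uv: "u < n" "v < n"
  then obtain p where p: "simple_path E u v p" "path_length l p = d u v"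
    using connected nat_dist_attained unfolding connected_graph_def by metis
  then obtain q where q: "walk (E - R) u v q" "real (path_length l q) \<le> \<alpha> * real (d u v)"
    using replace_walk[OF edge, of u v p] by (auto simp: simple_path_walk)
  obtain q' where "simple_path (E - R) u v q'" "path_length l q' \<le> path_length l q"
    using walk_imp_simple_path[OF q(1)] by metis
  then show "path_dist (E - R) l u v \<le> ereal \<alpha> * path_dist E l u v"
    using q(2) by (auto simp: dist_eq[OF uv] path_dist_le_iff intro!: exI[of _ q'])
qed auto

lemma bypass_if_spanner:
  assumes "is_spanner I F" "e \<in> E"
  shows "bypass (E - F) e"
proof -
  obtain u v where e: "e = {u, v}" "u < n" "v < n" using edgeE[OF assms(2)] by metis
  have "path_dist F l u v \<le> ereal (\<alpha> * real (d u v))"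
    using assms(1) e(2,3) dist_eq[OF e(2,3)] unfolding is_spanner_def
    by (metis times_ereal.simps(1))
  then obtain p where "simple_path F u v p" "real (path_length l p) \<le> \<alpha> * real (d u v)"
    unfolding path_dist_le_iff by blast
  then show ?thesis
    unfolding bypass_def using e assms(1)
    by (intro exI[of _ u] exI[of _ v] exI[of _ p]) (auto simp: settling_iff simple_path_def is_spanner_def)
qed

section \<open>Removable sets and tightness\<close>

definition removable :: "nat set set \<Rightarrow> bool" where
  "removable R \<longleftrightarrow> R \<subseteq> N \<and> card R = removals I \<and> (\<forall>e\<in>R. bypass R e)"

lemma removable_solution:
  assumes "removable R"
  shows "solution I (E - R)"
proof -
  have R: "R \<subseteq> N" "card R = removals I" "\<And>e. e \<in> R \<Longrightarrow> bypass R e"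
    using assms by (auto simp: removable_def)
  have "N - (E - R) = R" using R(1) N_subset by auto
  then show ?thesis
    using spanner_if_bypass[of R] R N_subset by (auto simp: solution_def)
qed

text \<open>By \<open>bypass_anti\<close> putting removed edges back never hurts, so it suffices to
  search for sets of exactly the required size.\<close>

lemma solution_iff: "(\<exists>F. solution I F) \<longleftrightarrow> (\<exists>R. removable R)"
proof
  assume "\<exists>F. solution I F"
  then obtain F where F: "is_spanner I F" "removals I \<le> card (N - F)" by (auto simp: solution_def)
  then obtain R where R: "R \<subseteq> N - F" "card R = removals I" by (metis obtain_subset_with_card_n)
  have "bypass R e" if "e \<in> R" for e
    using bypass_anti[OF bypass_if_spanner[OF F(1)], of e R] R N_subset that by blast
  then show "\<exists>R. removable R" using R by (auto simp: removable_def)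
qed (use removable_solution in blast)

lemma tightness_ge:
  assumes "{u, v} \<in> critical_pairs I"
  shows "card (nontrivial_part I (tightest_path I u v)) \<le> tightness I"
proof -
  let ?f = "\<lambda>(u, v). card (nontrivial_part I (tightest_path I u v))"
  have "{card (nontrivial_part I (tightest_path I u v)) |u v. {u, v} \<in> critical_pairs I}
      \<subseteq> ?f ` ({..<n} \<times> {..<n})"
    using edge_nodes by (fastforce simp: critical_iff)
  then have "finite {card (nontrivial_part I (tightest_path I u v)) |u v. {u, v} \<in> critical_pairs I}"
    by (rule finite_subset) simp
  then show ?thesis unfolding tightness_def using assms by (intro Max_ge) auto
qed

lemma tightest_path:
  assumes "{u, v} \<in> N"
  shows "settling I u v (tightest_path I u v)" "alternative u v (tightest_path I u v)"
proof -
  have "\<exists>p. settling I u v p \<and> alternative u v p"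
    using nontrivial_iff[of u v] bypass_iff[of u v] assms N_subset by (auto simp: alternative_def)
  then obtain p where "settling I u v p \<and> alternative u v p" by blast
  then have "settling I u v (tightest_path I u v) \<and> alternative u v (tightest_path I u v)"
    unfolding tightest_path_def by (rule arg_min_natI)
  then show "settling I u v (tightest_path I u v)" "alternative u v (tightest_path I u v)" by auto
qed

text \<open>A trivial edge is itself a settling path without nontrivial edges.\<close>

lemma critical_nontrivial: "critical_pairs I \<subseteq> N"
proof
  fix e assume "e \<in> critical_pairs I"
  then have e: "e \<in> E" "\<not> bypass N e" by (auto simp: critical_iff)
  obtain u v where uv: "e = {u, v}" using edgeE[OF e(1)] by metis
  show "e \<in> N"
  proof (rule ccontr)
    assume "e \<notin> N"
    then have "set (path_edges [u, v]) \<inter> N = {}" using uv by simp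
    then show False using e uv edge_settles[of u v] bypass_iff[of u v N] by blast
  qed
qed

text \<open>Extends the bound from critical to all nontrivial edges: a noncritical one has a
  settling path without any nontrivial edge, which therefore also avoids the edge itself.\<close>

lemma light_alternative:
  assumes "e \<in> N"
  shows "\<exists>p u v. e = {u, v} \<and> settling I u v p \<and> e \<notin> set (path_edges p) \<and>
    card (nontrivial_part I p) \<le> tightness I"
proof -
  obtain u v where uv: "e = {u, v}" using edgeE assms N_subset by (metis subsetD)
  show ?thesis
  proof (cases "e \<in> critical_pairs I")
    case True
    then show ?thesis
      using tightest_path[of u v] tightness_ge[of u v] uv assms unfolding alternative_def by blast
  next
    case False
    then have "bypass N e" using assms N_subset by (auto simp: critical_iff)
    then obtain x y p where "e = {x, y}" "settling I x y p" "set (path_edges p) \<inter> N = {}"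
      by (auto simp: bypass_def)
    then show ?thesis using assms by (intro exI[of _ p] exI[of _ x] exI[of _ y]) (auto simp: nontrivial_part_def)
  qed
qed

text \<open>The digraph has an arc from \<open>e\<close> to every edge of \<open>S\<close> on its
  path \<open>P e\<close>. If \<open>R\<close> is independent, every \<open>P e\<close> with
  \<open>e\<close> in \<open>R\<close> avoids \<open>R\<close>, so all of \<open>R\<close> can be
  removed at once.\<close>

lemma many_removable:
  assumes "S \<subseteq> N" "removals I * (2 * tightness I + 1) \<le> card S"
  shows "\<exists>R\<subseteq>S. removable R"
proof -
  have "\<forall>e\<in>S. \<exists>p. (\<exists>u v. e = {u, v} \<and> settling I u v p) \<and> e \<notin> set (path_edges p) \<and>
    card (nontrivial_part I p) \<le> tightness I"
    using light_alternative assms(1) by blast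
  then obtain P where P: "\<And>e. e \<in> S \<Longrightarrow> (\<exists>u v. e = {u, v} \<and> settling I u v (P e)) \<and>
    e \<notin> set (path_edges (P e)) \<and> card (nontrivial_part I (P e)) \<le> tightness I"
    by metis
  have fin: "finite S" using assms(1) N_subset finite_edges finite_subset by metis
  have "card (set (path_edges (P e)) \<inter> S) \<le> tightness I" if "e \<in> S" for e
  proof -
    have "card (set (path_edges (P e)) \<inter> S) \<le> card (nontrivial_part I (P e))"
      using assms(1) by (intro card_mono) (auto simp: nontrivial_part_def)
    then show ?thesis using P[OF that] by linarith
  qed
  then have "\<exists>R\<subseteq>S. card R = removals I \<and> (\<forall>e\<in>R. set (path_edges (P e)) \<inter> R = {})"
    using P assms(2) by (intro independent_subset[OF fin]) blast+
  then obtain R where R: "R \<subseteq> S" "card R = removals I" "\<forall>e\<in>R. set (path_edges (P e)) \<inter> R = {}"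
    by blast
  have "bypass R e" if "e \<in> R" for e
    using P[of e] R that unfolding bypass_def by blast
  then have "removable R" using R(1,2) assms(1) by (auto simp: removable_def)
  then show ?thesis using R(1) by blast
qed

text \<open>For use in the other direction: if the tightness is 0, there are no critical edges and
  hence nothing to check, which matches a time bound whose shortest path term vanishes.\<close>

lemma tightness_pos:
  assumes "critical_pairs I \<noteq> {}"
  shows "0 < tightness I"
proof -
  obtain e where e: "e \<in> critical_pairs I" using assms by blast
  then obtain u v where uv: "e = {u, v}" using edgeE unfolding critical_iff by metis
  have N: "{u, v} \<in> N" using critical_nontrivial e uv by blast
  let ?p = "tightest_path I u v"
  have "set (path_edges ?p) \<inter> N \<noteq> {}"
    using tightest_path(1)[OF N] e uv unfolding critical_iff bypass_def by blast
  then have "0 < card (nontrivial_part I ?p)" by (simp add: nontrivial_part_def card_gt_0_iff)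
  then show ?thesis using tightness_ge[of u v] e uv by simp
qed

section \<open>Integer tests for settling paths\<close>

abbreviation "num \<equiv> nat (fst (quotient_of (stretch I)))"
abbreviation "den \<equiv> nat (snd (quotient_of (stretch I)))"

lemma q_pos: "0 < den"
  using quotient_of_denom_pos' by simp

lemma alpha_frac: "\<alpha> = real num / real den"
proof -
  obtain x y where xy: "quotient_of (stretch I) = (x, y)" by (cases "quotient_of (stretch I)")
  then have "stretch I = of_int x / of_int y" by (rule quotient_of_div)
  then have a: "\<alpha> = real_of_int x / real_of_int y" by (simp add: of_rat_divide)
  have "0 < y" using quotient_of_denom_pos[OF xy] .
  moreover have "0 < x"
  proof -
    have "0 < \<alpha> * real_of_int y" using alpha_ge \<open>0 < y\<close> by simp
    then show ?thesis using a \<open>0 < y\<close> by simp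
  qed
  ultimately show ?thesis using a xy by simp
qed

lemma le_alpha_iff: "real x \<le> \<alpha> * real y \<longleftrightarrow> den * x \<le> num * y"
proof -
  have "real x \<le> \<alpha> * real y \<longleftrightarrow> real den * real x \<le> real num * real y"
    using q_pos by (simp add: alpha_frac field_simps)
  also have "\<dots> \<longleftrightarrow> den * x \<le> num * y" by (metis of_nat_le_iff of_nat_mult)
  finally show ?thesis .
qed

lemma bypass_edge_iff:
  assumes "{u, v} \<in> E"
  shows "bypass R {u, v} \<longleftrightarrow> (\<exists>\<pi>. simple_path (E - R) u v \<pi> \<and> den * path_length l \<pi> \<le> num * d u v)"
  unfolding bypass_iff[OF assms] settling_iff[OF edge_nodes(1,2)[OF assms]] le_alpha_iff
  by (auto simp: simple_path_def)

text \<open>A single edge of length \<open>B\<close> already exceeds the budget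
  \<open>num * d u v\<close>, as \<open>den\<close> is positive. So a path within the budget uses no
  edge of \<open>R\<close>, and for such paths the two length functions agree.\<close>

lemma bypass_lengthened:
  assumes e: "{u, v} \<in> E" and B: "num * d u v < B"
  shows "bypass R {u, v} \<longleftrightarrow> den * nat_dist E (\<lambda>e. if e \<in> R then B else l e) u v \<le> num * d u v"
proof -
  let ?l = "\<lambda>e. if e \<in> R then B else l e"
  have len: "path_length ?l \<pi> = path_length l \<pi>" if "simple_path (E - R) u v \<pi>" for \<pi>
    using that by (intro path_length_cong) (auto simp: simple_path_def)
  show ?thesis
    unfolding bypass_edge_iff[OF e]
  proof
    assume "\<exists>\<pi>. simple_path (E - R) u v \<pi> \<and> den * path_length l \<pi> \<le> num * d u v"
    then obtain \<pi> where \<pi>: "simple_path (E - R) u v \<pi>" "den * path_length l \<pi> \<le> num * d u v" by blast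
    have "simple_path E u v \<pi>" using \<pi>(1) by (auto simp: simple_path_def)
    then have "nat_dist E ?l u v \<le> path_length l \<pi>" using nat_dist_le len[OF \<pi>(1)] by metis
    then show "den * nat_dist E ?l u v \<le> num * d u v" using \<pi>(2) by (meson le_trans mult_le_mono2)
  next
    assume le: "den * nat_dist E ?l u v \<le> num * d u v"
    obtain \<pi> where \<pi>: "simple_path E u v \<pi>" "path_length ?l \<pi> = nat_dist E ?l u v"
      using nat_dist_attained[OF simple_path_edge[OF edge_nodes(3)[OF e] e]] by metis
    have "set (path_edges \<pi>) \<inter> R = {}"
    proof (rule ccontr)
      assume "set (path_edges \<pi>) \<inter> R \<noteq> {}"
      then obtain f where "f \<in> set (path_edges \<pi>)" "f \<in> R" by blast
      then have "B \<le> nat_dist E ?l u v" using path_length_ge[of f \<pi> ?l] \<pi>(2) by simp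
      then have "B \<le> den * nat_dist E ?l u v" using q_pos by (metis One_nat_def Suc_leI le_trans mult_le_mono1 nat_mult_1)
      then show False using le B by simp
    qed
    then have "simple_path (E - R) u v \<pi>" using \<pi>(1) by (auto simp: simple_path_def)
    then show "\<exists>\<pi>. simple_path (E - R) u v \<pi> \<and> den * path_length l \<pi> \<le> num * d u v"
      using len \<pi>(2) le by metis
  qed
qed

text \<open>Hence a simple path is alternative iff it differs from \<open>[u, v]\<close>, a property
  that counting paths can decide.\<close>

lemma only_simple_path_via_edge:
  assumes "simple_path F u v \<pi>" "{u, v} \<in> set (path_edges \<pi>)" "u \<noteq> v"
  shows "\<pi> = [u, v]"
proof -
  obtain \<pi>' where \<pi>: "\<pi> = u # \<pi>'" "u \<notin> set \<pi>'" "distinct \<pi>'"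
    using assms(1) unfolding simple_path_def by (metis distinct.simps(2) list.collapse)
  then obtain y \<pi>'' where y: "\<pi>' = y # \<pi>''" using assms(2) by (cases \<pi>') auto
  have sub: "e \<subseteq> set r" if "e \<in> set (path_edges r)" for e r
    using that by (induction r rule: induct_list012) auto
  have "{u, v} \<notin> set (path_edges \<pi>')" using sub \<pi>(2) by blast
  then have "y = v" using assms(2,3) \<pi> y by (auto simp: doubleton_eq)
  moreover have "last \<pi>' = v" using assms(1) \<pi> y by (auto simp: simple_path_def)
  ultimately have "\<pi>'' = []" using \<pi>(3) y by (metis distinct.simps(2) last_ConsR last_in_set)
  then show ?thesis using \<pi> y \<open>y = v\<close> by simp
qed

text \<open>The edge settles itself, so an alternative settling path exists iff at least two paths
  settle, that is, iff the second shortest one does. Which of the two is the edge is irrelevant, and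
  so are ties. The value \<open>b = 0\<close> cannot be the length of a second path, since lengths
  are positive.\<close>

lemma nontrivial_two_shortest:
  assumes e: "{u, v} \<in> E" and ab: "two_shortest E l u v a b"
  shows "{u, v} \<in> N \<longleftrightarrow> b \<noteq> 0 \<and> den * b \<le> num * a"
proof -
  note uv = edge_nodes[OF e]
  have a: "d u v = a" using two_shortest_unique[OF ab] .
  have settle: "settling I u v \<pi> \<longleftrightarrow> simple_path E u v \<pi> \<and> den * path_length l \<pi> \<le> num * a" for \<pi>
    unfolding settling_iff[OF uv(1,2)] le_alpha_iff a ..
  have N: "{u, v} \<in> N \<longleftrightarrow> (\<exists>\<pi>. settling I u v \<pi> \<and> \<pi> \<noteq> [u, v])"
    unfolding nontrivial_iff[OF e] bypass_iff[OF e]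
    using only_simple_path_via_edge[OF _ _ uv(3)] by (fastforce simp: settling_def)
  obtain p1 where p1: "simple_path E u v p1" "path_length l p1 = a"
    "\<And>r. simple_path E u v r \<Longrightarrow> a \<le> path_length l r"
    and alt: "(\<exists>r. simple_path E u v r \<and> r \<noteq> p1 \<and> path_length l r = b \<and>
            (\<forall>s. simple_path E u v s \<and> s \<noteq> p1 \<longrightarrow> b \<le> path_length l s)) \<or>
         (b = 0 \<and> (\<forall>r. simple_path E u v r \<longrightarrow> r = p1))"
    using ab unfolding two_shortest_def by blast
  have edge: "settling I u v [u, v]" using edge_settles[OF e] .
  show ?thesis
    using alt
  proof
    assume "\<exists>r. simple_path E u v r \<and> r \<noteq> p1 \<and> path_length l r = b \<and>
            (\<forall>s. simple_path E u v s \<and> s \<noteq> p1 \<longrightarrow> b \<le> path_length l s)"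
    then obtain r where r: "simple_path E u v r" "r \<noteq> p1" "path_length l r = b"
      "\<And>s. simple_path E u v s \<Longrightarrow> s \<noteq> p1 \<Longrightarrow> b \<le> path_length l s" by blast
    have "path_edges r \<noteq> []"
    proof
      assume "path_edges r = []"
      then have "length r \<le> 1" using length_path_edges[of r] by simp
      then show False using r(1) uv(3) by (cases r) (auto simp: simple_path_def)
    qed
    then obtain f where f: "f \<in> set (path_edges r)" by (meson last_in_set)
    then have "1 \<le> b" using len_pos[of f] path_length_ge[OF f, of l] r by (fastforce simp: simple_path_def)
    moreover have "den * a \<le> num * a" using p1 settle edge r(3) by (metis le_trans mult_le_mono2 settling_def)
    have "(\<exists>\<pi>. settling I u v \<pi> \<and> \<pi> \<noteq> [u, v]) \<longleftrightarrow> den * b \<le> num * a"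
    proof
      assume "\<exists>\<pi>. settling I u v \<pi> \<and> \<pi> \<noteq> [u, v]"
      then obtain \<pi> where \<pi>: "settling I u v \<pi>" "\<pi> \<noteq> [u, v]" by blast
      \<comment> \<open>Of two different settling paths, at least one differs from the shortest path
        \<open>p1\<close>.\<close>
      obtain \<pi>' where "settling I u v \<pi>'" "\<pi>' \<noteq> p1" using \<pi> edge by metis
      then show "den * b \<le> num * a" using settle r(4) by (meson le_trans mult_le_mono2)
    next
      assume "den * b \<le> num * a"
      then have "settling I u v r" "settling I u v p1" using settle r p1 \<open>den * a \<le> num * a\<close> by auto
      then show "\<exists>\<pi>. settling I u v \<pi> \<and> \<pi> \<noteq> [u, v]" using r(2) by metis
    qed
    ultimately show ?thesis using N by simp
  next
    assume "b = 0 \<and> (\<forall>r. simple_path E u v r \<longrightarrow> r = p1)"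
    then show ?thesis using N edge settle by (metis settling_def)
  qed
qed

end

section \<open>Encoded instances\<close>

lemma length_edge_code [simp]: "length (edge_code l es) = 3 * length es"
  by (induction es) (auto simp: edge_code_def)

lemma edge_code_Cons: "edge_code l (e # es) = fst e # snd e # l {fst e, snd e} # edge_code l es"
  by (cases e) (simp add: edge_code_def)

lemma nth_edge_code:
  assumes "i < length es"
  shows "edge_code l es ! (3 * i) = fst (es ! i)"
    "edge_code l es ! Suc (3 * i) = snd (es ! i)"
    "edge_code l es ! Suc (Suc (3 * i)) = l {fst (es ! i), snd (es ! i)}"
proof -
  have "edge_code l es ! (3 * i) = fst (es ! i) \<and> edge_code l es ! Suc (3 * i) = snd (es ! i) \<and>
    edge_code l es ! Suc (Suc (3 * i)) = l {fst (es ! i), snd (es ! i)}"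
    using assms
  proof (induction es arbitrary: i)
    case (Cons e es)
    then show ?case by (cases i) (auto simp: edge_code_Cons)
  qed simp
  then show "edge_code l es ! (3 * i) = fst (es ! i)" "edge_code l es ! Suc (3 * i) = snd (es ! i)"
    "edge_code l es ! Suc (Suc (3 * i)) = l {fst (es ! i), snd (es ! i)}" by auto
qed

lemma set_edge_code: "set (edge_code l es) = (\<Union>(u, v)\<in>set es. {u, v, l {u, v}})"
  by (auto simp: edge_code_def)

lemma edge_code_cong:
  "(\<And>e. e \<in> set es \<Longrightarrow> l {fst e, snd e} = l' {fst e, snd e}) \<Longrightarrow> edge_code l es = edge_code l' es"
  by (induction es) (auto simp: edge_code_Cons edge_code_def)

text \<open>Overwriting one cell amounts to changing the length function, because no other entry of
  the list describes the same edge.\<close>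

lemma edge_code_update:
  assumes "distinct (map (\<lambda>(u, v). {u, v}) es)" "i < length es"
  shows "(edge_code l es)[Suc (Suc (3 * i)) := x] = edge_code (l({fst (es ! i), snd (es ! i)} := x)) es"
  using assms
proof (induction es arbitrary: i)
  case (Cons e es)
  show ?case
  proof (cases i)
    case 0
    have "{fst f, snd f} \<noteq> {fst e, snd e}" if "f \<in> set es" for f
      using Cons.prems(1) that by (auto simp: case_prod_beta image_iff)
    then have "edge_code (l({fst e, snd e} := x)) es = edge_code l es" by (intro edge_code_cong) simp
    then show ?thesis using 0 by (simp add: edge_code_Cons fun_upd_def)
  next
    case (Suc j)
    have "es ! j \<in> set es" using Suc Cons.prems(2) by simp
    then have "{fst (es ! j), snd (es ! j)} \<noteq> {fst e, snd e}"
      using Cons.prems(1) by (auto simp: case_prod_beta image_iff)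
    then show ?thesis using Suc Cons by (simp add: edge_code_Cons)
  qed
qed simp

text \<open>The contents of an array while a loop overwrites it from left to right.\<close>

definition blend :: "nat \<Rightarrow> nat \<Rightarrow> (nat \<Rightarrow> nat) \<Rightarrow> (nat \<Rightarrow> nat) \<Rightarrow> nat list" where
  "blend m j g h = map (\<lambda>i. if i < j then g i else h i) [0..<m]"

lemma length_blend [simp]: "length (blend m j g h) = m"
  by (simp add: blend_def)

lemma nth_blend [simp]: "i < m \<Longrightarrow> blend m j g h ! i = (if i < j then g i else h i)"
  by (simp add: blend_def)

lemma blend_0: "blend m 0 g h = map h [0..<m]"
  by (simp add: blend_def)

lemma blend_all: "blend m m g h = map g [0..<m]"
  by (simp add: blend_def)

lemma blend_update: "j < m \<Longrightarrow> (blend m j g h)[j := g j] = blend m (Suc j) g h"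
  by (auto intro!: nth_equalityI simp: nth_list_update less_Suc_eq)

lemma blend_skip: "g j = h j \<Longrightarrow> blend m j g h = blend m (Suc j) g h"
  by (auto intro!: nth_equalityI simp: less_Suc_eq)

lemma replicate_blend: "replicate m 0 = blend m 0 g (\<lambda>_. 0)"
  by (auto intro!: nth_equalityI)

text \<open>Copies the edge list behind a header of length \<open>a\<close> that is already in
  place. The limits 12 and 11 keep the constants of the loop within the degree that the word size
  allows.\<close>

lemma (in machine) wp_copy:
  assumes "\<And>k. k \<le> 3 * (length zs - a) + 2 \<Longrightarrow> Q k ((fst s)(i := length zs), (snd s)(b := zs))"
    and "snd s b = take a zs @ replicate (length zs - a) 0" "a \<le> length zs" "b \<noteq> 0" "a \<le> 12" "c \<le> 11"
      "length zs \<le> M" "\<forall>z\<in>set zs. z \<le> M"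
    and "\<And>j. a \<le> j \<Longrightarrow> j < length zs \<Longrightarrow> j + c < length (snd s 0) \<and> snd s 0 ! (j + c) = zs ! j"
  shows "wp (For i (Const a) (Len b) (Write b (Reg i) (Read 0 (Reg i [+] Const c)))) s Q"
proof (rule wp_For[where a = a and n = "length zs" and b = 1 and
    I = "\<lambda>j s'. \<exists>x. s' = ((fst s)(i := x), (snd s)(b := take j zs @ replicate (length zs - j) 0))"])
  fix j and s' :: state
  assume "\<exists>x. s' = ((fst s)(i := x), (snd s)(b := take j zs @ replicate (length zs - j) 0))"
    and j: "fst s' i = j" "a \<le> j" "j < length zs"
  then have s': "s' = ((fst s)(i := j), (snd s)(b := take j zs @ replicate (length zs - j) 0))"
    by (metis fst_conv fun_upd_same)
  have "replicate (length zs - j) (0::nat) = 0 # replicate (length zs - Suc j) 0"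
    using j(3) by (simp flip: replicate_Suc add: Suc_diff_Suc)
  moreover have "zs ! j \<le> M" using assms(8) j(3) by simp
  ultimately show "wp (Write b (Reg i) (Read 0 (Reg i [+] Const c))) s'
       (\<lambda>k s'. k \<le> 1 \<and> fst s' i = j \<and>
          (\<exists>x. ((fst s')(i := Suc j), snd s') = ((fst s)(i := x), (snd s)(b := take (Suc j) zs @ replicate (length zs - Suc j) 0))))"
    using assms(4-6) assms(9)[OF j(2,3)] j
    by (intro wp_Write) (auto simp: s' list_update_append take_Suc_conv_app_nth)
qed (use assms in \<open>auto intro!: exI[of _ a]\<close>)

locale coded = spanner +
  fixes es :: "(nat \<times> nat) list"
  assumes es: "lists_edges es E"
begin

abbreviation "m \<equiv> length es"
abbreviation "\<rho> \<equiv> removals I"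
abbreviation "xs \<equiv> inst_code I es"
abbreviation "src i \<equiv> fst (es ! i)"
abbreviation "tgt i \<equiv> snd (es ! i)"

definition ed :: "nat \<Rightarrow> nat set" where "ed i = {src i, tgt i}"

definition size :: nat where "size = 2 + length xs + Max (insert 0 (set xs))"

lemma word_bound_size: "word_bound D xs = size ^ D"
  by (simp add: word_bound_def size_def)

lemma map_ed: "map (\<lambda>(u, v). {u, v}) es = map ed [0..<m]"
  by (intro nth_equalityI) (auto simp: ed_def case_prod_beta)

lemma ed_in: "i < m \<Longrightarrow> ed i \<in> E"
  using es map_ed unfolding lists_edges_def by auto

lemma inj_ed: "inj_on ed {..<m}"
  using es map_ed unfolding lists_edges_def by (simp add: distinct_map lessThan_atLeast0)

lemma image_ed: "ed ` {..<m} = E"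
  using es map_ed unfolding lists_edges_def by (simp add: lessThan_atLeast0 atLeast_upt)

lemma m_eq: "m = card E"
  using card_image[OF inj_ed] image_ed by simp

lemma src_tgt: "i < m \<Longrightarrow> src i < n" "i < m \<Longrightarrow> tgt i < n" "i < m \<Longrightarrow> src i \<noteq> tgt i"
  using ed_in edge_nodes unfolding ed_def by blast+

lemma length_xs [simp]: "length xs = 5 + 3 * m"
  by (simp add: inst_code_def rat_code_def)

lemma nth_xs [simp]: "xs ! 0 = n" "xs ! 1 = m" "xs ! Suc 0 = m" "xs ! 2 = \<rho>" "xs ! 3 = num" "xs ! 4 = den"
  by (auto simp: inst_code_def rat_code_def)

lemma nth_xs_code: "xs ! (5 + i) = edge_code l es ! i"
  by (simp add: inst_code_def rat_code_def numeral_eq_Suc)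

lemma nth_xs_edge:
  assumes "i < m"
  shows "xs ! (5 + 3 * i) = src i" "xs ! (6 + 3 * i) = tgt i" "xs ! (7 + 3 * i) = l (ed i)"
  using nth_edge_code[OF assms, of l] nth_xs_code[of "3 * i"] nth_xs_code[of "Suc (3 * i)"]
    nth_xs_code[of "Suc (Suc (3 * i))"]
  by (auto simp: ed_def)

lemma in_xs_less: "x \<in> set xs \<Longrightarrow> x + 2 + length xs \<le> size"
  unfolding size_def by (simp add: Max_ge_iff)

lemma size_bounds:
  "m + 7 \<le> size" "3 * m + 7 \<le> size" "n + 2 \<le> size" "\<rho> + 2 \<le> size" "num + 2 \<le> size" "den + 2 \<le> size"
  "i < m \<Longrightarrow> l (ed i) + 2 \<le> size"
proof -
  have "xs ! i + 2 + length xs \<le> size" if "i < length xs" for i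
    using in_xs_less nth_mem that by blast
  from this[of 0] this[of 1] this[of 2] this[of 3] this[of 4] this[of "7 + 3 * i"]
  show "m + 7 \<le> size" "3 * m + 7 \<le> size" "n + 2 \<le> size" "\<rho> + 2 \<le> size" "num + 2 \<le> size" "den + 2 \<le> size"
    "i < m \<Longrightarrow> l (ed i) + 2 \<le> size"
    using nth_xs_edge[of i] by auto
qed

text \<open>With at least two nodes, connectedness gives every node an incident edge; the 1 is for
  the graph with a single node. This allows a search that is linear in \<open>n + m\<close> to be
  charged to \<open>m\<close>.\<close>

lemma nodes_le: "n \<le> 2 * m + 1"
proof (cases "n \<le> 1")
  case False
  have "{..<n} \<subseteq> \<Union>E"
  proof
    fix v assume "v \<in> {..<n}"
    then obtain w where vw: "v < n" "w < n" "v \<noteq> w" using False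
      by (metis One_nat_def lessThan_iff less_numeral_extra(1) linorder_not_less order_less_le_trans not_less_iff_gr_or_eq)
    then obtain \<pi> where \<pi>: "simple_path E v w \<pi>" using connected unfolding connected_graph_def by blast
    then obtain \<pi>' where 1: "\<pi> = v # \<pi>'" unfolding simple_path_def by (metis list.collapse)
    then obtain y \<pi>'' where "\<pi>' = y # \<pi>''" using \<pi> vw(3) unfolding simple_path_def by (cases \<pi>') auto
    then have "{v, y} \<in> E" using \<pi> 1 by (simp add: simple_path_def)
    then show "v \<in> \<Union>E" by blast
  qed
  moreover have "finite (\<Union>E)" using finite_edges edgeE by (metis finite.simps finite_Union)
  ultimately have "n \<le> card (\<Union>E)" using card_mono[of "\<Union>E" "{..<n}"] by simp
  also have "\<dots> \<le> (\<Sum>e\<in>E. card e)" by (rule card_Union_le_sum_card)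
  also have "\<dots> \<le> (\<Sum>e\<in>E. 2)"
  proof (rule sum_mono)
    fix e assume "e \<in> E"
    then obtain u v where "e = {u, v}" using edgeE by metis
    then show "card e \<le> 2" by (simp add: card_insert_if)
  qed
  finally show ?thesis by (simp add: m_eq)
qed simp

text \<open>Value 0 marks trivial edges, and an edge with value 2 need not be checked.\<close>

definition valid_flags :: "nat list \<Rightarrow> bool" where
  "valid_flags fl \<longleftrightarrow> length fl = m \<and> (\<forall>x\<in>set fl. x \<le> 2) \<and>
     (\<forall>i<m. (fl ! i \<noteq> 0 \<longleftrightarrow> ed i \<in> N) \<and> (fl ! i = 2 \<longrightarrow> bypass N (ed i)))"

definition witness :: "nat list \<Rightarrow> bool" where
  "witness ys \<longleftrightarrow> (if \<exists>F. solution I F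
     then \<exists>F. solution I F \<and> ys = 1 # map (\<lambda>(u, v). if {u, v} \<in> F then 1 else 0) es
     else ys = [0])"

text \<open>An index set is good iff its edges form a removable set: an edge with flag 2 bypasses
  all of \<open>N\<close>, hence every subset of \<open>N\<close>, without a check. The bound on the
  number of subsets comes from \<open>many_removable\<close>, applied to the first
  candidates.\<close>

lemma computes_witness:
  assumes "(M + 2) ^ 12 \<le> W" "size \<le> M" "length xs + m + 1 \<le> M"
    and fl: "valid_flags fl" "computes W cf xs tf (\<lambda>ys. ys = fl)"
    and check: "\<And>A e. A \<subseteq> {..<m} \<Longrightarrow> ed ` A \<subseteq> N \<Longrightarrow> e \<in> A \<Longrightarrow> fl ! e = 1 \<Longrightarrow>
       computes W cc (xs @ indicator_list m A @ [e]) tc (\<lambda>ys. ys = [if bypass (ed ` A) (ed e) then 1 else 0])"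
    and CC: "\<And>e. e < m \<Longrightarrow> fl ! e = 1 \<Longrightarrow> tc + 4 * m + 15 \<le> CC"
  shows "computes W (search_com cf cc) xs
    (tf + 32 * m + 65 + (if \<rho> \<le> m then (\<rho> * (2 * tightness I + 1) choose \<rho>) * ((16 + CC) * \<rho> + 14) else 0)) witness"
proof -
  interpret S: subset_search M W xs fl m \<rho> "\<lambda>A e. bypass (ed ` A) (ed e)" cc tc CC
  proof (standard, goal_cases)
    case (6)
    then show ?case using in_xs_less assms(2) by fastforce
  next
    case (10 A e)
    then show ?case using fl(1) by (intro check) (auto simp: valid_flags_def)
  next
    case (11 e)
    then show ?case using CC[of e] by simp
  next
    case 8
    then show ?case using fl(1) assms(2) size_bounds(1) unfolding valid_flags_def by fastforce
  qed (use assms size_bounds(1) in \<open>auto simp: valid_flags_def\<close>)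
  have cands: "set S.cands = {i. i < m \<and> ed i \<in> N}"
    using fl(1) unfolding S.set_cands valid_flags_def by auto
  have removable: "removable (ed ` A) \<longleftrightarrow> card A = \<rho> \<and> S.good A" if "A \<subseteq> set S.cands" for A
  proof -
    have A: "A \<subseteq> {..<m}" "ed ` A \<subseteq> N" using that cands by auto
    have "bypass (ed ` A) (ed e)" if "e \<in> A" "fl ! e \<noteq> 1" for e
    proof -
      have e: "e < m" "ed e \<in> N" using that A by auto
      then have "fl ! e \<le> 2" "fl ! e \<noteq> 0" using fl(1) by (auto simp: valid_flags_def)
      then have "fl ! e = 2" using that(2) by simp
      then have "bypass N (ed e)" using fl(1) e by (auto simp: valid_flags_def)
      then show ?thesis using bypass_anti A(2) by blast
    qed
    then show ?thesis
      using A card_image[OF inj_on_subset[OF inj_ed A(1)]] unfolding removable_def S.good_def by auto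
  qed
  have solvable: "S.solvable \<longleftrightarrow> (\<exists>F. solution I F)"
    unfolding solution_iff
  proof
    assume S.solvable
    then show "\<exists>R. removable R" using removable unfolding S.solvable_def by blast
  next
    assume "\<exists>R. removable R"
    then obtain R where R: "removable R" by blast
    define A where "A = {i. i < m \<and> ed i \<in> R}"
    have "R \<subseteq> E" using R N_subset by (auto simp: removable_def)
    have "R = ed ` A"
    proof
      show "R \<subseteq> ed ` A"
      proof
        fix e assume e: "e \<in> R"
        then obtain i where "i < m" "e = ed i" using \<open>R \<subseteq> E\<close> image_ed by blast
        then show "e \<in> ed ` A" using e by (auto simp: A_def)
      qed
    qed (auto simp: A_def)
    moreover have "A \<subseteq> set S.cands" using R cands by (auto simp: A_def removable_def)
    ultimately show S.solvable using R removable[of A] unfolding S.solvable_def by auto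
  qed
  let ?k0 = "\<rho> * (2 * tightness I + 1)"
  have k0: "\<exists>A. A \<subseteq> set (take ?k0 S.cands) \<and> card A = \<rho> \<and> S.good A" if k: "?k0 \<le> S.k"
  proof -
    let ?S = "set (take ?k0 S.cands)"
    have sub: "?S \<subseteq> set S.cands" by (rule set_take_subset)
    then have S: "?S \<subseteq> {..<m}" "ed ` ?S \<subseteq> N" using cands by auto
    have "card ?S = ?k0" using k S.distinct_cands by (simp add: distinct_card)
    then have "?k0 \<le> card (ed ` ?S)" using card_image[OF inj_on_subset[OF inj_ed S(1)]] by simp
    then obtain R where R: "R \<subseteq> ed ` ?S" "removable R" using many_removable[OF S(2)] by blast
    then obtain A where A: "A \<subseteq> ?S" "R = ed ` A" by (metis subset_imageE)
    then show ?thesis using removable[of A] R(2) sub by blast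
  qed
  show ?thesis
  proof (rule computes_mono[OF S.computes_search[OF fl(2) k0]])
    fix ys assume o: "S.outcome ys"
    show "witness ys"
    proof (cases S.solvable)
      case True
      then obtain A where A: "A \<subseteq> set S.cands" "card A = \<rho>" "S.good A"
        "ys = 1 # map (\<lambda>i. if i \<in> A then 0 else 1) [0..<m]"
        using o unfolding S.outcome_def by auto
      have Am: "A \<subseteq> {..<m}" using A(1) cands by auto
      have "map (\<lambda>i. if i \<in> A then 0 else 1) [0..<m] = map (\<lambda>(u, v). if {u, v} \<in> E - ed ` A then 1 else 0::nat) es"
      proof (rule nth_equalityI)
        fix i assume "i < length (map (\<lambda>i. if i \<in> A then 0 else 1::nat) [0..<m])"
        then have i: "i < m" by simp
        then have "ed i \<in> ed ` A \<longleftrightarrow> i \<in> A" using Am inj_on_image_mem_iff[OF inj_ed, of i A] by simp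
        then show "map (\<lambda>i. if i \<in> A then 0 else 1) [0..<m] ! i =
          map (\<lambda>(u, v). if {u, v} \<in> E - ed ` A then 1 else 0::nat) es ! i"
          using i ed_in[OF i] by (auto simp: case_prod_beta ed_def)
      qed simp
      then show ?thesis
        using True solvable A removable[OF A(1)] removable_solution[of "ed ` A"] unfolding witness_def by auto
    next
      case False
      then show ?thesis using o solvable unfolding witness_def S.outcome_def by auto
    qed
  next
    have "S.k \<le> m" by (rule S.k_le)
    then show "tf + 5 * length xs + 17 * m + 40 + (if \<rho> \<le> S.k then (?k0 choose \<rho>) * ((16 + CC) * \<rho> + 14) else 0)
      \<le> tf + 32 * m + 65 + (if \<rho> \<le> m then (?k0 choose \<rho>) * ((16 + CC) * \<rho> + 14) else 0)"
      by auto
  qed auto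
qed

end

section \<open>General lengths\<close>

text \<open>The lengths of input and output are kept as a lower bound for the time of the oracle;
  the linear overhead of the caller is charged to it later.\<close>

lemma runs_within_computes:
  assumes "runs_within c D xs (real t) Q" "word_bound D xs \<le> W"
  shows "computes W c xs t (\<lambda>ys. Q ys \<and> length xs + length ys \<le> t)"
proof -
  obtain k s where *: "exec (word_bound D xs) c (init xs) k s"
    "real (length xs + k + length (result s)) \<le> real t" "Q (result s)"
    using assms(1) unfolding runs_within_def by blast
  then have "length xs + k + length (result s) \<le> t" by linarith
  then show ?thesis
    unfolding computes_def using exec_mono[OF *(1) assms(2)] *(3)
    by (intro exI[of _ k] exI[of _ s]) auto
qed

context coded
begin

lemma simple_path_length_le:
  assumes "simple_path E u v \<pi>" "u < n"
  shows "length \<pi> \<le> n"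
proof -
  have "x < n" if "x \<in> set \<pi>" "set (path_edges \<pi>) \<subseteq> E" "hd \<pi> < n" for x and \<pi> :: "nat list"
    using that
  proof (induction \<pi> rule: induct_list012)
    case (3 y z zs)
    then show ?case using edge_nodes[of y z] by auto
  qed auto
  then have "set \<pi> \<subseteq> {..<n}" using assms unfolding simple_path_def by blast
  then show ?thesis
    using assms(1) card_mono[of "{..<n}" "set \<pi>"] by (simp add: simple_path_def distinct_card)
qed

lemma path_length_le:
  assumes "simple_path E u v \<pi>" "u < n" "\<And>e. e \<in> E \<Longrightarrow> l' e \<le> B"
  shows "path_length l' \<pi> \<le> n * B"
proof -
  have "path_length l' \<pi> \<le> (\<Sum>e\<leftarrow>path_edges \<pi>. B)"
    unfolding path_length_def using assms(1,3) by (intro sum_list_mono) (auto simp: simple_path_def)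
  also have "\<dots> \<le> n * B"
    using simple_path_length_le[OF assms(1,2)] diff_le_self[of "length \<pi>" 1]
    by (auto simp: sum_list_triv length_path_edges)
  finally show ?thesis .
qed

lemma path_exists:
  assumes "u < n" "v < n"
  obtains \<pi> where "simple_path E u v \<pi>"
  using connected assms unfolding connected_graph_def by blast

lemma nat_dist_bound:
  assumes "u < n" "v < n" "\<And>e. e \<in> E \<Longrightarrow> l' e \<le> B"
  shows "nat_dist E l' u v \<le> n * B"
proof -
  obtain \<pi> where \<pi>: "simple_path E u v \<pi>" using path_exists[OF assms(1,2)] .
  then have "nat_dist E l' u v \<le> path_length l' \<pi>" by (rule nat_dist_le)
  then show ?thesis using path_length_le[OF \<pi> assms(1), of l' B] assms(3) by simp
qed

lemma edge_list_elems:
  assumes "\<And>e. e \<in> E \<Longrightarrow> l' e \<le> B" "x \<in> set (edge_code l' es)"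
  shows "x \<le> size + B"
proof -
  obtain u v where uv: "(u, v) \<in> set es" "x = u \<or> x = v \<or> x = l' {u, v}"
    using assms(2) by (auto simp: set_edge_code)
  then have "{u, v} \<in> E" using es by (auto simp: lists_edges_def)
  then show ?thesis using uv(2) assms(1)[of "{u, v}"] edge_nodes[of u v] size_bounds(3) by auto
qed

lemma size_ge: "7 \<le> size"
  using size_bounds(1) by simp

text \<open>The oracles are called with lengths up to \<open>size ^ 3\<close>. Their word bound with
  exponent \<open>D\<close> is then covered by that of the original instance with exponent
  \<open>4 * D\<close>.\<close>

lemma word_bound_le:
  assumes "\<And>e. e \<in> E \<Longrightarrow> l' e \<le> B" "B \<le> size ^ 3" "length hs \<le> 4" "\<forall>x\<in>set hs. x \<le> size"
  shows "word_bound D (hs @ edge_code l' es) \<le> size ^ (4 * D)"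
proof -
  have "Max (insert 0 (set (hs @ edge_code l' es))) \<le> size + B"
    using assms(4) edge_list_elems[of l' B] assms(1) by (auto intro: le_trans)
  moreover have "length (hs @ edge_code l' es) \<le> size" using assms(3) size_bounds(2) by simp
  ultimately have "2 + length (hs @ edge_code l' es) + Max (insert 0 (set (hs @ edge_code l' es))) \<le> 2 + 2 * size + size ^ 3"
    using assms(2) by linarith
  also have "\<dots> \<le> size ^ 4"
  proof -
    have "2 + 2 * size \<le> 6 * size" using size_ge by simp
    also have "\<dots> \<le> 6 * size ^ 3" using size_ge by (simp add: self_le_power)
    finally have "2 + 2 * size + size ^ 3 \<le> 7 * size ^ 3" by simp
    also have "\<dots> \<le> size * size ^ 3" using size_ge by (intro mult_le_mono1)
    finally show ?thesis by (simp add: eval_nat_numeral)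
  qed
  finally have "word_bound D (hs @ edge_code l' es) \<le> (size ^ 4) ^ D"
    unfolding word_bound_def by (intro power_mono) auto
  then show ?thesis by (simp add: power_mult)
qed

text \<open>Large enough for distances with lengths up to \<open>size ^ 3\<close>, since a simple
  path has fewer than \<open>n\<close> edges and \<open>n\<close> is below
  \<open>size\<close>.\<close>

definition wmax :: nat where "wmax = size ^ 4"

lemma wmax_ge: "a \<le> size ^ 2 \<Longrightarrow> a * size ^ 2 \<le> wmax" "size \<le> wmax" "size * size \<le> wmax" "size ^ 3 \<le> wmax"
  "n * size ^ 3 \<le> wmax" "length xs + m + 1 \<le> wmax" "2 * n * n \<le> wmax"
proof -
  have s2: "size * size \<le> wmax" unfolding wmax_def using power_increasing[of 2 4 size] size_ge
    by (simp add: power2_eq_square)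
  show "a * size ^ 2 \<le> wmax" if "a \<le> size ^ 2"
    using mult_le_mono1[OF that, of "size ^ 2"] by (simp add: wmax_def flip: power_add)
  show "size \<le> wmax" unfolding wmax_def using size_ge by (simp add: self_le_power)
  show "size * size \<le> wmax" by (rule s2)
  show "size ^ 3 \<le> wmax" unfolding wmax_def using size_ge by (intro power_increasing) auto
  have "n * size ^ 3 \<le> size * size ^ 3" using size_bounds(3) by (intro mult_le_mono1) simp
  then show "n * size ^ 3 \<le> wmax" unfolding wmax_def by (simp add: eval_nat_numeral)
  have "length xs + m + 1 \<le> 2 * size" using size_bounds(1,2) by simp
  also have "\<dots> \<le> size * size" using size_ge by (intro mult_le_mono1) simp
  finally show "length xs + m + 1 \<le> wmax" using s2 by simp
  have "2 * n * n \<le> size * size * size" using size_bounds(3) size_ge by (intro mult_le_mono) auto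
  also have "\<dots> = size ^ 3" by (simp add: eval_nat_numeral)
  finally show "2 * n * n \<le> wmax" using \<open>size ^ 3 \<le> wmax\<close> by simp
qed

end

subsection \<open>Checking a removed edge\<close>

text \<open>The first call finds the distance \<open>a\<close> of the endpoints in the full graph.
  It determines both the budget \<open>num * a\<close> and the prohibitive length
  \<open>num * a + 1\<close> that removed edges get for the second call.\<close>

definition spsp_check_com :: "com \<Rightarrow> com" where
  "spsp_check_com cs = (
     2 ::= Read 0 (Const 1) ;;
     3 ::= Const 5 [+] Const 3 [*] Read 0 (Len 0 [-] Const 1) ;;
     4 ::= Read 0 (Const 3) ;; 5 ::= Read 0 (Const 4) ;;
     New 2 (Const 4 [+] Const 3 [*] Reg 2) ;;
     Write 2 (Const 0) (Read 0 (Const 0)) ;; Write 2 (Const 1) (Reg 2) ;;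
     Write 2 (Const 2) (Read 0 (Reg 3)) ;; Write 2 (Const 3) (Read 0 (Reg 3 [+] Const 1)) ;;
     For 6 (Const 4) (Len 2) (Write 2 (Reg 6) (Read 0 (Reg 6 [+] Const 1))) ;;
     Call 3 cs 2 ;;
     7 ::= Reg 4 [*] Read 3 (Const 0) [+] Const 1 ;;
     For 6 (Const 0) (Reg 2)
       (If (Read 0 (Const 5 [+] Const 3 [*] Reg 2 [+] Reg 6))
         (Write 2 (Const 6 [+] Const 3 [*] Reg 6) (Reg 7)) skip_com) ;;
     Call 4 cs 2 ;;
     8 ::= Reg 4 [*] Read 3 (Const 0) [<] Reg 5 [*] Read 4 (Const 0) ;;
     New 0 (Const 1) ;; Write 0 (Const 0) (Const 1 [-] Reg 8))"

text \<open>Only the lengths vary between calls while the graph is fixed, so a single number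
  \<open>T\<close> bounds all of them.\<close>

locale spsp_oracle = coded +
  fixes cs :: com and D T W :: nat
  assumes spsp: "\<And>l' s t. \<forall>e\<in>E. 1 \<le> l' e \<Longrightarrow> s < n \<Longrightarrow> t < n \<Longrightarrow>
      runs_within cs D ([n, m, s, t] @ edge_code l' es) (real T)
        (\<lambda>ys. \<exists>k. ys = [k] \<and> ereal (real k) = path_dist E l' s t)"
    and W: "(wmax + 2) ^ 12 \<le> W" "size ^ (4 * D) \<le> W"
begin

sublocale machine wmax W
  by standard (rule W(1))

lemma spsp_computes:
  assumes "\<And>e. e \<in> E \<Longrightarrow> 1 \<le> l' e" "\<And>e. e \<in> E \<Longrightarrow> l' e \<le> size ^ 3" "s < n" "t < n"
  shows "computes W cs ([n, m, s, t] @ edge_code l' es) T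
    (\<lambda>ys. ys = [nat_dist E l' s t] \<and> 4 + 3 * m + 1 \<le> T)"
proof -
  have "word_bound D ([n, m, s, t] @ edge_code l' es) \<le> W"
    using word_bound_le[of l' "size ^ 3" "[n, m, s, t]" D] assms size_bounds(1,3) W(2) by force
  from runs_within_computes[OF spsp this] show ?thesis
  proof (rule computes_mono)
    fix ys assume *: "(\<exists>k. ys = [k] \<and> ereal (real k) = path_dist E l' s t) \<and>
      length ([n, m, s, t] @ edge_code l' es) + length ys \<le> T"
    then obtain k where k: "ys = [k]" "ereal (real k) = path_dist E l' s t" by blast
    obtain \<pi> where "simple_path E s t \<pi>" using path_exists[OF assms(3,4)] .
    then have "k = nat_dist E l' s t" using k(2) path_dist_eq by simp
    then show "ys = [nat_dist E l' s t] \<and> 4 + 3 * m + 1 \<le> T" using * k(1) by simp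
  qed (use assms in auto)
qed

lemma spsp_check:
  assumes A: "A \<subseteq> {..<m}" and e: "e < m"
  shows "computes W (spsp_check_com cs) (xs @ indicator_list m A @ [e]) (2 * T + 30 * m + 40)
    (\<lambda>ys. ys = [if bypass (ed ` A) (ed e) then 1 else 0] \<and> 3 * m + 5 \<le> T)"
proof (rule computesI)
  define z where "z = xs @ indicator_list m A @ [e]"
  let ?u = "src e" and ?v = "tgt e"
  let ?a = "d ?u ?v"
  let ?B = "num * ?a + 1"
  \<comment> \<open>The length function in array 2 after \<open>j\<close> positions of the indicator
    have been processed.\<close>
  define lj where "lj j e = (if \<exists>i<j. i \<in> A \<and> ed i = e then ?B else l e)" for j :: nat and e
  let ?l' = "\<lambda>e. if e \<in> ed ` A then ?B else l e"
  let ?a' = "nat_dist E ?l' ?u ?v"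
  define zs where "zs l' = [n, m, ?u, ?v] @ edge_code l' es" for l'
  have length_zs [simp]: "length (zs l') = 4 + 3 * m" for l' by (simp add: zs_def)
  note uv = src_tgt[OF e]
  have uvE: "{?u, ?v} \<in> E" using ed_in[OF e] by (simp add: ed_def)
  have num: "num \<le> size" "den \<le> size" using size_bounds by auto
  have a: "?a + 2 \<le> size" using d_edge_le[OF uvE] size_bounds(7)[OF e] by (simp add: ed_def)
  have l_le: "l f + 2 \<le> size" if f: "f \<in> E" for f
  proof -
    obtain i where "i < m" "f = ed i" using f image_ed by blast
    then show ?thesis using size_bounds(7) by simp
  qed
  have B2: "?B \<le> size * size"
  proof -
    have "num * ?a \<le> size * (size - 1)" using num a by (intro mult_le_mono) auto
    moreover have "size * (size - 1) + 1 \<le> size * size" using size_ge by (cases size) auto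
    ultimately show ?thesis by linarith
  qed
  have B: "?B \<le> size ^ 3"
  proof -
    have "size * size \<le> size ^ 3" using size_ge by (simp add: eval_nat_numeral)
    then show ?thesis using B2 by simp
  qed
  have BM: "?B \<le> wmax" using B2 wmax_ge(3) by simp
  have s3: "size \<le> size ^ 3" using size_ge by (simp add: self_le_power)
  have l3: "l f \<le> size ^ 3" if "f \<in> E" for f using l_le[OF that] s3 by simp
  have l'3: "?l' f \<le> size ^ 3" if "f \<in> E" for f using B l3[OF that] by simp
  have l'1: "1 \<le> ?l' f" if "f \<in> E" for f using len_pos[OF that] by simp
  have a': "?a' \<le> wmax" using nat_dist_bound[OF uv(1,2), of ?l' "size ^ 3"] l'3 wmax_ge(5) by simp
  have aM: "?a \<le> wmax" using a wmax_ge(2) by simp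
  have len_z: "length z = 6 + 4 * m" by (simp add: z_def)
  have z_nth: "z ! 0 = n" "z ! 1 = m" "z ! Suc 0 = m" "z ! 3 = num" "z ! 4 = den"
    "z ! (5 + 4 * m) = e" "z ! (5 + 3 * e) = ?u" "z ! (6 + 3 * e) = ?v"
    using nth_xs_edge[OF e] e by (auto simp: z_def nth_append)
  have z_code: "z ! (j + 1) = zs l ! j" if "4 \<le> j" "j < 4 + 3 * m" for j
  proof -
    define i where "i = j - 4"
    have i: "j + 1 = 5 + i" "j = length [n, m, ?u, ?v] + i" "i < 3 * m" using that by (auto simp: i_def)
    have "z ! (j + 1) = xs ! (5 + i)" unfolding i(1) z_def using i(3) by (simp add: nth_append)
    also have "\<dots> = edge_code l es ! i" by (rule nth_xs_code)
    also have "\<dots> = zs l ! j" unfolding i(2) zs_def by (rule nth_append_length_plus[symmetric])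
    finally show ?thesis .
  qed
  have z_rem: "z ! (5 + 3 * m + j) = (if j \<in> A then 1 else 0)" if "j < m" for j
    using that by (simp add: z_def nth_append)
  have zs_M: "length (zs l) \<le> wmax" "\<forall>x\<in>set (zs l). x \<le> wmax"
  proof -
    show "length (zs l) \<le> wmax" using size_bounds(2) wmax_ge(2) by simp
    have "x \<le> size + size ^ 3" if "x \<in> set (zs l)" for x
      using that edge_list_elems[of l "size ^ 3" x] l3 uv size_bounds(1,3) by (auto simp: zs_def)
    moreover have "size + size ^ 3 \<le> wmax"
    proof -
      have "size + size ^ 3 \<le> 2 * size ^ 3" using s3 by simp
      also have "\<dots> \<le> size * size ^ 3" using size_ge by (intro mult_le_mono1) simp
      finally show ?thesis by (simp add: wmax_def eval_nat_numeral)
    qed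
    ultimately show "\<forall>x\<in>set (zs l). x \<le> wmax" by (meson le_trans)
  qed
  have lj_Suc: "lj (Suc j) = (if j \<in> A then (lj j)(ed j := ?B) else lj j)" for j
    by (auto simp: lj_def less_Suc_eq fun_eq_iff)
  have lj_0: "lj 0 = l" by (auto simp: lj_def fun_eq_iff)
  have lj_m: "lj m = ?l'" using A by (auto simp: lj_def fun_eq_iff)
  have code_upd: "(zs (lj j))[6 + 3 * j := ?B] = zs ((lj j)(ed j := ?B))" if "j < m" for j
    using edge_code_update[of es j "lj j" ?B] that es by (simp add: zs_def lists_edges_def ed_def)
  have idx: "5 + 3 * e + 2 \<le> wmax" "4 + 3 * m \<le> wmax" "m \<le> wmax" "n \<le> wmax" "num \<le> wmax" "den \<le> wmax"
    "5 + 3 * e \<le> wmax"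
    using e size_bounds wmax_ge(2) by auto
  have uvM: "?u \<le> wmax" "?v \<le> wmax" using uv idx by auto
  have one: "1 \<le> wmax" "6 \<le> wmax" using size_ge wmax_ge(2) by auto
  have final: "bypass (ed ` A) (ed e) \<longleftrightarrow> den * ?a' \<le> num * ?a"
    using bypass_lengthened[OF uvE, of ?B "ed ` A"] by (simp add: ed_def)
  let ?base = "\<lambda>s :: state. snd s 0 = z \<and> fst s 2 = m \<and> fst s 4 = num \<and> fst s 5 = den"
  let ?Q = "\<lambda>k s. k \<le> 2 * T + 30 * m + 40 \<and> (result s = [if bypass (ed ` A) (ed e) then 1 else 0] \<and> 3 * m + 5 \<le> T)"
  let ?J = "\<lambda>j s. ?base s \<and> snd s 3 = [?a] \<and> fst s 7 = ?B \<and> snd s 2 = zs (lj j)"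
  let ?c4 = "8 ::= Reg 4 [*] Read 3 (Const 0) [<] Reg 5 [*] Read 4 (Const 0) ;;
     New 0 (Const 1) ;; Write 0 (Const 0) (Const 1 [-] Reg 8)"
  let ?b3 = "com.If (Read 0 (Const 5 [+] Const 3 [*] Reg 2 [+] Reg 6))
         (Write 2 (Const 6 [+] Const 3 [*] Reg 6) (Reg 7)) skip_com"
  let ?c3 = "For 6 (Const 0) (Reg 2) ?b3 ;;
     Call 4 cs 2 ;; ?c4"
  let ?c2 = "Call 3 cs 2 ;; 7 ::= Reg 4 [*] Read 3 (Const 0) [+] Const 1 ;; ?c3"
  \<comment> \<open>The suffixes of the program are treated from its end backwards; \<open>t\<close>
    bounds the steps spent before.\<close>
  have c3: "wp ?c3 s (\<lambda>k. ?Q (t + k))"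
    if s: "?base s" "snd s 3 = [?a]" "fst s 7 = ?B" "snd s 2 = zs l" and t: "t \<le> T + 20 * m + 25" for s t
  proof (rule wp_Seq, rule wp_For[where a = 0 and n = m and b = 2 and I = ?J])
    fix j :: nat and s :: state
    assume *: "?J j s" "fst s 6 = j" "j < m"
    show "wp ?b3 s
        (\<lambda>k s'. k \<le> 2 \<and> fst s' 6 = j \<and> ?J (Suc j) ((fst s')(6 := Suc j), snd s'))"
    proof (rule wp_If)
      assume "val s (Read 0 (Const 5 [+] Const 3 [*] Reg 2 [+] Reg 6)) \<noteq> 0"
      then have jA: "j \<in> A" using * z_rem[OF *(3)] by (simp split: if_splits)
      have "(zs (lj j))[6 + 3 * j := Suc (num * ?a)] = zs (lj (Suc j))"
        unfolding lj_Suc using jA code_upd[OF *(3)] by simp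
      then show "wp (Write 2 (Const 6 [+] Const 3 [*] Reg 6) (Reg 7)) s
        (\<lambda>k s'. 1 + k \<le> 2 \<and> fst s' 6 = j \<and> ?J (Suc j) ((fst s')(6 := Suc j), snd s'))"
        using * BM by (intro wp_Write) auto
    next
      assume "val s (Read 0 (Const 5 [+] Const 3 [*] Reg 2 [+] Reg 6)) = 0"
      then have jA: "j \<notin> A" using * z_rem[OF *(3)] by (simp split: if_splits)
      then have "lj (Suc j) = lj j" unfolding lj_Suc by simp
      then show "wp skip_com s
        (\<lambda>k s'. 1 + k \<le> 2 \<and> fst s' 6 = j \<and> ?J (Suc j) ((fst s')(6 := Suc j), snd s'))"
        using * by (intro wp_Assign) auto
    qed (use * len_z in auto)
  next
    fix k :: nat and s :: state
    assume *: "?J m s" and k: "k \<le> (2 + 2) * (m - 0) + 2"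
    show "wp (Call 4 cs 2 ;; ?c4) s (\<lambda>k'. ?Q (t + (k + k')))"
    proof (rule wp_Seq, rule wp_Call)
      have "snd s 2 = zs ?l'" using * lj_m by simp
      then show "computes W cs (snd s 2) T (\<lambda>ys. ys = [?a'] \<and> 4 + 3 * m + 1 \<le> T)"
        using spsp_computes[of ?l', OF l'1 l'3 uv(1,2)] unfolding zs_def by simp
    next
      fix k' :: nat and ys :: "nat list"
      assume ys: "ys = [?a'] \<and> 4 + 3 * m + 1 \<le> T" and k': "k' \<le> 1 + length (snd s 2) + T + length ys"
      have "length (snd s 2) = 4 + 3 * m" using * by simp
      then have "k' \<le> T + 3 * m + 6" using k' ys by simp
      then show "wp ?c4 (fst s, (snd s)(4 := ys)) (\<lambda>k''. ?Q (t + (k + (k' + k''))))"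
        using * ys t k final one by (intro wp_Seq wp_Assign wp_New wp_Write) auto
    qed (use a' one in auto)
  qed (use s len_z idx lj_0 in auto)
  have c2: "wp ?c2 s (\<lambda>k. ?Q (t + k))"
    if s: "?base s" "snd s 2 = zs l" and t: "t \<le> 15 * m + 18" for s t
  proof (rule wp_Seq, rule wp_Call)
    show "computes W cs (snd s 2) T (\<lambda>ys. ys = [?a] \<and> 4 + 3 * m + 1 \<le> T)"
      using spsp_computes[of l, OF len_pos l3 uv(1,2)] s(2) unfolding zs_def by simp
  next
    fix k :: nat and ys :: "nat list"
    assume ys: "ys = [?a] \<and> 4 + 3 * m + 1 \<le> T" and k: "k \<le> 1 + length (snd s 2) + T + length ys"
    let ?s = "(fst s, (snd s)(3 := ys))"
    show "wp (7 ::= Reg 4 [*] Read 3 (Const 0) [+] Const 1 ;; ?c3) ?s (\<lambda>k'. ?Q (t + (k + k')))"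
    proof (rule wp_Seq, rule wp_Assign)
      have "length (snd s 2) = 4 + 3 * m" using s by simp
      then have "t + (k + 1) \<le> T + 20 * m + 25" using k t ys by simp
      show "wp ?c3 ((fst ?s)(7 := val ?s (Reg 4 [*] Read 3 (Const 0) [+] Const 1)), snd ?s) (\<lambda>k'. ?Q (t + (k + (1 + k'))))"
        using c3[of "((fst ?s)(7 := val ?s (Reg 4 [*] Read 3 (Const 0) [+] Const 1)), snd ?s)" "t + (k + 1)"]
          s ys k t by (simp add: add.assoc)
    qed (use s ys BM in auto)
  qed (use aM one in auto)
  let ?c1 = "For 6 (Const 4) (Len 2) (Write 2 (Reg 6) (Read 0 (Reg 6 [+] Const 1))) ;; ?c2"
  have c1: "wp ?c1 s (\<lambda>k. ?Q (t + k))"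
    if s: "?base s" "snd s 2 = [n, m, ?u, ?v] @ replicate (3 * m) 0" and t: "t \<le> 3 * m + 14" for s t
  proof (rule wp_Seq, rule wp_copy[where zs = "zs l"])
    fix k assume k: "k \<le> 3 * (length (zs l) - 4) + 2"
    let ?s = "((fst s)(6 := length (zs l)), (snd s)(2 := zs l))"
    have "wp ?c2 ?s (\<lambda>k'. ?Q ((t + k) + k'))"
      using s t k by (intro c2) auto
    then show "wp ?c2 ?s (\<lambda>k'. ?Q (t + (k + k')))" by (simp add: add.assoc)
  next
    show "snd s 2 = take 4 (zs l) @ replicate (length (zs l) - 4) 0" using s by (simp add: zs_def)
    show "j + 1 < length (snd s 0) \<and> snd s 0 ! (j + 1) = zs l ! j" if "4 \<le> j" "j < length (zs l)" for j
      using that s(1) z_code[of j] len_z by simp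
  qed (use zs_M in auto)
  have pos: "5 + 3 * e < length z" "Suc (5 + 3 * e) < length z" "length z - 1 = 5 + 4 * m"
    using e len_z by auto
  have "wp (spsp_check_com cs) (init z) ?Q"
    unfolding spsp_check_com_def init_def
    apply (rule wp_Seq, rule wp_Assign_to[where x = m])
    apply (rule wp_Seq, rule wp_Assign_to[where x = "5 + 3 * e"])
    apply (rule wp_Seq, rule wp_Assign_to[where x = num])
    apply (rule wp_Seq, rule wp_Assign_to[where x = den])
    apply (rule wp_Seq, rule wp_New_to[where k = "4 + 3 * m"])
    apply (rule wp_Seq, rule wp_Write_to[where i = 0 and x = n and ys = "n # replicate (3 + 3 * m) 0"])
    apply (rule wp_Seq, rule wp_Write_to[where i = 1 and x = m and ys = "n # m # replicate (2 + 3 * m) 0"])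
    apply (rule wp_Seq, rule wp_Write_to[where i = 2 and x = ?u and ys = "n # m # ?u # replicate (1 + 3 * m) 0"])
    apply (rule wp_Seq, rule wp_Write_to[where i = 3 and x = ?v and ys = "n # m # ?u # ?v # replicate (3 * m) 0"])
    apply (rule wp_conseq[OF c1[where t = "3 * m + 13"]])
    using len_z z_nth pos idx uvM one by (simp_all add: numeral_eq_Suc)
  then show "wp (spsp_check_com cs) (init (xs @ indicator_list m A @ [e])) ?Q" unfolding z_def .
  have "length z \<le> wmax" using len_z wmax_ge(6) by simp
  moreover have "x \<le> wmax" if "x \<in> set z" for x
  proof -
    have "x \<in> set xs \<or> x \<le> 1 \<or> x = e" using that by (auto simp: z_def indicator_list_def)
    then show ?thesis using in_xs_less[of x] wmax_ge(2) one e idx by auto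
  qed
  ultimately show "length (xs @ indicator_list m A @ [e]) \<le> wmax" "\<forall>x\<in>set (xs @ indicator_list m A @ [e]). x \<le> wmax"
    unfolding z_def by auto
qed

end

subsection \<open>Classifying the edges\<close>

text \<open>In the second call one length must be prohibitive for all edges at once. Register 7
  therefore sums up \<open>num\<close> times the length of every edge, starting from 1; an edge is
  at least as long as the distance of its ends, so the sum exceeds each single budget.\<close>

definition apsp_flags_com :: "com \<Rightarrow> com" where
  "apsp_flags_com ca = (
     2 ::= Read 0 (Const 1) ;; 3 ::= Read 0 (Const 0) ;; 4 ::= Read 0 (Const 3) ;; 5 ::= Read 0 (Const 4) ;;
     New 2 (Const 2 [+] Const 3 [*] Reg 2) ;; Write 2 (Const 0) (Reg 3) ;; Write 2 (Const 1) (Reg 2) ;;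
     For 6 (Const 2) (Len 2) (Write 2 (Reg 6) (Read 0 (Reg 6 [+] Const 3))) ;;
     Call 3 ca 2 ;;
     New 4 (Reg 2) ;; 7 ::= Const 1 ;;
     For 6 (Const 0) (Reg 2) (
       8 ::= Const 2 [*] (Read 0 (Const 5 [+] Const 3 [*] Reg 6) [*] Reg 3 [+] Read 0 (Const 6 [+] Const 3 [*] Reg 6)) ;;
       7 ::= Reg 7 [+] Reg 4 [*] Read 0 (Const 7 [+] Const 3 [*] Reg 6) ;;
       If (Read 3 (Reg 8 [+] Const 1))
         (If (Reg 4 [*] Read 3 (Reg 8) [<] Reg 5 [*] Read 3 (Reg 8 [+] Const 1)) skip_com
           (Write 4 (Reg 6) (Const 1)))
         skip_com) ;;
     For 6 (Const 0) (Reg 2)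
       (If (Read 4 (Reg 6)) (Write 2 (Const 4 [+] Const 3 [*] Reg 6) (Reg 7)) skip_com) ;;
     Call 5 ca 2 ;;
     For 6 (Const 0) (Reg 2)
       (If (Read 4 (Reg 6))
         (8 ::= Const 2 [*] (Read 0 (Const 5 [+] Const 3 [*] Reg 6) [*] Reg 3 [+] Read 0 (Const 6 [+] Const 3 [*] Reg 6)) ;;
          If (Reg 4 [*] Read 3 (Reg 8) [<] Reg 5 [*] Read 5 (Reg 8)) skip_com (Write 4 (Reg 6) (Const 2)))
         skip_com) ;;
     Call 0 skip_com 4)"

locale apsp_oracle = coded +
  fixes ca :: com and D T W :: nat
  assumes apsp: "\<And>l'. \<forall>e\<in>E. 1 \<le> l' e \<Longrightarrow>
      runs_within ca D ([n, m] @ edge_code l' es) (real T)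
        (\<lambda>ys. length ys = 2 * n * n \<and> (\<forall>u<n. \<forall>v<n. two_shortest E l' u v
           (ys ! (2 * (u * n + v))) (ys ! (2 * (u * n + v) + 1))))"
    and W: "(wmax + 2) ^ 12 \<le> W" "size ^ (4 * D) \<le> W"
begin

sublocale machine wmax W
  by standard (rule W(1))

definition two_shortest_table :: "(nat set \<Rightarrow> nat) \<Rightarrow> nat list \<Rightarrow> bool" where
  "two_shortest_table l' ys \<longleftrightarrow> length ys = 2 * n * n \<and> (\<forall>u<n. \<forall>v<n. two_shortest E l' u v
     (ys ! (2 * (u * n + v))) (ys ! (2 * (u * n + v) + 1))) \<and> (\<forall>y\<in>set ys. y \<le> wmax)"

text \<open>Every entry of the table is 0 or the length of a simple path, so the table may be stored
  by the caller.\<close>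

lemma apsp_computes:
  assumes "\<And>e. e \<in> E \<Longrightarrow> 1 \<le> l' e" "\<And>e. e \<in> E \<Longrightarrow> l' e \<le> size ^ 3"
  shows "computes W ca ([n, m] @ edge_code l' es) T
    (\<lambda>ys. two_shortest_table l' ys \<and> 2 * n * n + 3 * m + 2 \<le> T)"
proof -
  have "word_bound D ([n, m] @ edge_code l' es) \<le> W"
    using word_bound_le[of l' "size ^ 3" "[n, m]" D] assms size_bounds(1,3) W(2) by force
  from runs_within_computes[OF apsp this] show ?thesis
  proof (rule computes_mono)
    fix ys assume *: "(length ys = 2 * n * n \<and> (\<forall>u<n. \<forall>v<n. two_shortest E l' u v
           (ys ! (2 * (u * n + v))) (ys ! (2 * (u * n + v) + 1)))) \<and> length ([n, m] @ edge_code l' es) + length ys \<le> T"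
    have "ys ! k \<le> wmax" if k: "k < 2 * n * n" for k
    proof -
      define u where "u = k div 2 div n"
      define v where "v = k div 2 mod n"
      have "0 < n" using k by (cases "n = 0") auto
      then have "v < n" by (simp add: v_def)
      moreover have "k div 2 < n * n" using k by simp
      then have "u < n" unfolding u_def by (simp add: less_mult_imp_div_less)
      ultimately have ts: "two_shortest E l' u v (ys ! (2 * (u * n + v))) (ys ! (2 * (u * n + v) + 1))"
        using * by blast
      have path: "path_length l' \<pi> \<le> wmax" if "simple_path E u v \<pi>" for \<pi>
        using path_length_le[OF that \<open>u < n\<close>, of l' "size ^ 3"] assms(2) wmax_ge(5) by simp
      have "a \<le> wmax \<and> b \<le> wmax" if "two_shortest E l' u v a b" for a b
      proof -
        have "\<exists>\<pi>. simple_path E u v \<pi> \<and> path_length l' \<pi> = a"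
          using that unfolding two_shortest_def by blast
        moreover have "b = 0 \<or> (\<exists>\<pi>. simple_path E u v \<pi> \<and> path_length l' \<pi> = b)"
          using that unfolding two_shortest_def by blast
        ultimately show ?thesis using path by (metis zero_le)
      qed
      then have "ys ! (2 * (u * n + v)) \<le> wmax" "ys ! (2 * (u * n + v) + 1) \<le> wmax"
        using ts by blast+
      moreover have "u * n + v = k div 2" by (simp add: u_def v_def)
      moreover have "k = 2 * (k div 2) \<or> k = 2 * (k div 2) + 1" by presburger
      ultimately show ?thesis by metis
    qed
    then have "\<forall>y\<in>set ys. y \<le> wmax" using * by (metis in_set_conv_nth)
    then show "two_shortest_table l' ys \<and> 2 * n * n + 3 * m + 2 \<le> T"
      using * by (simp add: two_shortest_table_def)
  qed (use assms in auto)
qed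

definition flag :: "nat \<Rightarrow> nat" where
  "flag i = (if ed i \<notin> N then 0 else if bypass N (ed i) then 2 else 1)"

lemma valid_flags: "valid_flags (map flag [0..<m])"
  by (auto simp: valid_flags_def flag_def)

lemma flag_1_critical: "i < m \<Longrightarrow> map flag [0..<m] ! i = 1 \<Longrightarrow> ed i \<in> critical_pairs I"
  using ed_in by (auto simp: flag_def critical_iff split: if_splits)

lemma apsp_flags:
  "computes W (apsp_flags_com ca) xs (4 * T + 50 * m + 50)
    (\<lambda>ys. ys = map flag [0..<m] \<and> 2 * n * n + 3 * m + 2 \<le> T)"
proof (rule computesI)
  \<comment> \<open>The value of register 7 after \<open>j\<close> edges.\<close>
  let ?Bj = "\<lambda>j. 1 + (\<Sum>i<j. num * l (ed i))"
  define B where "B = ?Bj m"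
  let ?l' = "\<lambda>e. if e \<in> N then B else l e"
  define zs where "zs l' = [n, m] @ edge_code l' es" for l'
  define lj where "lj j e = (if \<exists>i<j. ed i \<in> N \<and> ed i = e then B else l e)" for j :: nat and e
  let ?f = "\<lambda>i. if ed i \<in> N then 1 else 0 :: nat"
  let ?pos = "\<lambda>i. 2 * (src i * n + tgt i)"
  have length_zs [simp]: "length (zs l') = 2 + 3 * m" for l' by (simp add: zs_def)
  have l_le: "l f + 2 \<le> size" if f: "f \<in> E" for f
  proof -
    obtain i where "i < m" "f = ed i" using f image_ed by blast
    then show ?thesis using size_bounds(7) by simp
  qed
  have Bj_le: "?Bj j \<le> size ^ 3" if "j \<le> m" for j
  proof -
    have "l (ed i) \<le> size" if "i < j" for i using size_bounds(7)[of i] that \<open>j \<le> m\<close> by simp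
    then have "(\<Sum>i<j. num * l (ed i)) \<le> (\<Sum>i<j. size * size)"
      using size_bounds(5) by (intro sum_mono mult_le_mono) auto
    also have "\<dots> = j * (size * size)" by simp
    also have "\<dots> \<le> (size - 1) * (size * size)"
      using that size_bounds(1) by (intro mult_le_mono1) simp
    moreover have "1 \<le> size * size" using size_ge by simp
    ultimately have "?Bj j \<le> size * size + (size - 1) * (size * size)" by linarith
    also have "\<dots> = size ^ 3" using size_ge by (cases size) (auto simp: eval_nat_numeral)
    finally show ?thesis .
  qed
  have BM: "?Bj j \<le> wmax" if "j \<le> m" for j using Bj_le[OF that] wmax_ge(4) by simp
  have B_M: "B \<le> wmax" using BM[of m] by (simp add: B_def)
  have s3: "size \<le> size ^ 3" using size_ge by (simp add: self_le_power)
  have l3: "l f \<le> size ^ 3" if "f \<in> E" for f using l_le[OF that] s3 by simp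
  have l'3: "?l' f \<le> size ^ 3" if "f \<in> E" for f using Bj_le[of m] l3[OF that] by (simp add: B_def)
  have l'1: "1 \<le> ?l' f" if "f \<in> E" for f using len_pos[OF that] by (simp add: B_def)
  have B_gt: "num * d (src i) (tgt i) < B" if i: "i < m" for i
  proof -
    have "num * d (src i) (tgt i) \<le> num * l (ed i)"
      using d_edge_le[of "src i" "tgt i"] ed_in[OF i] by (simp add: ed_def)
    also have "\<dots> \<le> (\<Sum>i<m. num * l (ed i))" using i by (intro member_le_sum) auto
    finally show ?thesis by (simp add: B_def)
  qed
  have lj_Suc: "lj (Suc j) = (if ed j \<in> N then (lj j)(ed j := B) else lj j)" for j
    by (auto simp: lj_def less_Suc_eq fun_eq_iff)
  have lj_0: "lj 0 = l" by (auto simp: lj_def fun_eq_iff)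
  have lj_m: "lj m = ?l'"
  proof
    fix e
    have "\<exists>i<m. ed i = e" if "e \<in> N"
    proof -
      have "e \<in> ed ` {..<m}" unfolding image_ed using that N_subset by (rule rev_subsetD)
      then show ?thesis by auto
    qed
    then have "(\<exists>i<m. ed i \<in> N \<and> ed i = e) \<longleftrightarrow> e \<in> N" by auto
    then show "lj m e = ?l' e" by (simp add: lj_def)
  qed
  have code_upd: "(zs (lj j))[4 + 3 * j := B] = zs ((lj j)(ed j := B))" if "j < m" for j
    using edge_code_update[of es j "lj j" B] that es by (simp add: zs_def lists_edges_def ed_def)
  have zs_code: "xs ! (j + 3) = zs l ! j" if "2 \<le> j" "j < 2 + 3 * m" for j
  proof -
    define i where "i = j - 2"
    have i: "j + 3 = 5 + i" "j = length [n, m] + i" using that by (auto simp: i_def)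
    have "xs ! (j + 3) = edge_code l es ! i" unfolding i(1) by (rule nth_xs_code)
    also have "\<dots> = zs l ! j" unfolding i(2) zs_def by (rule nth_append_length_plus[symmetric])
    finally show ?thesis .
  qed
  have zs_M: "length (zs l) \<le> wmax" "\<forall>x\<in>set (zs l). x \<le> wmax"
  proof -
    show "length (zs l) \<le> wmax" using size_bounds(2) wmax_ge(2) by simp
    have "x \<le> size + size ^ 3" if "x \<in> set (zs l)" for x
      using that edge_list_elems[of l "size ^ 3" x] l3 size_bounds(1,3) by (auto simp: zs_def)
    moreover have "size + size ^ 3 \<le> wmax"
    proof -
      have "size + size ^ 3 \<le> 2 * size ^ 3" using s3 by simp
      also have "\<dots> \<le> size * size ^ 3" using size_ge by (intro mult_le_mono1) simp
      finally show ?thesis by (simp add: wmax_def eval_nat_numeral)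
    qed
    ultimately show "\<forall>x\<in>set (zs l). x \<le> wmax" by (meson le_trans)
  qed
  have pos: "Suc (?pos i) < 2 * n * n" "?pos i \<le> wmax" if i: "i < m" for i
  proof -
    have "src i * n + n \<le> n * n"
      using src_tgt(1)[OF i] by (metis Suc_leI add.commute mult_Suc mult_le_mono1)
    then have "src i * n + tgt i < n * n" using src_tgt(2)[OF i] by linarith
    moreover have "x < y \<Longrightarrow> Suc (2 * x) < 2 * y" for x y :: nat by presburger
    ultimately have "Suc (?pos i) < 2 * (n * n)" by blast
    then show "Suc (?pos i) < 2 * n * n" by (simp only: mult.assoc)
    then show "?pos i \<le> wmax" using wmax_ge(7) by linarith
  qed
  have idx: "2 + 3 * m \<le> wmax" "m \<le> wmax" "n \<le> wmax" "num \<le> wmax" "den \<le> wmax" "2 \<le> wmax"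
    using size_bounds wmax_ge(2) size_ge by auto
  have table: "ys ! ?pos i = nat_dist E l' (src i) (tgt i)" if "two_shortest_table l' ys" "i < m" for l' ys i
    using that two_shortest_unique src_tgt unfolding two_shortest_table_def by metis
  have table_N: "ed i \<in> N \<longleftrightarrow> ys ! Suc (?pos i) \<noteq> 0 \<and> den * ys ! Suc (?pos i) \<le> num * ys ! ?pos i"
    if "two_shortest_table l ys" "i < m" for ys i
    using nontrivial_two_shortest[of "src i" "tgt i" "ys ! ?pos i" "ys ! Suc (?pos i)"] that ed_in src_tgt
    unfolding two_shortest_table_def ed_def by simp
  have table_byp: "bypass N (ed i) \<longleftrightarrow> den * ys' ! ?pos i \<le> num * ys ! ?pos i"
    if "two_shortest_table l ys" "two_shortest_table ?l' ys'" "i < m" for ys ys' i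
    using bypass_lengthened[of "src i" "tgt i" B N] ed_in[OF that(3)] B_gt[OF that(3)]
      table[OF that(1,3)] table[OF that(2,3)] by (simp add: ed_def)
  have table_len: "length ys = 2 * n * n" "\<forall>y\<in>set ys. y \<le> wmax" if "two_shortest_table l' ys" for l' ys
    using that by (auto simp: two_shortest_table_def)
  let ?base = "\<lambda>s :: state. snd s 0 = xs \<and> fst s 2 = m \<and> fst s 3 = n \<and> fst s 4 = num \<and> fst s 5 = den"
  let ?Q = "\<lambda>k s. k \<le> 4 * T + 50 * m + 50 \<and> (result s = map flag [0..<m] \<and> 2 * n * n + 3 * m + 2 \<le> T)"
  let ?p8 = "8 ::= Const 2 [*] (Read 0 (Const 5 [+] Const 3 [*] Reg 6) [*] Reg 3 [+] Read 0 (Const 6 [+] Const 3 [*] Reg 6))"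
  let ?J4 = "\<lambda>ys ys' j s. ?base s \<and> snd s 3 = ys \<and> snd s 5 = ys' \<and> snd s 4 = blend m j flag ?f"
  let ?J3 = "\<lambda>ys j s. ?base s \<and> snd s 3 = ys \<and> snd s 4 = map ?f [0..<m] \<and> fst s 7 = B \<and> snd s 2 = zs (lj j)"
  let ?J2 = "\<lambda>ys j s. ?base s \<and> snd s 3 = ys \<and> snd s 2 = zs l \<and> fst s 7 = ?Bj j \<and> snd s 4 = blend m j ?f (\<lambda>_. 0)"
  let ?b3 = "com.If (Read 4 (Reg 6))
         (?p8 ;; com.If (Reg 4 [*] Read 3 (Reg 8) [<] Reg 5 [*] Read 5 (Reg 8)) skip_com (Write 4 (Reg 6) (Const 2)))
         skip_com"
  let ?c4 = "For 6 (Const 0) (Reg 2) ?b3 ;; Call 0 skip_com 4"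
  have c4: "wp ?c4 s (\<lambda>k. ?Q (t + k))"
    if s: "?base s" "snd s 3 = ys" "snd s 5 = ys'" "snd s 4 = map ?f [0..<m]"
      and ys: "two_shortest_table l ys" "two_shortest_table ?l' ys'"
      and t: "t \<le> 2 * T + 4 * n * n + 35 * m + 40" and T: "2 * n * n + 3 * m + 2 \<le> T" for s t ys ys'
  proof (rule wp_Seq, rule wp_For[where a = 0 and n = m and b = 5 and
      I = "?J4 ys ys'"])
    fix j :: nat and s :: state
    assume *: "?J4 ys ys' j s" "fst s 6 = j" "j < m"
    show "wp ?b3 s (\<lambda>k s'. k \<le> 5 \<and> fst s' 6 = j \<and> ?J4 ys ys' (Suc j) ((fst s')(6 := Suc j), snd s'))"
    proof (cases "ed j \<in> N")
      case False
      then have "flag j = ?f j" by (simp add: flag_def)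
      then show ?thesis
        using * False blend_skip[of flag j ?f m] by (intro wp_If wp_Assign) auto
    next
      case True
      then have fl: "if bypass N (ed j) then flag j = 2 else flag j = ?f j" by (simp add: flag_def)
      have upd: "if bypass N (ed j) then (blend m j flag ?f)[j := 2] = blend m (Suc j) flag ?f
        else blend m j flag ?f = blend m (Suc j) flag ?f"
        using fl blend_update[OF *(3), of flag ?f] blend_skip[of flag j ?f m] by (auto split: if_splits)
      show ?thesis
        using * True upd pos[OF *(3)] idx table_byp[OF ys *(3)] nth_xs_edge[OF *(3)] table_len[OF ys(1)] table_len[OF ys(2)]
        by (intro wp_If wp_Seq wp_Assign wp_Write) (auto split: if_splits)
    qed
  next
    fix k :: nat and s :: state
    assume *: "?J4 ys ys' m s" and k: "k \<le> (5 + 2) * (m - 0) + 2"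
    show "wp (Call 0 skip_com 4) s (\<lambda>k'. ?Q (t + (k + k')))"
    proof (rule wp_Call[OF computes_skip])
      show "length zs \<le> wmax \<and> (\<forall>y\<in>set zs. y \<le> wmax)" if "zs = snd s 4" for zs
        using that * idx by (auto simp: blend_all flag_def)
    qed (use * k t T in \<open>auto simp: blend_all\<close>)
  qed (use s idx in \<open>auto simp: blend_0\<close>)
  let ?b2 = "com.If (Read 4 (Reg 6)) (Write 2 (Const 4 [+] Const 3 [*] Reg 6) (Reg 7)) skip_com"
  let ?c3 = "For 6 (Const 0) (Reg 2) ?b2 ;; Call 5 ca 2 ;; ?c4"
  have c3: "wp ?c3 s (\<lambda>k. ?Q (t + k))"
    if s: "?base s" "snd s 3 = ys" "snd s 2 = zs l" "snd s 4 = map ?f [0..<m]" "fst s 7 = B"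
      and ys: "two_shortest_table l ys"
      and t: "t \<le> T + 2 * n * n + 25 * m + 34" and T: "2 * n * n + 3 * m + 2 \<le> T" for s t ys
  proof (rule wp_Seq, rule wp_For[where a = 0 and n = m and b = 2 and
      I = "?J3 ys"])
    fix j :: nat and s :: state
    assume *: "?J3 ys j s" "fst s 6 = j" "j < m"
    have "ed j \<in> N \<Longrightarrow> (zs (lj j))[4 + 3 * j := B] = zs (lj (Suc j))" "ed j \<notin> N \<Longrightarrow> lj (Suc j) = lj j"
      using code_upd[OF *(3)] unfolding lj_Suc by simp_all
    then show "wp ?b2 s (\<lambda>k s'. k \<le> 2 \<and> fst s' 6 = j \<and> ?J3 ys (Suc j) ((fst s')(6 := Suc j), snd s'))"
      using * B_M by (intro wp_If wp_Assign wp_Write) (auto split: if_splits)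
  next
    fix k :: nat and s :: state
    assume *: "?J3 ys m s" and k: "k \<le> (2 + 2) * (m - 0) + 2"
    show "wp (Call 5 ca 2 ;; ?c4) s (\<lambda>k'. ?Q (t + (k + k')))"
    proof (rule wp_Seq, rule wp_Call)
      show "computes W ca (snd s 2) T (\<lambda>ys. two_shortest_table ?l' ys \<and> 2 * n * n + 3 * m + 2 \<le> T)"
        using apsp_computes[of ?l', OF l'1 l'3] * lj_m unfolding zs_def by simp
    next
      fix k' :: nat and ys' :: "nat list"
      assume ys': "two_shortest_table ?l' ys' \<and> 2 * n * n + 3 * m + 2 \<le> T" and k': "k' \<le> 1 + length (snd s 2) + T + length ys'"
      have "length (snd s 2) = 2 + 3 * m" using * by simp
      then have "k' \<le> T + 3 * m + 3 + 2 * n * n" using k' ys' by (simp add: two_shortest_table_def)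
      moreover have "k \<le> 4 * m + 2" using k by simp
      ultimately have "t + k + k' \<le> 2 * T + 2 * (2 * n * n) + 35 * m + 40" using t by linarith
      then have "t + k + k' \<le> 2 * T + 4 * n * n + 35 * m + 40" by simp
      then have "wp ?c4 (fst s, (snd s)(5 := ys')) (\<lambda>k''. ?Q ((t + k + k') + k''))"
        using * ys' ys T by (intro c4[of _ ys ys']) auto
      then show "wp ?c4 (fst s, (snd s)(5 := ys')) (\<lambda>k''. ?Q (t + (k + (k' + k''))))" by (simp add: add.assoc)
    next
      show "length ys \<le> wmax \<and> (\<forall>y\<in>set ys. y \<le> wmax)"
        if "two_shortest_table ?l' ys \<and> 2 * n * n + 3 * m + 2 \<le> T" for ys
        using that wmax_ge(7) by (auto simp: two_shortest_table_def)
    qed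
  qed (use s idx lj_0 in auto)
  let ?b1 = "?p8 ;; 7 ::= Reg 7 [+] Reg 4 [*] Read 0 (Const 7 [+] Const 3 [*] Reg 6) ;;
       com.If (Read 3 (Reg 8 [+] Const 1))
         (com.If (Reg 4 [*] Read 3 (Reg 8) [<] Reg 5 [*] Read 3 (Reg 8 [+] Const 1)) skip_com
           (Write 4 (Reg 6) (Const 1)))
         skip_com"
  let ?c2 = "For 6 (Const 0) (Reg 2) ?b1 ;; ?c3"
  have c2: "wp ?c2 s (\<lambda>k. ?Q (t + k))"
    if s: "?base s" "snd s 3 = ys" "snd s 2 = zs l" "snd s 4 = replicate m 0" "fst s 7 = 1"
      and ys: "two_shortest_table l ys"
      and t: "t \<le> T + 2 * n * n + 17 * m + 30" and T: "2 * n * n + 3 * m + 2 \<le> T" for s t ys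
  proof (rule wp_Seq, rule wp_For[where a = 0 and n = m and b = 5 and
      I = "?J2 ys"])
    fix j :: nat and s :: state
    assume *: "?J2 ys j s" "fst s 6 = j" "j < m"
    have upd: "if ed j \<in> N then (blend m j ?f (\<lambda>_. 0))[j := Suc 0] = blend m (Suc j) ?f (\<lambda>_. 0)
        else blend m j ?f (\<lambda>_. 0) = blend m (Suc j) ?f (\<lambda>_. 0)"
      using blend_update[OF *(3), of ?f "\<lambda>_. 0"] blend_skip[of ?f j "\<lambda>_. 0" m] by (auto split: if_splits)
    show "wp ?b1 s (\<lambda>k s'. k \<le> 5 \<and> fst s' 6 = j \<and> ?J2 ys (Suc j) ((fst s')(6 := Suc j), snd s'))"
      using * upd pos[OF *(3)] idx table_N[OF ys *(3)] nth_xs_edge[OF *(3)] table_len[OF ys] BM[of "Suc j"]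
      by (intro wp_If wp_Seq wp_Assign wp_Write) (auto split: if_splits)
  next
    fix k :: nat and s :: state
    assume *: "?J2 ys m s" and k: "k \<le> (5 + 2) * (m - 0) + 2"
    have "wp ?c3 s (\<lambda>k'. ?Q ((t + k) + k'))"
      using * k t T ys by (intro c3[of _ ys]) (auto simp: blend_all B_def)
    then show "wp ?c3 s (\<lambda>k'. ?Q (t + (k + k')))" by (simp add: add.assoc)
  qed (use s idx in \<open>auto simp: replicate_blend\<close>)
  let ?c1 = "Call 3 ca 2 ;; New 4 (Reg 2) ;; 7 ::= Const 1 ;; ?c2"
  have c1: "wp ?c1 s (\<lambda>k. ?Q (t + k))"
    if s: "?base s" "snd s 2 = zs l" and t: "t \<le> 12 * m + 12" for s t
  proof (rule wp_Seq, rule wp_Call)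
    show "computes W ca (snd s 2) T (\<lambda>ys. two_shortest_table l ys \<and> 2 * n * n + 3 * m + 2 \<le> T)"
      using apsp_computes[of l, OF len_pos l3] s unfolding zs_def by simp
  next
    fix k :: nat and ys :: "nat list"
    assume ys: "two_shortest_table l ys \<and> 2 * n * n + 3 * m + 2 \<le> T" and k: "k \<le> 1 + length (snd s 2) + T + length ys"
    have "length (snd s 2) = 2 + 3 * m" using s by simp
    then have k': "k \<le> T + 3 * m + 3 + 2 * n * n" using k ys by (simp add: two_shortest_table_def)
    let ?s = "((fst s)(7 := 1), (snd s)(3 := ys, 4 := replicate m 0))"
    have w: "wp ?c2 ?s (\<lambda>k''. ?Q ((t + (k + (1 + m + 1))) + k''))"
      using s ys k' t by (intro c2[of _ ys]) auto
    show "wp (New 4 (Reg 2) ;; 7 ::= Const 1 ;; ?c2) (fst s, (snd s)(3 := ys)) (\<lambda>k'. ?Q (t + (k + k')))"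
      by (rule wp_Seq, rule wp_New_to[where k = m], rule wp_Seq, rule wp_Assign_to[where x = 1],
          rule wp_conseq[OF w]) (use s idx in auto)
  next
    show "length ys \<le> wmax \<and> (\<forall>y\<in>set ys. y \<le> wmax)"
      if "two_shortest_table l ys \<and> 2 * n * n + 3 * m + 2 \<le> T" for ys
      using that wmax_ge(7) by (auto simp: two_shortest_table_def)
  qed
  let ?c0 = "For 6 (Const 2) (Len 2) (Write 2 (Reg 6) (Read 0 (Reg 6 [+] Const 3))) ;; ?c1"
  have c0: "wp ?c0 s (\<lambda>k. ?Q (t + k))"
    if s: "?base s" "snd s 2 = [n, m] @ replicate (3 * m) 0" and t: "t \<le> 3 * m + 10" for s t
  proof (rule wp_Seq, rule wp_copy[where zs = "zs l"])
    fix k assume k: "k \<le> 3 * (length (zs l) - 2) + 2"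
    let ?s = "((fst s)(6 := length (zs l)), (snd s)(2 := zs l))"
    have "wp ?c1 ?s (\<lambda>k'. ?Q ((t + k) + k'))"
      using s t k by (intro c1) auto
    then show "wp ?c1 ?s (\<lambda>k'. ?Q (t + (k + k')))" by (simp add: add.assoc)
  next
    show "snd s 2 = take 2 (zs l) @ replicate (length (zs l) - 2) 0" using s by (simp add: zs_def)
    show "j + 3 < length (snd s 0) \<and> snd s 0 ! (j + 3) = zs l ! j" if "2 \<le> j" "j < length (zs l)" for j
      using that s(1) zs_code[of j] by simp
  qed (use zs_M in auto)
  show "wp (apsp_flags_com ca) (init xs) ?Q"
    unfolding apsp_flags_com_def init_def
    apply (rule wp_Seq, rule wp_Assign_to[where x = m])
    apply (rule wp_Seq, rule wp_Assign_to[where x = n])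
    apply (rule wp_Seq, rule wp_Assign_to[where x = num])
    apply (rule wp_Seq, rule wp_Assign_to[where x = den])
    apply (rule wp_Seq, rule wp_New_to[where k = "2 + 3 * m"])
    apply (rule wp_Seq, rule wp_Write_to[where i = 0 and x = n and ys = "n # replicate (1 + 3 * m) 0"])
    apply (rule wp_Seq, rule wp_Write_to[where i = 1 and x = m and ys = "n # m # replicate (3 * m) 0"])
    apply (rule wp_conseq[OF c0[where t = "3 * m + 9"]])
    using idx nth_xs(5,6) by (simp_all add: numeral_eq_Suc)
  show "length xs \<le> wmax" using wmax_ge(6) by simp
  show "\<forall>x\<in>set xs. x \<le> wmax" using in_xs_less wmax_ge(2) by fastforce
qed

end

section \<open>Breadth-first search\<close>

text \<open>Distances are shifted by one, so that \<open>D x = 0\<close> means that \<open>x\<close> has not been reached; \<open>S x\<close> is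
  the first node after \<open>s\<close> on the path to \<open>x\<close>.\<close>

locale bfs_arcs =
  fixes n s :: nat and al :: "nat \<Rightarrow> nat list" and tg :: "nat \<Rightarrow> nat"
  assumes s: "s < n" and tg: "x < n \<Longrightarrow> b \<in> set (al x) \<Longrightarrow> tg b < n"
begin

text \<open>The two cases differ in the label: a child of \<open>s\<close> starts a branch of its
  own, whereas any other node inherits the branch of its predecessor.\<close>

definition parent :: "(nat \<Rightarrow> nat) \<Rightarrow> (nat \<Rightarrow> nat) \<Rightarrow> nat \<Rightarrow> bool" where
  "parent D S y \<longleftrightarrow> (D y = 2 \<and> S y = y \<and> (\<exists>b\<in>set (al s). tg b = y)) \<or>
     (\<exists>x<n. x \<noteq> s \<and> D x \<noteq> 0 \<and> D y = D x + 1 \<and> S y = S x \<and> (\<exists>b\<in>set (al x). tg b = y))"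

definition relaxed :: "(nat \<Rightarrow> nat) \<Rightarrow> nat \<Rightarrow> nat \<Rightarrow> bool" where
  "relaxed D x b \<longleftrightarrow> D (tg b) \<noteq> 0 \<and> D (tg b) \<le> D x + 1"

text \<open>\<open>q\<close> lists the reached nodes in order of discovery,
  \<open>q ! (h - 1)\<close> is the node being scanned, and its arcs split into the scanned ones
  \<open>P\<close> and the remaining ones \<open>L\<close>. As usual for a queue, levels do not
  decrease along \<open>q\<close> and exceed that of the current node by at most one. The bound
  \<open>i + 1\<close> keeps the levels within \<open>n\<close>.\<close>

definition inv :: "nat \<Rightarrow> nat list \<Rightarrow> (nat \<Rightarrow> nat) \<Rightarrow> (nat \<Rightarrow> nat) \<Rightarrow> nat list \<Rightarrow> nat list \<Rightarrow> bool" where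
  "inv h q D S P L \<longleftrightarrow> 1 \<le> h \<and> h \<le> length q \<and> distinct q \<and> set q \<subseteq> {..<n} \<and>
     (\<forall>x<n. D x \<noteq> 0 \<longleftrightarrow> x \<in> set q) \<and> D s = 1 \<and>
     (\<forall>i<length q. D (q ! i) \<le> i + 1 \<and> D (q ! i) \<le> D (q ! (h - 1)) + 1) \<and>
     (\<forall>j<length q. \<forall>i\<le>j. D (q ! i) \<le> D (q ! j)) \<and>
     al (q ! (h - 1)) = P @ L \<and>
     (\<forall>i<h - 1. \<forall>b\<in>set (al (q ! i)). relaxed D (q ! i) b) \<and>
     (\<forall>b\<in>set P. relaxed D (q ! (h - 1)) b) \<and>
     (\<forall>y\<in>set q. y \<noteq> s \<longrightarrow> parent D S y)"

text \<open>Local conditions that remain when the search is over and no longer refer to the queue.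
  Relaxed arcs make \<open>D\<close> a lower bound for the number of nodes on walks from
  \<open>s\<close>; parents provide walks that attain it.\<close>

definition certificate :: "(nat \<Rightarrow> nat) \<Rightarrow> (nat \<Rightarrow> nat) \<Rightarrow> bool" where
  "certificate D S \<longleftrightarrow> D s = 1 \<and>
     (\<forall>x<n. D x \<noteq> 0 \<longrightarrow> (\<forall>b\<in>set (al x). relaxed D x b)) \<and>
     (\<forall>y<n. D y \<noteq> 0 \<longrightarrow> y \<noteq> s \<longrightarrow> parent D S y) \<and> (\<forall>x<n. D x \<le> n)"

lemma inv_current:
  assumes "inv h q D S P L"
  shows "q ! (h - 1) < n" "q ! (h - 1) \<in> set q" "D (q ! (h - 1)) \<noteq> 0"
proof -
  show 1: "q ! (h - 1) \<in> set q" using assms by (auto simp: inv_def)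
  show "q ! (h - 1) < n" using assms 1 unfolding inv_def by blast
  then show "D (q ! (h - 1)) \<noteq> 0" using assms 1 unfolding inv_def by blast
qed

text \<open>No reached node lies more than one level above the current one, so an arc to such a node
  is relaxed as it stands.\<close>

lemma inv_old:
  assumes inv: "inv h q D S P (b # L)" and y: "D (tg b) \<noteq> 0"
  shows "inv h q D S (P @ [b]) L"
proof -
  let ?x = "q ! (h - 1)"
  have "b \<in> set (al ?x)" using inv by (simp add: inv_def)
  then have "tg b < n" using tg inv_current(1)[OF inv] by blast
  then have "tg b \<in> set q" using y inv unfolding inv_def by blast
  then obtain i where "i < length q" "tg b = q ! i" by (metis in_set_conv_nth)
  then have "relaxed D ?x b" using inv y unfolding inv_def relaxed_def by simp
  then show ?thesis using inv unfolding inv_def by auto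
qed

text \<open>The new node enters at the end of the queue with the highest level allowed, which
  preserves monotonicity. Earlier parents and relaxed arcs never refer to it, since its level was 0.
  The bounds on \<open>length q\<close> and \<open>D x + 1\<close> justify the array access and the
  stored value.\<close>

lemma inv_new:
  assumes inv: "inv h q D S P (b # L)" and y: "D (tg b) = 0"
  defines "x \<equiv> q ! (h - 1)"
  shows "inv h (q @ [tg b]) (D(tg b := D x + 1)) (S(tg b := (if x = s then tg b else S x))) (P @ [b]) L"
    "tg b < n" "length q < n" "D x + 1 \<le> n"
proof -
  let ?D = "D(tg b := D x + 1)" and ?q = "q @ [tg b]" and ?S = "S(tg b := (if x = s then tg b else S x))"
  note cur = inv_current[OF inv, folded x_def]
  have bx: "b \<in> set (al x)" using inv by (simp add: inv_def x_def)
  then show tgn: "tg b < n" using tg cur(1) by blast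
  have new: "tg b \<notin> set q" using y tgn inv unfolding inv_def by blast
  then have ne: "q ! i \<noteq> tg b" if "i < length q" for i using new nth_mem[OF that] by metis
  have h: "1 \<le> h" "h \<le> length q" using inv by (auto simp: inv_def)
  have sub: "set q \<subseteq> {..<n}" "distinct q" using inv by (auto simp: inv_def)
  have "set ?q \<subseteq> {..<n}" "distinct ?q" using sub tgn new by auto
  then show len: "length q < n" using card_mono[of "{..<n}" "set ?q"] by (simp add: distinct_card)
  have Dx: "D x \<le> h" using inv h unfolding inv_def x_def by (metis Suc_diff_1 Suc_eq_plus1 diff_less le_trans less_le_trans less_numeral_extra(1) order_refl)
  then show "D x + 1 \<le> n" using h len by simp
  have xn: "x \<noteq> tg b" using cur(2) new by auto
  have sn: "s \<noteq> tg b" using inv y unfolding inv_def by auto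
  have mono: "relaxed ?D z a" if "relaxed D z a" "z \<noteq> tg b" for z a
    using that y by (auto simp: relaxed_def)
  have parent: "parent ?D ?S z" if "parent D S z" "z \<noteq> tg b" for z
    using that(1) unfolding parent_def
  proof
    assume "\<exists>x<n. x \<noteq> s \<and> D x \<noteq> 0 \<and> D z = D x + 1 \<and> S z = S x \<and> (\<exists>b\<in>set (al x). tg b = z)"
    then obtain w where w: "w < n" "w \<noteq> s" "D w \<noteq> 0" "D z = D w + 1" "S z = S w" "\<exists>b\<in>set (al w). tg b = z" by blast
    then have "w \<noteq> tg b" using y by auto
    then show "(?D z = 2 \<and> ?S z = z \<and> (\<exists>b\<in>set (al s). tg b = z)) \<or>
      (\<exists>x<n. x \<noteq> s \<and> ?D x \<noteq> 0 \<and> ?D z = ?D x + 1 \<and> ?S z = ?S x \<and> (\<exists>b\<in>set (al x). tg b = z))"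
      using w that(2) by (intro disjI2 exI[of _ w]) auto
  qed (use that(2) in auto)
  have parent_new: "parent ?D ?S (tg b)"
  proof (cases "x = s")
    case True
    then have "D x = 1" using inv by (simp add: inv_def)
    then show ?thesis using True bx unfolding parent_def by auto
  next
    case False
    then show ?thesis using cur bx xn unfolding parent_def by (intro disjI2 exI[of _ x]) auto
  qed
  have Dq: "?D (?q ! i) = D (q ! i)" if "i < length q" for i using that ne[OF that] by (simp add: nth_append)
  have Dl: "?D (?q ! length q) = D x + 1" by simp
  have "h - 1 < length q" using h by simp
  then have cx: "?q ! (h - 1) = x" by (simp add: nth_append x_def)
  show "inv h ?q ?D ?S (P @ [b]) L"
    unfolding inv_def cx
  proof (intro conjI)
    show "\<forall>i<length ?q. ?D (?q ! i) \<le> i + 1 \<and> ?D (?q ! i) \<le> ?D x + 1"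
    proof (intro allI impI)
      fix i assume "i < length ?q"
      then consider "i < length q" | "i = length q" by force
      then show "?D (?q ! i) \<le> i + 1 \<and> ?D (?q ! i) \<le> ?D x + 1"
      proof cases
        case 1
        then show ?thesis using inv Dq[OF 1] xn unfolding inv_def x_def by simp
      next
        case 2
        then show ?thesis using Dl Dx h xn by simp
      qed
    qed
    show "\<forall>j<length ?q. \<forall>i\<le>j. ?D (?q ! i) \<le> ?D (?q ! j)"
    proof (intro allI impI)
      fix i j assume j: "j < length ?q" and i: "i \<le> j"
      then consider "j < length q" | "j = length q" "i < length q" | "j = length q" "i = length q" by force
      then show "?D (?q ! i) \<le> ?D (?q ! j)"
      proof cases
        case 1
        then show ?thesis using inv i Dq[of i] Dq[of j] unfolding inv_def by auto
      next
        case 2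
        then show ?thesis using inv Dq[of i] Dl unfolding inv_def x_def by auto
      qed auto
    qed
    show "\<forall>i<h - 1. \<forall>b\<in>set (al (?q ! i)). relaxed ?D (?q ! i) b"
    proof (intro allI impI ballI)
      fix i a assume i: "i < h - 1" and a: "a \<in> set (al (?q ! i))"
      then have "?q ! i = q ! i" "i < length q" using h by (auto simp: nth_append)
      then show "relaxed ?D (?q ! i) a" using i a inv ne[of i] mono unfolding inv_def by auto
    qed
    show "\<forall>a\<in>set (P @ [b]). relaxed ?D x a"
    proof
      fix a assume "a \<in> set (P @ [b])"
      then consider "a \<in> set P" | "a = b" by auto
      then show "relaxed ?D x a"
      proof cases
        case 1
        then show ?thesis using inv mono xn unfolding inv_def x_def by blast
      next
        case 2
        then show ?thesis using xn by (simp add: relaxed_def)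
      qed
    qed
    show "\<forall>y\<in>set ?q. y \<noteq> s \<longrightarrow> parent ?D ?S y"
    proof (intro ballI impI)
      fix z assume z: "z \<in> set ?q" "z \<noteq> s"
      show "parent ?D ?S z"
      proof (cases "z = tg b")
        case False
        then have "parent D S z" using z inv unfolding inv_def by auto
        then show ?thesis using parent False by blast
      qed (use parent_new in simp)
    qed
    show "\<forall>z<n. ?D z \<noteq> 0 \<longleftrightarrow> z \<in> set ?q" using inv unfolding inv_def by auto
  qed (use inv h sn \<open>set ?q \<subseteq> {..<n}\<close> \<open>distinct ?q\<close> in \<open>auto simp: inv_def x_def\<close>)
qed

text \<open>The next node has at least the level of the current one, so the condition of being at
  most one level above can only become weaker.\<close>

lemma inv_pop:
  assumes inv: "inv h q D S P []" and h: "h < length q"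
  shows "inv (Suc h) q D S [] (al (q ! h))"
proof -
  have h1: "1 \<le> h" using inv by (simp add: inv_def)
  have le: "D (q ! (h - 1)) \<le> D (q ! h)" using inv h unfolding inv_def by auto
  have bound: "D (q ! i) \<le> D (q ! h) + 1" if "i < length q" for i
    using inv that le unfolding inv_def by (meson add_le_mono1 le_trans)
  have rel: "relaxed D (q ! i) b" if "i < h" "b \<in> set (al (q ! i))" for i b
  proof (cases "i = h - 1")
    case True
    then show ?thesis using inv that unfolding inv_def by auto
  next
    case False
    then show ?thesis using inv that unfolding inv_def by auto
  qed
  show ?thesis using inv h bound rel unfolding inv_def by auto
qed

lemma inv_certificate:
  assumes inv: "inv h q D S P []" and h: "h = length q"
  shows "certificate D S"
proof -
  have h1: "1 \<le> h" using inv by (simp add: inv_def)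
  have rel: "relaxed D (q ! i) b" if "i < h" "b \<in> set (al (q ! i))" for i b
  proof (cases "i = h - 1")
    case True
    then show ?thesis using inv that unfolding inv_def by auto
  next
    case False
    then show ?thesis using inv that unfolding inv_def by auto
  qed
  have len: "length q \<le> n"
    using inv card_mono[of "{..<n}" "set q"] by (simp add: inv_def distinct_card)
  show ?thesis
    unfolding certificate_def
  proof (intro conjI allI impI ballI)
    fix x b assume "x < n" "D x \<noteq> 0" "b \<in> set (al x)"
    then have "x \<in> set q" using inv unfolding inv_def by blast
    then obtain i where "i < length q" "x = q ! i" by (metis in_set_conv_nth)
    then show "relaxed D x b" using rel h \<open>b \<in> set (al x)\<close> by blast
  next
    fix x assume x: "x < n"
    show "D x \<le> n"
    proof (cases "x \<in> set q")
      case True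
      then obtain i where "i < length q" "x = q ! i" by (metis in_set_conv_nth)
      then have "D x \<le> i + 1" using inv unfolding inv_def by blast
      then show ?thesis using \<open>i < length q\<close> len by simp
    next
      case False
      then have "D x = 0" using inv x unfolding inv_def by blast
      then show ?thesis by simp
    qed
  qed (use inv in \<open>auto simp: inv_def\<close>)
qed

end

text \<open>Linked lists in an array; the pointer 0 is the end, and the pointer \<open>b + 1\<close> refers to entry \<open>b\<close>.\<close>

fun chain :: "nat list \<Rightarrow> nat \<Rightarrow> nat list \<Rightarrow> bool" where
  "chain nx a [] \<longleftrightarrow> a = 0"
| "chain nx a (b # L) \<longleftrightarrow> a = Suc b \<and> chain nx (nx ! b) L"

lemma chain_update: "b \<notin> set L \<Longrightarrow> chain (nx[b := v]) a L = chain nx a L"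
  by (induction L arbitrary: a) auto

text \<open>Arrays 2 and 3 hold the heads and links of the arc lists, 4 the values of
  \<open>D\<close> and \<open>S\<close>, and 5 the queue. Registers 8 and 9 are \<open>h\<close> and
  the length of the queue, 10 is the current node, 11 points to its next arc, 12 and 13 are an arc
  and its target.\<close>

definition pop_com :: com where
  "pop_com = (10 ::= Read 5 (Reg 8) ;; incr 8 ;; 11 ::= Read 2 (Reg 10))"

definition visit_com :: com where
  "visit_com = (Write 4 (Const 2 [*] Reg 13) (Read 4 (Const 2 [*] Reg 10) [+] Const 1) ;;
     Write 5 (Reg 9) (Reg 13) ;; incr 9 ;;
     If (Reg 10 [=] Reg 4) (Write 4 (Const 2 [*] Reg 13 [+] Const 1) (Reg 13))
       (Write 4 (Const 2 [*] Reg 13 [+] Const 1) (Read 4 (Const 2 [*] Reg 10 [+] Const 1))))"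

text \<open>The inner difference is the parity of the arc: an even arc leads to the second endpoint
  of its edge and an odd arc to the first.\<close>

definition arc_com :: com where
  "arc_com = (12 ::= Reg 11 [-] Const 1 ;;
     13 ::= Read 0 (Const 3 [+] Const 3 [*] Op Divide (Reg 12) (Const 2) [+]
       (Const 1 [-] (Reg 12 [-] Const 2 [*] Op Divide (Reg 12) (Const 2)))) ;;
     If (Read 4 (Const 2 [*] Reg 13)) skip_com visit_com ;;
     11 ::= Read 3 (Reg 12))"

text \<open>Edges with length entry 0 count as deleted; in contrast to the oracles, this search may
  be run on a disconnected graph. A single flat loop either scans an arc or takes a node from the
  queue, so that one potential pays for both.\<close>

definition bfs_com :: com where
  "bfs_com = (
     2 ::= Read 0 (Const 0) ;; 3 ::= Read 0 (Const 1) ;; 4 ::= Read 0 (Const 2) ;;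
     New 2 (Reg 2) ;; New 3 (Const 2 [*] Reg 3) ;; New 4 (Const 2 [*] Reg 2) ;; New 5 (Reg 2) ;;
     For 6 (Const 0) (Reg 3)
       (If (Read 0 (Const 5 [+] Const 3 [*] Reg 6))
         (7 ::= Read 0 (Const 3 [+] Const 3 [*] Reg 6) ;;
          Write 3 (Const 2 [*] Reg 6) (Read 2 (Reg 7)) ;;
          Write 2 (Reg 7) (Const 2 [*] Reg 6 [+] Const 1) ;;
          7 ::= Read 0 (Const 4 [+] Const 3 [*] Reg 6) ;;
          Write 3 (Const 2 [*] Reg 6 [+] Const 1) (Read 2 (Reg 7)) ;;
          Write 2 (Reg 7) (Const 2 [*] Reg 6 [+] Const 2))
         skip_com) ;;
     Write 4 (Const 2 [*] Reg 4) (Const 1) ;; Write 5 (Const 0) (Reg 4) ;;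
     8 ::= Const 1 ;; 9 ::= Const 1 ;; 10 ::= Reg 4 ;; 11 ::= Read 2 (Reg 4) ;;
     While (Reg 11 [+] (Reg 8 [<] Reg 9)) (If (Reg 11) arc_com pop_com) ;;
     Call 0 skip_com 4)"

text \<open>Edge \<open>i\<close> joins \<open>u i\<close> and \<open>v i\<close> and is ignored if \<open>dead i\<close>; it gives the arcs \<open>2 i\<close> and
  \<open>2 i + 1\<close>.\<close>

locale bfs_input = machine +
  fixes zs :: "nat list" and n m s :: nat and u v :: "nat \<Rightarrow> nat" and dead :: "nat \<Rightarrow> bool"
  assumes len: "length zs = 3 + 3 * m" and hd: "zs ! 0 = n" "zs ! 1 = m" "zs ! 2 = s"
    and edge: "\<And>i. i < m \<Longrightarrow> zs ! (3 + 3 * i) = u i \<and> zs ! (4 + 3 * i) = v i \<and> (zs ! (5 + 3 * i) = 0 \<longleftrightarrow> dead i)"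
    and nodes: "s < n" "\<And>i. i < m \<Longrightarrow> u i < n \<and> v i < n"
    and bounds: "3 * m + 3 \<le> M" "2 * n \<le> M" "\<forall>z\<in>set zs. z \<le> M"
begin

definition tail :: "nat \<Rightarrow> nat" where "tail b = (if even b then u (b div 2) else v (b div 2))"
definition tg :: "nat \<Rightarrow> nat" where "tg b = (if even b then v (b div 2) else u (b div 2))"

text \<open>Reversed, because arcs are pushed onto the front of their lists.\<close>

definition arcs :: "nat \<Rightarrow> nat \<Rightarrow> nat list" where
  "arcs k x = rev (filter (\<lambda>b. \<not> dead (b div 2) \<and> tail b = x) [0..<k])"

abbreviation "al \<equiv> arcs (2 * m)"

sublocale bfs_arcs n s al tg
proof
  fix x b assume "b \<in> set (al x)"
  then have "b div 2 < m" by (auto simp: arcs_def)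
  then show "tg b < n" using nodes(2) by (auto simp: tg_def)
qed (rule nodes(1))

lemma arcs_Suc: "arcs (Suc k) x = (if \<not> dead (k div 2) \<and> tail k = x then k # arcs k x else arcs k x)"
  by (simp add: arcs_def)

lemma arcs_less: "b \<in> set (arcs k x) \<Longrightarrow> b < k"
  by (auto simp: arcs_def)

lemma al_less: "b \<in> set (al x) \<Longrightarrow> b < 2 * m"
  by (rule arcs_less)

lemma sum_arcs: "(\<Sum>x<n. length (arcs k x)) \<le> k"
proof (induction k)
  case (Suc k)
  have "(\<Sum>x<n. length (arcs (Suc k) x)) \<le> (\<Sum>x<n. length (arcs k x) + (if x = tail k then 1 else 0))"
    by (intro sum_mono) (auto simp: arcs_Suc)
  also have "\<dots> \<le> (\<Sum>x<n. length (arcs k x)) + 1" by (simp add: sum.distrib)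
  finally show ?case using Suc by simp
qed (simp add: arcs_def)

definition lists_ok :: "nat \<Rightarrow> nat list \<Rightarrow> nat list \<Rightarrow> bool" where
  "lists_ok k hs nx \<longleftrightarrow> length hs = n \<and> length nx = 2 * m \<and> (\<forall>x<n. chain nx (hs ! x) (arcs k x))"

lemma lists_ok_add:
  assumes "lists_ok k hs nx" "k < 2 * m" "\<not> dead (k div 2)" "tail k < n"
  shows "lists_ok (Suc k) (hs[tail k := Suc k]) (nx[k := hs ! tail k])"
  unfolding lists_ok_def
proof (intro conjI allI impI)
  fix x assume x: "x < n"
  have "k \<notin> set (arcs k y)" for y using arcs_less by blast
  then show "chain (nx[k := hs ! tail k]) (hs[tail k := Suc k] ! x) (arcs (Suc k) x)"
    using assms x by (auto simp: lists_ok_def arcs_Suc chain_update nth_list_update)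
qed (use assms in \<open>auto simp: lists_ok_def\<close>)

lemma lists_ok_skip: "lists_ok k hs nx \<Longrightarrow> dead (k div 2) \<Longrightarrow> lists_ok (Suc k) hs nx"
  by (simp add: lists_ok_def arcs_Suc)

lemma lists_ok_edge:
  assumes "lists_ok (2 * i) hs nx" "i < m" "\<not> dead i"
  shows "lists_ok (2 * Suc i)
    ((hs[u i := Suc (2 * i)])[v i := Suc (Suc (2 * i))])
    ((nx[2 * i := hs ! u i])[Suc (2 * i) := hs[u i := Suc (2 * i)] ! v i])"
  using lists_ok_add[OF lists_ok_add[OF assms(1)], of] assms nodes(2)[OF assms(2)]
  by (simp add: tail_def)

lemma lists_ok_edge_skip: "lists_ok (2 * i) hs nx \<Longrightarrow> dead i \<Longrightarrow> lists_ok (2 * Suc i) hs nx"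
  using lists_ok_skip[OF lists_ok_skip[of "2 * i"]] by simp

lemma lists_ok_0: "lists_ok 0 (replicate n 0) (replicate (2 * m) 0)"
  by (simp add: lists_ok_def arcs_def)

text \<open>\<open>D\<close> and \<open>S\<close> are stored alternately.\<close>

abbreviation "Dof os \<equiv> (\<lambda>x. os ! (2 * x))"
abbreviation "Sof os \<equiv> (\<lambda>x. os ! Suc (2 * x))"

lemma Dof_update: "y < n \<Longrightarrow> length os = 2 * n \<Longrightarrow> Dof (os[2 * y := z]) = (Dof os)(y := z)"
  "y < n \<Longrightarrow> length os = 2 * n \<Longrightarrow> Dof (os[Suc (2 * y) := z]) = Dof os"
  by (auto simp: fun_eq_iff nth_list_update, presburger)

lemma Sof_update: "y < n \<Longrightarrow> length os = 2 * n \<Longrightarrow> Sof (os[Suc (2 * y) := z]) = (Sof os)(y := z)"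
  "y < n \<Longrightarrow> length os = 2 * n \<Longrightarrow> Sof (os[2 * y := z]) = Sof os"
  by (auto simp: fun_eq_iff nth_list_update, presburger)

lemma chain_unique: "chain nx a L \<Longrightarrow> chain nx a L' \<Longrightarrow> L = L'"
proof (induction L arbitrary: a L')
  case (Cons b L)
  then show ?case by (cases L') auto
next
  case Nil
  then show ?case by (cases L') auto
qed

text \<open>The potential of a loop must be a function of the state, whereas the list behind a
  pointer is known only existentially; \<open>chain_unique\<close> justifies the
  description.\<close>

definition chain_length :: "nat list \<Rightarrow> nat \<Rightarrow> nat" where
  "chain_length nx a = (THE k. \<exists>L. chain nx a L \<and> length L = k)"

lemma chain_length: "chain nx a L \<Longrightarrow> chain_length nx a = length L"
  unfolding chain_length_def using chain_unique by blast

lemma bounded_nth: "bounded_state M st \<Longrightarrow> i < length (snd st a) \<Longrightarrow> snd st a ! i \<le> M"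
  unfolding bounded_state_def by (meson nth_mem)

text \<open>The number of arcs of nodes not yet taken from the queue, reached or not; written as a
  difference, it does not change when the queue grows.\<close>

definition unseen :: "nat \<Rightarrow> nat list \<Rightarrow> nat" where
  "unseen h q = (\<Sum>x<n. length (al x)) - (\<Sum>i<h. length (al (q ! i)))"

lemma unseen_Suc:
  assumes "inv h q D S P L" "h < length q"
  shows "unseen h q = length (al (q ! h)) + unseen (Suc h) q"
proof -
  have q: "distinct q" "set q \<subseteq> {..<n}" using assms(1) by (auto simp: inv_def)
  have "(\<Sum>i<Suc h. length (al (q ! i))) = (\<Sum>x\<in>(!) q ` {..<Suc h}. length (al x))"
    using q(1) assms(2) by (subst sum.reindex) (auto simp: inj_on_def nth_eq_iff_index_eq simp del: sum.lessThan_Suc)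
  also have "\<dots> \<le> (\<Sum>x<n. length (al x))"
    using q(2) assms(2) by (intro sum_mono2) (auto simp: subset_iff less_Suc_eq)
  finally show ?thesis by (simp add: unseen_def)
qed

definition search_state :: "nat list \<Rightarrow> nat list \<Rightarrow> state \<Rightarrow> nat list \<Rightarrow> nat list \<Rightarrow> nat list \<Rightarrow> bool" where
  "search_state hs nx st q P L \<longleftrightarrow> snd st 0 = zs \<and> fst st 2 = n \<and> fst st 4 = s \<and> snd st 2 = hs \<and>
     snd st 3 = nx \<and> length (snd st 4) = 2 * n \<and> snd st 5 = q @ replicate (n - length q) 0 \<and>
     fst st 9 = length q \<and> fst st 10 = q ! (fst st 8 - 1) \<and> chain nx (fst st 11) L \<and>
     inv (fst st 8) q (Dof (snd st 4)) (Sof (snd st 4)) P L"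

text \<open>Scanning an arc shortens the current chain; taking a node lowers \<open>n - h\<close>
  while its arcs move from the unseen ones to the chain. The factor 12 covers the at most 9 steps of
  an arc, the branch and the loop test.\<close>

definition potential :: "nat list \<Rightarrow> state \<Rightarrow> nat" where
  "potential nx st = 12 * (n - fst st 8 + unseen (fst st 8) (snd st 5) + chain_length nx (fst st 11))"

lemma unseen_append: "h \<le> length q \<Longrightarrow> unseen h (q @ r) = unseen h q"
  by (simp add: unseen_def nth_append)

lemma potential_eq:
  assumes "search_state hs nx st q P L"
  shows "potential nx st = 12 * (n - fst st 8 + unseen (fst st 8) q + length L)"
  using assms chain_length[of nx "fst st 11" L]
  by (auto simp: potential_def search_state_def unseen_append inv_def)

lemma wp_pop:
  assumes lists: "lists_ok (2 * m) hs nx" and st: "search_state hs nx st q P []" and h: "fst st 8 < length q"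
    and b: "bounded_state M st"
  shows "wp pop_com st (\<lambda>k st'. k \<le> 3 \<and> search_state hs nx st' q [] (al (q ! fst st 8)) \<and> fst st' 8 = Suc (fst st 8))"
proof -
  let ?h = "fst st 8"
  have inv: "inv ?h q (Dof (snd st 4)) (Sof (snd st 4)) P []" using st by (simp add: search_state_def)
  have len: "length q \<le> n"
    using inv card_mono[of "{..<n}" "set q"] by (simp add: inv_def distinct_card)
  have "q ! ?h \<in> set q" using h by simp
  then have qn: "q ! ?h < n" using inv unfolding inv_def by blast
  then have ch: "chain nx (hs ! (q ! ?h)) (al (q ! ?h))" "q ! ?h < length hs" using lists by (auto simp: lists_ok_def)
  have "hs ! (q ! ?h) \<le> M" using bounded_nth[OF b, of "q ! ?h" 2] st ch(2) by (simp add: search_state_def)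
  then show ?thesis
    unfolding pop_com_def
    using st h qn ch inv_pop[OF inv h] len bounds nodes
    by (intro wp_Seq wp_Assign) (auto simp: search_state_def nth_append)
qed

lemma wp_arc:
  assumes lists: "lists_ok (2 * m) hs nx" and st: "search_state hs nx st q P (b # L)"
    and bd: "bounded_state M st"
  shows "wp arc_com st (\<lambda>k st'. k \<le> 9 \<and> fst st' 8 = fst st 8 \<and> (\<exists>q'. search_state hs nx st' q' (P @ [b]) L \<and> (q' = q \<or> q' = q @ [tg b])))"
proof -
  let ?h = "fst st 8" and ?os = "snd st 4"
  let ?x = "q ! (?h - 1)"
  have inv: "inv ?h q (Dof ?os) (Sof ?os) P (b # L)" using st by (simp add: search_state_def)
  have "b \<in> set (al ?x)" using inv by (simp add: inv_def)
  then have b: "b < 2 * m" by (rule al_less)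
  have bs: "b \<in> set (al ?x)" by fact
  have chs: "fst st 11 = Suc b" "chain nx (nx ! b) L" using st by (auto simp: search_state_def)
  have nxb: "nx ! b \<le> M" "b < length nx"
    using bounded_nth[OF bd, of b 3] st b lists by (auto simp: search_state_def lists_ok_def)
  note cur = inv_current[OF inv]
  have tgn: "tg b < n" using tg[OF cur(1) bs] .
  have i: "b div 2 < m" using b by simp
  have target: "zs ! (3 + 3 * (b div 2) + (1 - (b - 2 * (b div 2)))) = tg b"
  proof (cases "even b")
    case True
    then have "b - 2 * (b div 2) = 0" by simp
    then show ?thesis using edge[OF i] True by (simp add: tg_def)
  next
    case False
    then have "b - 2 * (b div 2) = 1" by presburger
    then show ?thesis using edge[OF i] False by (simp add: tg_def)
  qed
  have zlen: "3 + 3 * (b div 2) + (1 - (b - 2 * (b div 2))) < length zs" using i len by simp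
  have tgM: "tg b \<le> M" "2 * tg b + 1 < 2 * n" "2 * ?x + 1 < 2 * n" using tgn cur(1) bounds by auto
  have bM: "b \<le> M" using b bounds by simp
  have os: "length ?os = 2 * n" using st by (simp add: search_state_def)
  have osM: "?os ! j \<le> M" if "j < 2 * n" for j using bounded_nth[OF bd, of j 4] os that by simp
  let ?P = "\<lambda>k st'. k \<le> 9 \<and> fst st' 8 = fst st 8 \<and> (\<exists>q'. search_state hs nx st' q' (P @ [b]) L \<and> (q' = q \<or> q' = q @ [tg b]))"
  obtain rs as where st_eq: "st = (rs, as)" by (cases st)
  let ?rs = "rs(12 := b, 13 := tg b)"
  have "wp arc_com (rs, as) ?P"
    unfolding arc_com_def
  proof (rule wp_Seq, rule wp_Assign_to[where x = b], rule wp_Seq, rule wp_Assign_to[where x = "tg b"], rule wp_Seq, rule wp_If)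
    assume "val (?rs, as) (Read 4 (Const 2 [*] Reg 13)) \<noteq> 0"
    then have "Dof ?os (tg b) \<noteq> 0" using st_eq by simp
    from inv_old[OF inv this]
    show "wp skip_com (?rs, as) (\<lambda>k st'. wp (11 ::= Read 3 (Reg 12)) st' (\<lambda>k'. \<lambda>st'. ?P (1 + (1 + (1 + k + k'))) st'))"
      using st chs nxb bM unfolding st_eq
      by (intro wp_Assign) (auto simp: search_state_def intro!: exI[of _ q])
  next
    assume "val (?rs, as) (Read 4 (Const 2 [*] Reg 13)) = 0"
    then have D0: "Dof ?os (tg b) = 0" using st_eq by simp
    note new = inv_new[OF inv D0]
    have "replicate (n - length q) (0::nat) = 0 # replicate (n - Suc (length q)) 0"
      using new(3) by (simp flip: replicate_Suc add: Suc_diff_Suc)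
    then have qupd: "(q @ replicate (n - length q) 0)[length q := tg b] = (q @ [tg b]) @ replicate (n - length (q @ [tg b])) 0"
      by (simp add: list_update_append)
    let ?os1 = "?os[2 * tg b := Suc (?os ! (2 * ?x))]"
    let ?z = "if ?x = s then tg b else ?os ! Suc (2 * ?x)"
    let ?os2 = "?os1[Suc (2 * tg b) := ?z]"
    have D: "Dof ?os2 = (Dof ?os)(tg b := Dof ?os ?x + 1)" "Sof ?os2 = (Sof ?os)(tg b := ?z)"
      using tgn os by (simp_all add: Dof_update Sof_update)
    have inv': "inv ?h (q @ [tg b]) (Dof ?os2) (Sof ?os2) (P @ [b]) L"
      unfolding D using new(1) by simp
    have hq: "?h - 1 < length q" using inv by (auto simp: inv_def)
    have xne: "?os1 ! Suc (2 * ?x) = ?os ! Suc (2 * ?x)"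
      by (rule nth_list_update_neq) presburger
    have qM: "Suc (length q) \<le> M" "?os ! (2 * ?x) + 1 \<le> M" using new(3,4) bounds by auto
    let ?as = "as(4 := ?os1, 5 := (q @ [tg b]) @ replicate (n - length (q @ [tg b])) 0)"
    let ?rs' = "?rs(9 := Suc (length q))"
    let ?R = "\<lambda>k st'. wp (11 ::= Read 3 (Reg 12)) st' (\<lambda>k'. \<lambda>st'. ?P (1 + (1 + (k + k'))) st')"
    have fin: "wp (11 ::= Read 3 (Reg 12)) (?rs', ?as(4 := ?os2)) (\<lambda>k'. \<lambda>st'. ?P (1 + (1 + (k + k'))) st')" if "k \<le> 6" for k
      using st chs nxb inv' that hq os unfolding st_eq
      by (intro wp_Assign) (auto simp: search_state_def nth_append intro!: exI[of _ "q @ [tg b]"])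
    show "wp visit_com (?rs, as) (\<lambda>k. ?R (1 + k))"
      unfolding visit_com_def
    proof (rule wp_Seq, rule wp_Write_to[where i = "2 * tg b" and x = "Suc (?os ! (2 * ?x))" and ys = ?os1],
        rule wp_Seq, rule wp_Write_to[where i = "length q" and x = "tg b" and ys = "(q @ [tg b]) @ replicate (n - length (q @ [tg b])) 0"],
        rule wp_Seq, rule wp_Assign_to[where x = "Suc (length q)"], rule wp_If)
      assume "val (?rs', ?as) (Reg 10 [=] Reg 4) \<noteq> 0"
      then have xs: "?x = s" using st unfolding st_eq by (simp add: search_state_def split: if_splits)
      show "wp (Write 4 (Const 2 [*] Reg 13 [+] Const 1) (Reg 13)) (?rs', ?as) (\<lambda>k. ?R (1 + (1 + (1 + (1 + (1 + k))))))"
        by (rule wp_Write_to[where i = "Suc (2 * tg b)" and x = "tg b" and ys = ?os2], rule fin)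
          (use xs os tgM in \<open>auto\<close>)
    next
      assume "val (?rs', ?as) (Reg 10 [=] Reg 4) = 0"
      then have xs: "?x \<noteq> s" using st unfolding st_eq by (simp add: search_state_def split: if_splits)
      show "wp (Write 4 (Const 2 [*] Reg 13 [+] Const 1) (Read 4 (Const 2 [*] Reg 10 [+] Const 1))) (?rs', ?as) (\<lambda>k. ?R (1 + (1 + (1 + (1 + (1 + k))))))"
        by (rule wp_Write_to[where i = "Suc (2 * tg b)" and x = "?os ! Suc (2 * ?x)" and ys = ?os2], rule fin)
          (use xs os tgM osM[of "Suc (2 * ?x)"] xne st in \<open>auto simp: st_eq search_state_def\<close>)
    qed (use st os tgM qM qupd new(3) in \<open>auto simp: st_eq search_state_def\<close>)
  qed (use st chs target zlen tgM bM os in \<open>auto simp: st_eq search_state_def\<close>)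
  then show ?thesis by (simp only: st_eq[symmetric])
qed

lemma wp_search:
  assumes lists: "lists_ok (2 * m) hs nx" and st: "search_state hs nx st q P L" and h1: "fst st 8 = 1"
    and post: "\<And>k st'. length (snd st' 4) = 2 * n \<Longrightarrow> certificate (Dof (snd st' 4)) (Sof (snd st' 4)) \<Longrightarrow>
      k \<le> 12 * (n + 2 * m) + 1 \<Longrightarrow> Q k st'"
  shows "wp (While (Reg 11 [+] (Reg 8 [<] Reg 9)) (If (Reg 11) arc_com pop_com)) st Q"
proof (rule wp_While[where I = "\<lambda>st. \<exists>q P L. search_state hs nx st q P L" and \<Phi> = "potential nx"])
  fix st :: state assume bd: "bounded_state M st" and "\<exists>q P L. search_state hs nx st q P L"
    and v: "val st (Reg 11 [+] (Reg 8 [<] Reg 9)) \<noteq> 0"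
  then obtain q P L where st: "search_state hs nx st q P L" by blast
  then have inv: "inv (fst st 8) q (Dof (snd st 4)) (Sof (snd st 4)) P L" by (simp add: search_state_def)
  note pot = potential_eq[OF st]
  let ?Q = "\<lambda>k st'. (\<exists>q P L. search_state hs nx st' q P L) \<and> k + 1 + potential nx st' \<le> potential nx st"
  show "wp (com.If (Reg 11) arc_com pop_com) st ?Q"
  proof (rule wp_If)
    assume "val st (Reg 11) \<noteq> 0"
    then obtain b L' where L: "L = b # L'" using st by (cases L) (auto simp: search_state_def)
    show "wp arc_com st (\<lambda>k. ?Q (1 + k))"
    proof (rule wp_conseq[OF wp_arc[OF lists st[unfolded L] bd]])
      fix k :: nat and st' :: state assume *: "k \<le> 9 \<and> fst st' 8 = fst st 8 \<and> (\<exists>q'. search_state hs nx st' q' (P @ [b]) L' \<and> (q' = q \<or> q' = q @ [tg b]))"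
      then obtain r where r: "search_state hs nx st' (q @ r) (P @ [b]) L'" by (metis append_Nil2)
      have "fst st 8 \<le> length q" using inv by (simp add: inv_def)
      then have "potential nx st' + 12 = potential nx st"
        unfolding pot potential_eq[OF r] using * L by (simp add: unseen_append)
      then show "?Q (1 + k) st'" using * r by auto
    qed
  next
    assume "val st (Reg 11) = 0"
    then have L: "L = []" using st by (cases L) (auto simp: search_state_def)
    have h: "fst st 8 < length q" using v \<open>val st (Reg 11) = 0\<close> st by (auto simp: search_state_def split: if_splits)
    have "length q \<le> n"
      using inv card_mono[of "{..<n}" "set q"] by (simp add: inv_def distinct_card)
    then have "n - fst st 8 = Suc (n - Suc (fst st 8))" using h by simp
    then have p: "potential nx st' + 12 = potential nx st"
      if "search_state hs nx st' q [] (al (q ! fst st 8))" "fst st' 8 = Suc (fst st 8)" for st'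
      unfolding pot potential_eq[OF that(1)] that(2) using L unseen_Suc[OF inv h] by simp
    show "wp pop_com st (\<lambda>k. ?Q (1 + k))"
      by (rule wp_conseq[OF wp_pop[OF lists st[unfolded L] h bd]]) (use p in fastforce)
  qed auto
next
  fix k :: nat and st' :: state assume "\<exists>q P L. search_state hs nx st' q P L"
    and v: "val st' (Reg 11 [+] (Reg 8 [<] Reg 9)) = 0" and k: "k + potential nx st' \<le> potential nx st + 1"
  then obtain q' P' L' where st': "search_state hs nx st' q' P' L'" by blast
  have L: "L' = []" using v st' by (cases L') (auto simp: search_state_def)
  have inv: "inv (fst st' 8) q' (Dof (snd st' 4)) (Sof (snd st' 4)) P' []"
    using st' L by (simp add: search_state_def)
  moreover have "fst st' 8 = length q'"
    using v st' inv by (auto simp: search_state_def inv_def split: if_splits)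
  ultimately have c: "certificate (Dof (snd st' 4)) (Sof (snd st' 4))" by (rule inv_certificate)
  have inv0: "inv 1 q (Dof (snd st 4)) (Sof (snd st 4)) P L" using st h1 by (simp add: search_state_def)
  have "length L \<le> length (al (q ! 0))" using inv0 by (simp add: inv_def)
  moreover have "0 < length q" using inv0 by (auto simp: inv_def)
  moreover have "unseen 1 q + length (al (q ! 0)) \<le> 2 * m"
  proof -
    have "q ! 0 \<in> set q" "set q \<subseteq> {..<n}" using inv0 \<open>0 < length q\<close> by (auto simp: inv_def)
    then have "q ! 0 < n" by auto
    then have "length (al (q ! 0)) \<le> (\<Sum>x<n. length (al x))" by (intro member_le_sum) auto
    then show ?thesis using sum_arcs[of "2 * m"] by (simp add: unseen_def)
  qed
  ultimately have "potential nx st \<le> 12 * (n + 2 * m)"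
    unfolding potential_eq[OF st] h1 by simp
  then show "Q k st'" using post c st' k by (simp add: search_state_def)
qed (use st in \<open>auto\<close>)

lemma bfs_correct:
  "computes W bfs_com zs (20 * n + 40 * m + 30)
    (\<lambda>os. length os = 2 * n \<and> certificate (Dof os) (Sof os) \<and> (\<forall>z\<in>set os. z \<le> M))"
proof (rule computesI)
  let ?Q = "\<lambda>k st. k \<le> 20 * n + 40 * m + 30 \<and> (length (result st) = 2 * n \<and>
    certificate (Dof (result st)) (Sof (result st)) \<and> (\<forall>z\<in>set (result st). z \<le> M))"
  let ?w = "While (Reg 11 [+] (Reg 8 [<] Reg 9)) (If (Reg 11) arc_com pop_com) ;; Call 0 skip_com 4"
  let ?c2 = "Write 4 (Const 2 [*] Reg 4) (Const 1) ;; Write 5 (Const 0) (Reg 4) ;;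
     8 ::= Const 1 ;; 9 ::= Const 1 ;; 10 ::= Reg 4 ;; 11 ::= Read 2 (Reg 4) ;; ?w"
  let ?b1 = "com.If (Read 0 (Const 5 [+] Const 3 [*] Reg 6))
         (7 ::= Read 0 (Const 3 [+] Const 3 [*] Reg 6) ;;
          Write 3 (Const 2 [*] Reg 6) (Read 2 (Reg 7)) ;;
          Write 2 (Reg 7) (Const 2 [*] Reg 6 [+] Const 1) ;;
          7 ::= Read 0 (Const 4 [+] Const 3 [*] Reg 6) ;;
          Write 3 (Const 2 [*] Reg 6 [+] Const 1) (Read 2 (Reg 7)) ;;
          Write 2 (Reg 7) (Const 2 [*] Reg 6 [+] Const 2))
         skip_com"
  let ?c1 = "For 6 (Const 0) (Reg 3) ?b1 ;; ?c2"
  let ?base = "\<lambda>st :: state. snd st 0 = zs \<and> fst st 2 = n \<and> fst st 3 = m \<and> fst st 4 = s \<and>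
    snd st 4 = replicate (2 * n) 0 \<and> snd st 5 = replicate n 0"
  have sM: "s \<le> M" "1 \<le> M" "n \<le> M" "m \<le> M" "2 * s < 2 * n" using nodes bounds by auto
  have w: "wp ?w st (\<lambda>k. ?Q (t + k))"
    if lists: "lists_ok (2 * m) hs nx" and st: "search_state hs nx st q P L" "fst st 8 = 1"
      and t: "t \<le> 4 * n + 12 * m + 20" for st hs nx q P L t
  proof (rule wp_Seq, rule wp_conseq[where Q = "\<lambda>k st. length (snd st 4) = 2 * n \<and> certificate (Dof (snd st 4)) (Sof (snd st 4)) \<and> k \<le> 12 * (n + 2 * m) + 1"],
      rule wp_search[OF lists st], blast)
    fix k :: nat and st' :: state assume bd: "bounded_state M st'"
      and *: "length (snd st' 4) = 2 * n \<and> certificate (Dof (snd st' 4)) (Sof (snd st' 4)) \<and> k \<le> 12 * (n + 2 * m) + 1"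
    have el: "\<forall>z\<in>set (snd st' 4). z \<le> M" using bd by (simp add: bounded_state_def)
    show "wp (Call 0 skip_com 4) st' (\<lambda>k'. ?Q (t + (k + k')))"
      by (rule wp_Call[OF computes_skip]) (use * el t bounds in auto)
  qed
  have c2: "wp ?c2 st (\<lambda>k. ?Q (t + k))"
    if lists: "lists_ok (2 * m) (snd st 2) (snd st 3)" and st: "?base st" and bd: "bounded_state M st"
      and t: "t \<le> 4 * n + 12 * m + 14" for st t
  proof -
    obtain rs as where st_eq: "st = (rs, as)" by (cases st)
    let ?os = "(replicate (2 * n) 0)[2 * s := 1 :: nat]"
    let ?q = "[s] @ replicate (n - 1) 0"
    let ?st = "(rs(8 := 1, 9 := 1, 10 := s, 11 := as 2 ! s), as(4 := ?os, 5 := ?q))"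
    have hs: "length (as 2) = n" "chain (as 3) (as 2 ! s) (al s)" using lists nodes by (auto simp: lists_ok_def st_eq)
    have "as 2 ! s \<le> M" using bounded_nth[OF bd, of s 2] hs nodes by (simp add: st_eq)
    have rep: "replicate n (0::nat) = 0 # replicate (n - 1) 0"
      using nodes(1) by (cases n) auto
    have D: "inv 1 [s] (Dof ?os) (Sof ?os) [] (al s)"
    proof -
      have "\<forall>x<n. Dof ?os x = (if x = s then 1 else 0)" by (auto simp: nth_list_update)
      then show ?thesis using nodes(1) by (auto simp: inv_def)
    qed
    have ss: "search_state (as 2) (as 3) ?st [s] [] (al s)"
      unfolding search_state_def using st hs D by (simp add: st_eq)
    have "wp ?w ?st (\<lambda>k. ?Q ((t + 6) + k))"
      using w[OF _ ss, of "t + 6"] lists t by (simp add: st_eq)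
    then have ww: "wp ?w ?st (\<lambda>k. ?Q (t + (1 + (1 + (1 + (1 + (1 + (1 + k))))))))"
      by (rule wp_conseq) auto
    show ?thesis
      unfolding st_eq
      by (rule wp_Seq, rule wp_Write_to[where i = "2 * s" and x = 1 and ys = ?os],
        rule wp_Seq, rule wp_Write_to[where i = 0 and x = s and ys = ?q],
        rule wp_Seq, rule wp_Assign_to[where x = 1], rule wp_Seq, rule wp_Assign_to[where x = 1],
        rule wp_Seq, rule wp_Assign_to[where x = s], rule wp_Seq, rule wp_Assign_to[where x = "as 2 ! s"],
        rule ww)
       (use st sM rep hs nodes \<open>as 2 ! s \<le> M\<close> in \<open>auto simp: st_eq\<close>)
  qed
  have c1: "wp ?c1 st (\<lambda>k. ?Q (t + k))"
    if st: "?base st" "snd st 2 = replicate n 0" "snd st 3 = replicate (2 * m) 0"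
      and t: "t \<le> 4 * n + 2 * m + 10" for st t
  proof (rule wp_Seq, rule wp_For[where a = 0 and n = m and b = 7 and
      I = "\<lambda>j st. ?base st \<and> lists_ok (2 * j) (snd st 2) (snd st 3)"])
    fix j :: nat and st :: state
    assume bd: "bounded_state M st" and *: "?base st \<and> lists_ok (2 * j) (snd st 2) (snd st 3)" "fst st 6 = j" "j < m"
    obtain rs as where st_eq: "st = (rs, as)" by (cases st)
    let ?P = "\<lambda>k st'. k \<le> 7 \<and> fst st' 6 = j \<and> ?base ((fst st')(6 := Suc j), snd st') \<and>
      lists_ok (2 * Suc j) (snd ((fst st')(6 := Suc j), snd st') 2) (snd ((fst st')(6 := Suc j), snd st') 3)"
    have "wp ?b1 (rs, as) ?P"
    proof (rule wp_If)
      assume "val (rs, as) (Read 0 (Const 5 [+] Const 3 [*] Reg 6)) \<noteq> 0"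
      then have "\<not> dead j" using * edge[OF *(3)] by (simp add: st_eq)
      note ok = lists_ok_edge[OF conjunct2[OF *(1)] *(3) this, unfolded st_eq snd_conv]
      have len2: "length (as 2) = n" "length (as 3) = 2 * m" using * by (auto simp: st_eq lists_ok_def)
      have uv: "u j < n" "v j < n" using nodes(2)[OF *(3)] by auto
      have hM: "as 2 ! u j \<le> M" using bounded_nth[OF bd, of "u j" 2] len2 uv by (simp add: st_eq)
      have hM': "(as 2)[u j := Suc (2 * j)] ! v j \<le> M"
        using bounded_nth[OF bd, of "v j" 2] len2 uv bounds *(3) by (auto simp: st_eq nth_list_update)
      show "wp (7 ::= Read 0 (Const 3 [+] Const 3 [*] Reg 6) ;;
          Write 3 (Const 2 [*] Reg 6) (Read 2 (Reg 7)) ;;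
          Write 2 (Reg 7) (Const 2 [*] Reg 6 [+] Const 1) ;;
          7 ::= Read 0 (Const 4 [+] Const 3 [*] Reg 6) ;;
          Write 3 (Const 2 [*] Reg 6 [+] Const 1) (Read 2 (Reg 7)) ;;
          Write 2 (Reg 7) (Const 2 [*] Reg 6 [+] Const 2)) (rs, as) (\<lambda>k. ?P (1 + k))"
        by (rule wp_Seq, rule wp_Assign_to[where x = "u j"],
          rule wp_Seq, rule wp_Write_to[where i = "2 * j" and x = "as 2 ! u j" and ys = "(as 3)[2 * j := as 2 ! u j]"],
          rule wp_Seq, rule wp_Write_to[where i = "u j" and x = "Suc (2 * j)" and ys = "(as 2)[u j := Suc (2 * j)]"],
          rule wp_Seq, rule wp_Assign_to[where x = "v j"],
          rule wp_Seq, rule wp_Write_to[where i = "Suc (2 * j)" and x = "(as 2)[u j := Suc (2 * j)] ! v j" and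
            ys = "((as 3)[2 * j := as 2 ! u j])[Suc (2 * j) := (as 2)[u j := Suc (2 * j)] ! v j]"],
          rule wp_Write_to[where i = "v j" and x = "Suc (Suc (2 * j))" and ys = "((as 2)[u j := Suc (2 * j)])[v j := Suc (Suc (2 * j))]"])
         (use * ok edge[OF *(3)] len len2 uv hM hM' bounds in \<open>auto simp: st_eq\<close>)
    next
      assume "val (rs, as) (Read 0 (Const 5 [+] Const 3 [*] Reg 6)) = 0"
      then have "dead j" using * edge[OF *(3)] by (simp add: st_eq)
      then show "wp skip_com (rs, as) (\<lambda>k. ?P (1 + k))"
        using * lists_ok_edge_skip by (intro wp_Assign) (auto simp: st_eq)
    qed (use * len in \<open>auto simp: st_eq\<close>)
    then show "wp ?b1 st ?P" by (simp only: st_eq)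
  next
    fix k :: nat and st :: state
    assume bd: "bounded_state M st" and *: "?base st \<and> lists_ok (2 * m) (snd st 2) (snd st 3)"
      and k: "k \<le> (7 + 2) * (m - 0) + 2"
    have "wp ?c2 st (\<lambda>k'. ?Q ((t + k) + k'))"
      using * bd t k by (intro c2) auto
    then show "wp ?c2 st (\<lambda>k'. ?Q (t + (k + k')))" by (simp add: add.assoc)
  qed (use st lists_ok_0 sM in auto)
  show "wp bfs_com (init zs) ?Q"
    unfolding bfs_com_def init_def
    apply (rule wp_Seq, rule wp_Assign_to[where x = n])
    apply (rule wp_Seq, rule wp_Assign_to[where x = m])
    apply (rule wp_Seq, rule wp_Assign_to[where x = s])
    apply (rule wp_Seq, rule wp_New_to[where k = n])
    apply (rule wp_Seq, rule wp_New_to[where k = "2 * m"])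
    apply (rule wp_Seq, rule wp_New_to[where k = "2 * n"])
    apply (rule wp_Seq, rule wp_New_to[where k = n])
    apply (rule wp_conseq[OF c1[where t = "4 * n + 2 * m + 7"]])
    using sM hd len bounds by auto
  show "length zs \<le> M" using len bounds by simp
  show "\<forall>z\<in>set zs. z \<le> M" by (rule bounds(3))
qed

section \<open>Consequences of the certificate for paths\<close>

definition live :: "nat set set" where
  "live = {{u i, v i} | i. i < m \<and> \<not> dead i}"

lemma arc_iff: "(\<exists>b\<in>set (al x). tg b = y) \<longleftrightarrow> {x, y} \<in> live"
proof
  assume "\<exists>b\<in>set (al x). tg b = y"
  then obtain b where "b < 2 * m" "\<not> dead (b div 2)" "tail b = x" "tg b = y" by (auto simp: arcs_def)
  then show "{x, y} \<in> live"
    unfolding live_def tail_def tg_def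
    by (intro CollectI exI[of _ "b div 2"]) (auto split: if_splits)
next
  assume "{x, y} \<in> live"
  then obtain i where i: "i < m" "\<not> dead i" "{x, y} = {u i, v i}" by (auto simp: live_def)
  then consider "x = u i" "y = v i" | "x = v i" "y = u i" by (auto simp: doubleton_eq_iff)
  then show "\<exists>b\<in>set (al x). tg b = y"
  proof cases
    case 1
    then show ?thesis using i by (intro bexI[of _ "2 * i"]) (auto simp: arcs_def tail_def tg_def)
  next
    case 2
    then show ?thesis using i by (intro bexI[of _ "Suc (2 * i)"]) (auto simp: arcs_def tail_def tg_def)
  qed
qed

lemma live_nodes: "{x, y} \<in> live \<Longrightarrow> x < n \<and> y < n"
  using nodes(2) by (fastforce simp: live_def doubleton_eq_iff)

context
  fixes D S assumes cert: "certificate D S"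
begin

lemma cert_edge:
  assumes "{x, y} \<in> live" "D x \<noteq> 0"
  shows "D y \<noteq> 0" "D y \<le> D x + 1"
proof -
  obtain b where b: "b \<in> set (al x)" "tg b = y" using arc_iff assms(1) by blast
  then have "relaxed D x b" using cert assms(2) live_nodes[OF assms(1)] unfolding certificate_def by blast
  then show "D y \<noteq> 0" "D y \<le> D x + 1" using b by (auto simp: relaxed_def)
qed

text \<open>A walk has one node more than edges, hence the offset 1.\<close>

lemma cert_walk:
  assumes "walk live x y \<pi>" "D x \<noteq> 0"
  shows "D y \<noteq> 0 \<and> D y + 1 \<le> D x + length \<pi>"
  using assms
proof (induction \<pi> arbitrary: x rule: induct_list012)
  case (3 a b \<pi>)
  then have "{x, b} \<in> live" "walk live b y (b # \<pi>)" "a = x" by (auto simp: walk_def)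
  then show ?case using 3(2)[of b] cert_edge[of x b] 3(4) by auto
qed (auto simp: walk_def)

lemma cert_parent:
  assumes "y < n" "D y \<noteq> 0" "y \<noteq> s"
  shows "(D y = 2 \<and> S y = y \<and> {s, y} \<in> live) \<or>
     (\<exists>x<n. x \<noteq> s \<and> D x \<noteq> 0 \<and> D y = D x + 1 \<and> S y = S x \<and> {x, y} \<in> live)"
  using assms cert unfolding certificate_def parent_def arc_iff by blast

text \<open>A parent lies one level lower and has the same label, so following parents ends at the
  root \<open>S y\<close> of the branch without meeting \<open>s\<close>.\<close>

lemma cert_branch:
  assumes "y < n" "D y \<noteq> 0" "y \<noteq> s"
  shows "\<exists>\<pi>. walk live (S y) y \<pi> \<and> length \<pi> + 1 = D y \<and> s \<notin> set \<pi> \<and> {s, S y} \<in> live"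
  using assms
proof (induction "D y" arbitrary: y rule: less_induct)
  case less
  from cert_parent[OF less(2-4)] show ?case
  proof
    assume "D y = 2 \<and> S y = y \<and> {s, y} \<in> live"
    then show ?thesis using less(4) by (intro exI[of _ "[y]"]) (auto simp: walk_def)
  next
    assume "\<exists>x<n. x \<noteq> s \<and> D x \<noteq> 0 \<and> D y = D x + 1 \<and> S y = S x \<and> {x, y} \<in> live"
    then obtain x where x: "x < n" "x \<noteq> s" "D x \<noteq> 0" "D y = D x + 1" "S y = S x" "{x, y} \<in> live" by blast
    then obtain \<pi> where \<pi>: "walk live (S x) x \<pi>" "length \<pi> + 1 = D x" "s \<notin> set \<pi>" "{s, S x} \<in> live"
      using less(1)[of x] by auto
    have "walk live x y [x, y]" using x(6) by (simp add: walk_def)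
    from walk_append(1)[OF \<pi>(1) this] show ?thesis
      using \<pi> x less(4) by (intro exI[of _ "\<pi> @ [y]"]) auto
  qed
qed

lemma cert_path:
  assumes "y < n" "D y \<noteq> 0"
  shows "\<exists>\<pi>. walk live s y \<pi> \<and> length \<pi> = D y"
proof (cases "y = s")
  case True
  then show ?thesis using cert by (intro exI[of _ "[s]"]) (auto simp: walk_def certificate_def)
next
  case False
  then obtain \<pi> where \<pi>: "walk live (S y) y \<pi>" "length \<pi> + 1 = D y" "{s, S y} \<in> live"
    using cert_branch[OF assms] by blast
  have "walk live s (S y) [s, S y]" using \<pi>(3) by (simp add: walk_def)
  from walk_append(1)[OF this \<pi>(1)] show ?thesis
    using \<pi> by (intro exI[of _ "[s, S y] @ tl \<pi>"]) (auto simp: walk_def)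
qed

text \<open>Only \<open>s\<close> has level 1, so a neighbour of \<open>s\<close> has level 2, and a
  node of level 2 can only be a child of \<open>s\<close>.\<close>

lemma cert_neighbour:
  assumes "{s, y} \<in> live" "y \<noteq> s"
  shows "D y = 2" "S y = y"
proof -
  have s: "D s = 1" using cert by (simp add: certificate_def)
  have y: "y < n" "D y \<noteq> 0" "D y \<le> 2" using live_nodes[OF assms(1)] cert_edge[OF assms(1)] s by auto
  have two: "2 \<le> D x" if "x < n" "D x \<noteq> 0" "x \<noteq> s" for x
    using cert_parent[OF that] by auto
  show "D y = 2" using two[OF y(1,2) assms(2)] y(3) by simp
  then show "S y = y" using cert_parent[OF y(1,2) assms(2)] two by fastforce
qed

text \<open>All neighbours of \<open>s\<close> are roots of branches. A path to \<open>w\<close>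
  that avoids the edge \<open>{s, w}\<close> starts in another branch and enters that of
  \<open>w\<close> through some \<open>{x, y}\<close>; \<open>cert_walk\<close> bounds both parts
  from below. Conversely, the branch paths of \<open>x\<close> and \<open>y\<close> joined by
  \<open>{x, y}\<close> avoid \<open>{s, w}\<close>. Such a walk has \<open>D x - 1\<close> edges up
  to \<open>x\<close>, one edge to \<open>y\<close> and \<open>D y - 2\<close> edges on to
  \<open>w\<close>.\<close>

lemma cert_alternative:
  assumes w: "{s, w} \<in> live" "w \<noteq> s"
  shows "(\<exists>\<pi>. simple_path (live - {{s, w}}) s w \<pi> \<and> length \<pi> \<le> k + 1) \<longleftrightarrow>
    (\<exists>x y. {x, y} \<in> live \<and> x \<noteq> s \<and> y \<noteq> s \<and> D x \<noteq> 0 \<and> S x \<noteq> w \<and> S y = w \<and> D x + D y \<le> k + 2)"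
proof
  assume "\<exists>\<pi>. simple_path (live - {{s, w}}) s w \<pi> \<and> length \<pi> \<le> k + 1"
  then obtain \<pi> where \<pi>: "simple_path (live - {{s, w}}) s w \<pi>" "length \<pi> \<le> k + 1" by blast
  then obtain \<pi>1 where 1: "\<pi> = s # \<pi>1" "s \<notin> set \<pi>1" "distinct \<pi>1"
    unfolding simple_path_def by (metis distinct.simps(2) list.collapse)
  obtain a \<pi>2 where 2: "\<pi>1 = a # \<pi>2" using \<pi>(1) 1 w(2) by (cases \<pi>1) (auto simp: simple_path_def)
  have a: "{s, a} \<in> live" "a \<noteq> w" "a \<noteq> s" using \<pi>(1) 1 2 by (auto simp: simple_path_def)
  have walk1: "walk live a w \<pi>1" using \<pi>(1) 1 2 by (auto simp: simple_path_def walk_def)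
  have Sa: "S a \<noteq> w" "D a = 2" and Sw: "S w = w" "D w = 2"
    using cert_neighbour[OF a(1,3)] cert_neighbour[OF w] a(2) by auto
  \<comment> \<open>A discrete intermediate value argument: somewhere along the path the label
    changes to \<open>w\<close>.\<close>
  have "\<exists>xs x y ys. \<rho> = xs @ x # y # ys \<and> S x \<noteq> w \<and> S y = w"
    if "\<rho> \<noteq> []" "S (hd \<rho>) \<noteq> w" "S (last \<rho>) = w" for \<rho> :: "nat list"
    using that
  proof (induction \<rho> rule: induct_list012)
    case (3 x y zs)
    show ?case
    proof (cases "S y = w")
      case True
      then show ?thesis using 3 by (intro exI[of _ "[]"]) auto
    next
      case False
      then obtain xs x' y' ys where "y # zs = xs @ x' # y' # ys" "S x' \<noteq> w" "S y' = w" using 3 by fastforce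
      then show ?thesis by (intro exI[of _ "x # xs"] exI[of _ x'] exI[of _ y'] exI[of _ ys]) auto
    qed
  qed auto
  then obtain xs x y ys where xy: "\<pi>1 = xs @ x # y # ys" "S x \<noteq> w" "S y = w"
    using walk1 Sa(1) Sw(1) unfolding walk_def by metis
  have pe: "path_edges \<pi>1 = path_edges (xs @ [x]) @ {x, y} # path_edges (y # ys)"
    unfolding xy(1) by (subst path_edges_append) simp
  have wx: "walk live a x (xs @ [x])" and wy: "walk live y w (y # ys)" and e: "{x, y} \<in> live"
    using walk1 pe xy(1) by (auto simp: walk_def hd_append split: if_splits)
  have "D x \<noteq> 0 \<and> D x + 1 \<le> D a + length (xs @ [x])" using cert_walk[OF wx] Sa(2) by simp
  moreover have "D y + 1 \<le> D w + length (y # ys)"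
    using cert_walk[OF walk_rev[OF wy]] Sw(2) by simp
  ultimately have "D x \<noteq> 0" "D x + D y \<le> k + 2"
    using Sa(2) Sw(2) \<pi>(2) 1(1) xy(1) by auto
  then show "\<exists>x y. {x, y} \<in> live \<and> x \<noteq> s \<and> y \<noteq> s \<and> D x \<noteq> 0 \<and> S x \<noteq> w \<and> S y = w \<and> D x + D y \<le> k + 2"
    using e xy 1(2) by (intro exI[of _ x] exI[of _ y]) auto
next
  assume "\<exists>x y. {x, y} \<in> live \<and> x \<noteq> s \<and> y \<noteq> s \<and> D x \<noteq> 0 \<and> S x \<noteq> w \<and> S y = w \<and> D x + D y \<le> k + 2"
  then obtain x y where xy: "{x, y} \<in> live" "x \<noteq> s" "y \<noteq> s" "D x \<noteq> 0" "S x \<noteq> w" "S y = w" "D x + D y \<le> k + 2"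
    by blast
  have n: "x < n" "y < n" using live_nodes[OF xy(1)] by auto
  have Dy: "D y \<noteq> 0" using cert_edge[OF xy(1,4)] by simp
  obtain p where p: "walk live (S x) x p" "length p + 1 = D x" "s \<notin> set p" "{s, S x} \<in> live"
    using cert_branch[OF n(1) xy(4,2)] by blast
  obtain r where r: "walk live w y r" "length r + 1 = D y" "s \<notin> set r"
    using cert_branch[OF n(2) Dy xy(3)] xy(6) by blast
  have sub: "e \<subseteq> set t" if "e \<in> set (path_edges t)" for e t
    using that by (induction t rule: induct_list012) auto
  let ?E = "live - {{s, w}}"
  \<comment> \<open>A walk that misses \<open>s\<close> cannot contain the edge
    \<open>{s, w}\<close>.\<close>
  have avoid: "walk ?E a b t" if "walk live a b t" "s \<notin> set t" for a b t
    using that sub unfolding walk_def by blast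
  have "walk ?E s (S x) [s, S x]" using p(4) xy(5) by (auto simp: walk_def doubleton_eq_iff)
  note w1 = walk_append[OF this avoid[OF p(1,3)]]
  have "walk ?E x y [x, y]" using xy(1-3) by (auto simp: walk_def doubleton_eq_iff)
  note w2 = walk_append[OF w1(1) this]
  note w3 = walk_append[OF w2(1) walk_rev[OF avoid[OF r(1,3)]]]
  obtain \<pi> where \<pi>: "simple_path ?E s w \<pi>" "length \<pi> \<le> length ((([s, S x] @ tl p) @ tl [x, y]) @ tl (rev r))"
    using walk_imp_simple_path[OF w3(1)] by metis
  have "p \<noteq> []" "r \<noteq> []" using p r by (auto simp: walk_def)
  then have "length ((([s, S x] @ tl p) @ tl [x, y]) @ tl (rev r)) = 1 + length p + length r"
    by (cases p) auto
  then have "length \<pi> \<le> k + 1" using \<pi>(2) p(2) r(2) xy(7) by linarith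
  then show "\<exists>\<pi>. simple_path ?E s w \<pi> \<and> length \<pi> \<le> k + 1" using \<pi>(1) by blast
qed

end

end

section \<open>Basic instances\<close>

text \<open>In a basic instance the ends of an edge have distance 1, so the budget is just
  \<open>num\<close>. Register 8 is a distance shifted by one; its value 0 means that the ends are
  separated, and the answer stays 0.\<close>

definition bfs_check_com :: com where
  "bfs_check_com = (
     2 ::= Read 0 (Const 1) ;;
     3 ::= Const 5 [+] Const 3 [*] Read 0 (Len 0 [-] Const 1) ;;
     4 ::= Read 0 (Const 3) ;; 5 ::= Read 0 (Const 4) ;;
     New 2 (Const 3 [+] Const 3 [*] Reg 2) ;;
     Write 2 (Const 0) (Read 0 (Const 0)) ;; Write 2 (Const 1) (Reg 2) ;;
     Write 2 (Const 2) (Read 0 (Reg 3)) ;;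
     For 6 (Const 3) (Len 2) (Write 2 (Reg 6) (Read 0 (Reg 6 [+] Const 2))) ;;
     For 6 (Const 0) (Reg 2)
       (If (Read 0 (Const 5 [+] Const 3 [*] Reg 2 [+] Reg 6))
         (Write 2 (Const 5 [+] Const 3 [*] Reg 6) (Const 0)) skip_com) ;;
     Call 3 bfs_com 2 ;;
     8 ::= Read 3 (Const 2 [*] Read 0 (Reg 3 [+] Const 1)) ;;
     New 0 (Const 1) ;;
     If (Reg 8)
       (If (Reg 4 [<] Reg 5 [*] (Reg 8 [-] Const 1)) skip_com (Write 0 (Const 0) (Const 1))) skip_com)"

text \<open>The search from \<open>s\<close> decides the edges listed with first endpoint
  \<open>s\<close>, so every edge is decided once. Each search is accompanied by a constant number
  of passes over the edge list, which keeps the total time within \<open>n * (n + m)\<close> up to a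
  constant.\<close>

definition bfs_flags_com :: com where
  "bfs_flags_com = (
     2 ::= Read 0 (Const 1) ;; 3 ::= Read 0 (Const 0) ;; 4 ::= Read 0 (Const 3) ;; 5 ::= Read 0 (Const 4) ;;
     New 2 (Const 3 [+] Const 3 [*] Reg 2) ;;
     Write 2 (Const 0) (Reg 3) ;; Write 2 (Const 1) (Reg 2) ;;
     For 6 (Const 3) (Len 2) (Write 2 (Reg 6) (Read 0 (Reg 6 [+] Const 2))) ;;
     New 3 (Reg 2) ;;
     For 7 (Const 0) (Reg 3) (
       Write 2 (Const 2) (Reg 7) ;;
       Call 4 bfs_com 2 ;;
       New 5 (Reg 3) ;;
       For 6 (Const 0) (Reg 2) (
         8 ::= Read 0 (Const 5 [+] Const 3 [*] Reg 6) ;;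
         9 ::= Read 0 (Const 6 [+] Const 3 [*] Reg 6) ;;
         If (Reg 8 [=] Reg 7) skip_com (
         If (Reg 9 [=] Reg 7) skip_com (
           10 ::= Read 4 (Const 2 [*] Reg 8 [+] Const 1) ;;
           11 ::= Read 4 (Const 2 [*] Reg 9 [+] Const 1) ;;
           If (Reg 10 [=] Reg 11) skip_com (
           If (Reg 4 [<] Reg 5 [*] (Read 4 (Const 2 [*] Reg 8) [+] Read 4 (Const 2 [*] Reg 9) [-] Const 2)) skip_com
             (Write 5 (Reg 10) (Const 1) ;; Write 5 (Reg 11) (Const 1)))))) ;;
       For 6 (Const 0) (Reg 2)
         (If (Read 0 (Const 5 [+] Const 3 [*] Reg 6) [=] Reg 7)
           (Write 3 (Reg 6) (Read 5 (Read 0 (Const 6 [+] Const 3 [*] Reg 6)))) skip_com)) ;;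
     Call 0 skip_com 3)"

locale basic = coded +
  fixes W :: nat
  assumes basic: "basic_inst I"
    and W: "(wmax + 2) ^ 12 \<le> W"
begin

sublocale machine wmax W
  by standard (rule W)

lemma l_1: "e \<in> E \<Longrightarrow> l e = 1"
  using basic by (simp add: basic_inst_def)

lemma path_length_eq:
  assumes "simple_path F u v \<pi>" "F \<subseteq> E"
  shows "path_length l \<pi> = length \<pi> - 1"
proof -
  have "path_length l \<pi> = path_length (\<lambda>_. 1) \<pi>"
    using assms l_1 by (intro path_length_cong) (auto simp: simple_path_def)
  also have "\<dots> = length \<pi> - 1" by (simp add: path_length_def sum_list_triv length_path_edges)
  finally show ?thesis .
qed

lemma d_1:
  assumes "{u, v} \<in> E"
  shows "d u v = 1"
proof -
  note uv = edge_nodes[OF assms]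
  obtain \<pi> where \<pi>: "simple_path E u v \<pi>" "path_length l \<pi> = d u v"
    using nat_dist_attained[OF simple_path_edge[OF uv(3) assms]] by metis
  have "d u v \<noteq> 0"
  proof
    assume "d u v = 0"
    then have "length \<pi> \<le> 1" using \<pi> path_length_eq[OF \<pi>(1)] by simp
    then show False using \<pi>(1) uv(3) by (cases \<pi>) (auto simp: simple_path_def)
  qed
  then show ?thesis using d_edge_le[OF assms] l_1[OF assms] by simp
qed

lemma bypass_basic_iff:
  assumes "{u, v} \<in> E"
  shows "bypass R {u, v} \<longleftrightarrow> (\<exists>\<pi>. simple_path (E - R) u v \<pi> \<and> den * (length \<pi> - 1) \<le> num)"
  unfolding bypass_edge_iff[OF assms] d_1[OF assms] using path_length_eq[of "E - R" u v] by auto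

text \<open>A settling path for an edge has length, and hence number of edges, at most
  \<open>\<alpha>\<close>. This turns a bound in \<open>\<tau>\<close> into one in
  \<open>\<alpha>\<close>.\<close>

lemma tightness_le_alpha: "real (tightness I) \<le> \<alpha>"
proof -
  let ?T = "{card (nontrivial_part I (tightest_path I u v)) |u v. {u, v} \<in> critical_pairs I}"
  have le: "real (card (nontrivial_part I (tightest_path I u v))) \<le> \<alpha>" if C: "{u, v} \<in> critical_pairs I" for u v
  proof -
    have N: "{u, v} \<in> N" using C critical_nontrivial by blast
    then have E: "{u, v} \<in> E" using N_subset by blast
    let ?p = "tightest_path I u v"
    have p: "simple_path E u v ?p" "real (path_length l ?p) \<le> \<alpha>"
      using tightest_path(1)[OF N] settling_iff[OF edge_nodes(1,2)[OF E]] d_1[OF E] by auto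
    have "card (nontrivial_part I ?p) \<le> card (set (path_edges ?p))"
      unfolding nontrivial_part_def by (intro card_mono) auto
    also have "\<dots> \<le> length ?p - 1" using card_length[of "path_edges ?p"] by (simp add: length_path_edges)
    also have "\<dots> = path_length l ?p" using path_length_eq[OF p(1)] by simp
    finally show ?thesis using p(2) by linarith
  qed
  have "?T \<subseteq> (\<lambda>(u, v). card (nontrivial_part I (tightest_path I u v))) ` ({..<n} \<times> {..<n})"
    using edge_nodes by (fastforce simp: critical_iff)
  then have "finite (insert 0 ?T)" using finite_subset by blast
  then have "tightness I \<in> insert 0 ?T" unfolding tightness_def by (intro Max_in) auto
  then show ?thesis using le alpha_ge by auto
qed

definition bzs :: "nat \<Rightarrow> (nat set \<Rightarrow> nat) \<Rightarrow> nat list" where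
  "bzs s l' = [n, m, s] @ edge_code l' es"

lemma length_bzs [simp]: "length (bzs s l') = 3 + 3 * m"
  by (simp add: bzs_def)

lemma nth_bzs: "bzs s l' ! 0 = n" "bzs s l' ! 1 = m" "bzs s l' ! 2 = s"
  by (auto simp: bzs_def)

lemma nth_bzs_code: "bzs s l' ! (3 + i) = edge_code l' es ! i"
  using nth_append_length_plus[of "[n, m, s]" "edge_code l' es" i] by (simp add: bzs_def numeral_eq_Suc)

lemma nth_bzs_edge:
  assumes "i < m"
  shows "bzs s l' ! (3 + 3 * i) = src i" "bzs s l' ! (4 + 3 * i) = tgt i" "bzs s l' ! (5 + 3 * i) = l' (ed i)"
  using nth_edge_code[OF assms, of l'] nth_bzs_code[of s l' "3 * i"] nth_bzs_code[of s l' "Suc (3 * i)"]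
    nth_bzs_code[of s l' "Suc (Suc (3 * i))"]
  by (auto simp: ed_def)

lemma bzs_upd: "j < m \<Longrightarrow> (bzs s l')[5 + 3 * j := x] = bzs s (l'(ed j := x))"
  using edge_code_update[of es j l' x] es by (simp add: bzs_def lists_edges_def ed_def)

lemma bzs_le:
  assumes "s < n" "\<And>e. e \<in> E \<Longrightarrow> l' e \<le> 1"
  shows "\<forall>x\<in>set (bzs s l'). x \<le> wmax"
proof
  fix x assume "x \<in> set (bzs s l')"
  then have "x \<le> size + 1" using edge_list_elems[of l' 1 x] assms size_bounds(1,3) by (auto simp: bzs_def)
  also have "\<dots> \<le> size * size" using size_ge by (cases size) auto
  finally show "x \<le> wmax" using wmax_ge(3) by simp
qed

lemma small: "3 * m + 3 \<le> wmax" "2 * n \<le> wmax"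
proof -
  show "3 * m + 3 \<le> wmax" using size_bounds(2) wmax_ge(2) by simp
  have "2 * n \<le> size * size" using size_bounds(3) size_ge by (intro mult_le_mono) auto
  then show "2 * n \<le> wmax" using wmax_ge(3) by simp
qed

lemma bfs_input:
  assumes "s < n" "\<And>e. e \<in> E \<Longrightarrow> l' e \<le> 1"
  shows "bfs_input wmax W (bzs s l') n m s src tgt (\<lambda>i. l' (ed i) = 0)"
proof
  fix i assume "i < m"
  then show "bzs s l' ! (3 + 3 * i) = src i \<and> bzs s l' ! (4 + 3 * i) = tgt i \<and> (bzs s l' ! (5 + 3 * i) = 0 \<longleftrightarrow> l' (ed i) = 0)"
    "src i < n \<and> tgt i < n"
    using nth_bzs_edge src_tgt by auto
qed (use assms nth_bzs small bzs_le[of s l'] in auto)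

lemma live_eq:
  fixes l' :: "nat set \<Rightarrow> nat"
  assumes "s < n" "\<And>e. e \<in> E \<Longrightarrow> l' e \<le> 1"
  shows "bfs_input.live m src tgt (\<lambda>i. l' (ed i) = 0) = {e \<in> E. l' e \<noteq> 0}"
proof -
  interpret B: bfs_input wmax W "bzs s l'" n m s src tgt "\<lambda>i. l' (ed i) = 0"
    using bfs_input[OF assms] .
  have "B.live = {ed i |i. i < m \<and> l' (ed i) \<noteq> 0}" unfolding B.live_def by (auto simp: ed_def)
  also have "\<dots> = {e \<in> ed ` {..<m}. l' e \<noteq> 0}" by auto
  finally show ?thesis by (simp add: image_ed)
qed

lemma bypass_by_bfs:
  assumes e: "e < m" and A: "A \<subseteq> {..<m}"
    and cert: "bfs_arcs.certificate n (src e)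
      (bfs_input.arcs src tgt (\<lambda>i. (if ed i \<in> ed ` A then 0 else l (ed i)) = 0) (2 * m)) (bfs_input.tg src tgt) D S"
  shows "bypass (ed ` A) (ed e) \<longleftrightarrow> D (tgt e) \<noteq> 0 \<and> den * (D (tgt e) - 1) \<le> num"
proof -
  let ?l' = "\<lambda>e. if e \<in> ed ` A then 0 else l e"
  let ?u = "src e" and ?v = "tgt e"
  have l': "?l' e \<le> 1" if "e \<in> E" for e using l_1[OF that] by simp
  note uv = src_tgt[OF e]
  interpret B: bfs_input wmax W "bzs ?u ?l'" n m ?u src tgt "\<lambda>i. ?l' (ed i) = 0"
    using bfs_input[OF uv(1) l'] .
  have live: "B.live = E - ed ` A"
    using live_eq[OF uv(1), of ?l'] l' l_1 by auto
  have uvE: "{?u, ?v} \<in> E" using ed_in[OF e] by (simp add: ed_def)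
  have Du: "D ?u = 1" using cert by (simp add: B.certificate_def)
  have "bypass (ed ` A) (ed e) \<longleftrightarrow> (\<exists>\<pi>. simple_path B.live ?u ?v \<pi> \<and> den * (length \<pi> - 1) \<le> num)"
    unfolding live using bypass_basic_iff[OF uvE] by (simp add: ed_def)
  also have "\<dots> \<longleftrightarrow> D ?v \<noteq> 0 \<and> den * (D ?v - 1) \<le> num"
  proof
    assume "\<exists>\<pi>. simple_path B.live ?u ?v \<pi> \<and> den * (length \<pi> - 1) \<le> num"
    then obtain \<pi> where \<pi>: "simple_path B.live ?u ?v \<pi>" "den * (length \<pi> - 1) \<le> num" by blast
    then have "D ?v \<noteq> 0 \<and> D ?v + 1 \<le> D ?u + length \<pi>"
      using B.cert_walk[OF cert, of ?u ?v \<pi>] Du by (simp add: simple_path_walk)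
    then have "D ?v \<noteq> 0" "D ?v - 1 \<le> length \<pi> - 1" using Du by auto
    then show "D ?v \<noteq> 0 \<and> den * (D ?v - 1) \<le> num" using \<pi>(2) by (meson le_trans mult_le_mono2)
  next
    assume D: "D ?v \<noteq> 0 \<and> den * (D ?v - 1) \<le> num"
    then obtain \<pi> where \<pi>: "walk B.live ?u ?v \<pi>" "length \<pi> = D ?v" using B.cert_path[OF cert uv(2)] by blast
    obtain \<pi>' where \<pi>': "simple_path B.live ?u ?v \<pi>'" "length \<pi>' \<le> length \<pi>"
      by (rule walk_imp_simple_path[OF \<pi>(1), of l])
    then have "length \<pi>' - 1 \<le> D ?v - 1" using \<pi>(2) by simp
    then have "den * (length \<pi>' - 1) \<le> num" using D by (meson le_trans mult_le_mono2)
    then show "\<exists>\<pi>. simple_path B.live ?u ?v \<pi> \<and> den * (length \<pi> - 1) \<le> num" using \<pi>' by blast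
  qed
  finally show ?thesis .
qed

lemma bfs_check:
  assumes A: "A \<subseteq> {..<m}" and e: "e < m"
  shows "computes W bfs_check_com (xs @ indicator_list m A @ [e]) (24 * n + 80 * m + 80)
    (\<lambda>ys. ys = [if bypass (ed ` A) (ed e) then 1 else 0])"
proof (rule computesI)
  define z where "z = xs @ indicator_list m A @ [e]"
  let ?u = "src e" and ?v = "tgt e"
  define lj where "lj j e = (if \<exists>i<j. i \<in> A \<and> ed i = e then 0 else l e)" for j :: nat and e
  let ?l' = "\<lambda>e. if e \<in> ed ` A then 0 else l e"
  note uv = src_tgt[OF e]
  have l': "?l' e \<le> 1" if "e \<in> E" for e using l_1[OF that] by simp
  interpret B: bfs_input wmax W "bzs ?u ?l'" n m ?u src tgt "\<lambda>i. ?l' (ed i) = 0"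
    using bfs_input[OF uv(1) l'] .
  have len_z: "length z = 6 + 4 * m" by (simp add: z_def)
  have z_nth: "z ! 0 = n" "z ! 1 = m" "z ! Suc 0 = m" "z ! 3 = num" "z ! 4 = den"
    "z ! (5 + 4 * m) = e" "z ! (5 + 3 * e) = ?u" "z ! (6 + 3 * e) = ?v"
    using nth_xs_edge[OF e] e by (auto simp: z_def nth_append)
  have z_code: "z ! (j + 2) = bzs ?u l ! j" if "3 \<le> j" "j < 3 + 3 * m" for j
  proof -
    define i where "i = j - 3"
    have i: "j + 2 = 5 + i" "j = 3 + i" "i < 3 * m" using that by (auto simp: i_def)
    have "z ! (j + 2) = xs ! (5 + i)" unfolding i(1) z_def using i(3) by (simp add: nth_append)
    also have "\<dots> = edge_code l es ! i" by (rule nth_xs_code)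
    also have "\<dots> = bzs ?u l ! j" unfolding i(2) by (rule nth_bzs_code[symmetric])
    finally show ?thesis .
  qed
  have z_rem: "z ! (5 + 3 * m + j) = (if j \<in> A then 1 else 0)" if "j < m" for j
    using that by (simp add: z_def nth_append)
  have lj_Suc: "lj (Suc j) = (if j \<in> A then (lj j)(ed j := 0) else lj j)" for j
    by (auto simp: lj_def less_Suc_eq fun_eq_iff)
  have lj_0: "lj 0 = l" by (auto simp: lj_def fun_eq_iff)
  have lj_m: "lj m = ?l'" using A by (auto simp: lj_def fun_eq_iff)
  have idx: "7 + 3 * e \<le> wmax" "3 + 3 * m \<le> wmax" "m \<le> wmax" "n \<le> wmax" "num \<le> wmax" "den \<le> wmax"
    using e size_bounds wmax_ge(2) by auto
  have uvM: "?u \<le> wmax" "?v \<le> wmax" using uv idx by auto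
  have one: "1 \<le> wmax" "2 \<le> wmax" using size_ge wmax_ge(2) by auto
  have pos: "5 + 3 * e < length z" "Suc (5 + 3 * e) < length z" "length z - 1 = 5 + 4 * m"
    using e len_z by auto
  let ?base = "\<lambda>s :: state. snd s 0 = z \<and> fst s 2 = m \<and> fst s 3 = 5 + 3 * e \<and> fst s 4 = num \<and> fst s 5 = den"
  let ?Q = "\<lambda>k s. k \<le> 24 * n + 80 * m + 80 \<and> result s = [if bypass (ed ` A) (ed e) then 1 else 0]"
  let ?c3 = "Call 3 bfs_com 2 ;;
     8 ::= Read 3 (Const 2 [*] Read 0 (Reg 3 [+] Const 1)) ;;
     New 0 (Const 1) ;;
     com.If (Reg 8)
       (com.If (Reg 4 [<] Reg 5 [*] (Reg 8 [-] Const 1)) skip_com (Write 0 (Const 0) (Const 1))) skip_com"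
  have c3: "wp ?c3 s (\<lambda>k. ?Q (t + k))"
    if s: "?base s" "snd s 2 = bzs ?u ?l'" and t: "t \<le> 20 * m + 30" for s t
  proof (rule wp_Seq, rule wp_Call)
    show "computes W bfs_com (snd s 2) (20 * n + 40 * m + 30) (\<lambda>os. length os = 2 * n \<and>
       B.certificate (\<lambda>x. os ! (2 * x)) (\<lambda>x. os ! Suc (2 * x)) \<and> (\<forall>z\<in>set os. z \<le> wmax))"
      unfolding s(2) by (rule B.bfs_correct)
  next
    fix k :: nat and os :: "nat list"
    assume os: "length os = 2 * n \<and> B.certificate (\<lambda>x. os ! (2 * x)) (\<lambda>x. os ! Suc (2 * x)) \<and> (\<forall>z\<in>set os. z \<le> wmax)"
      and k: "k \<le> 1 + length (snd s 2) + (20 * n + 40 * m + 30) + length os"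
    have byp: "bypass (ed ` A) (ed e) \<longleftrightarrow> os ! (2 * ?v) \<noteq> 0 \<and> den * (os ! (2 * ?v) - 1) \<le> num"
      using bypass_by_bfs[OF e A] os by blast
    have v2: "2 * ?v < length os" using os uv by simp
    then have "os ! (2 * ?v) \<le> wmax" using os by simp
    moreover have "k \<le> 22 * n + 43 * m + 34" using k os s by simp
    ultimately show "wp (8 ::= Read 3 (Const 2 [*] Read 0 (Reg 3 [+] Const 1)) ;;
     New 0 (Const 1) ;;
     com.If (Reg 8)
       (com.If (Reg 4 [<] Reg 5 [*] (Reg 8 [-] Const 1)) skip_com (Write 0 (Const 0) (Const 1))) skip_com)
       (fst s, (snd s)(3 := os)) (\<lambda>k'. ?Q (t + (k + k')))"
      using s t one v2 z_nth pos byp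
      by (intro wp_Seq wp_Assign wp_New wp_If wp_Write) (auto simp: add.commute split: if_splits)
  qed (use small in auto)
  let ?b2 = "com.If (Read 0 (Const 5 [+] Const 3 [*] Reg 2 [+] Reg 6))
         (Write 2 (Const 5 [+] Const 3 [*] Reg 6) (Const 0)) skip_com"
  let ?c2 = "For 6 (Const 0) (Reg 2) ?b2 ;; ?c3"
  have c2: "wp ?c2 s (\<lambda>k. ?Q (t + k))"
    if s: "?base s" "snd s 2 = bzs ?u l" and t: "t \<le> 16 * m + 24" for s t
  proof (rule wp_Seq, rule wp_For[where a = 0 and n = m and b = 2 and
      I = "\<lambda>j s. ?base s \<and> snd s 2 = bzs ?u (lj j)"])
    fix j :: nat and s :: state
    assume *: "?base s \<and> snd s 2 = bzs ?u (lj j)" "fst s 6 = j" "j < m"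
    have "j \<in> A \<Longrightarrow> (bzs ?u (lj j))[5 + 3 * j := 0] = bzs ?u (lj (Suc j))" "j \<notin> A \<Longrightarrow> lj (Suc j) = lj j"
      using bzs_upd[OF *(3)] unfolding lj_Suc by simp_all
    then show "wp ?b2 s (\<lambda>k s'. k \<le> 2 \<and> fst s' 6 = j \<and> ?base ((fst s')(6 := Suc j), snd s') \<and>
       snd ((fst s')(6 := Suc j), snd s') 2 = bzs ?u (lj (Suc j)))"
      using * z_rem[OF *(3)] len_z by (intro wp_If wp_Assign wp_Write) (auto split: if_splits)
  next
    fix k :: nat and s :: state
    assume *: "?base s \<and> snd s 2 = bzs ?u (lj m)" and k: "k \<le> (2 + 2) * (m - 0) + 2"
    have "wp ?c3 s (\<lambda>k'. ?Q ((t + k) + k'))"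
      using * k t lj_m by (intro c3) auto
    then show "wp ?c3 s (\<lambda>k'. ?Q (t + (k + k')))" by (simp add: add.assoc)
  qed (use s idx lj_0 in auto)
  let ?c1 = "For 6 (Const 3) (Len 2) (Write 2 (Reg 6) (Read 0 (Reg 6 [+] Const 2))) ;; ?c2"
  have c1: "wp ?c1 s (\<lambda>k. ?Q (t + k))"
    if s: "?base s" "snd s 2 = [n, m, ?u] @ replicate (3 * m) 0" and t: "t \<le> 3 * m + 14" for s t
  proof (rule wp_Seq, rule wp_copy[where zs = "bzs ?u l"])
    fix k assume k: "k \<le> 3 * (length (bzs ?u l) - 3) + 2"
    let ?s = "((fst s)(6 := length (bzs ?u l)), (snd s)(2 := bzs ?u l))"
    have "wp ?c2 ?s (\<lambda>k'. ?Q ((t + k) + k'))"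
      using s t k by (intro c2) auto
    then show "wp ?c2 ?s (\<lambda>k'. ?Q (t + (k + k')))" by (simp add: add.assoc)
  next
    show "snd s 2 = take 3 (bzs ?u l) @ replicate (length (bzs ?u l) - 3) 0" using s by (simp add: bzs_def)
    show "j + 2 < length (snd s 0) \<and> snd s 0 ! (j + 2) = bzs ?u l ! j" if "3 \<le> j" "j < length (bzs ?u l)" for j
      using that s(1) z_code[of j] len_z by simp
    show "\<forall>x\<in>set (bzs ?u l). x \<le> wmax" using bzs_le[of ?u l, OF uv(1)] l_1 by simp
  qed (use idx in auto)
  have "wp bfs_check_com (init z) ?Q"
    unfolding bfs_check_com_def init_def
    apply (rule wp_Seq, rule wp_Assign_to[where x = m])
    apply (rule wp_Seq, rule wp_Assign_to[where x = "5 + 3 * e"])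
    apply (rule wp_Seq, rule wp_Assign_to[where x = num])
    apply (rule wp_Seq, rule wp_Assign_to[where x = den])
    apply (rule wp_Seq, rule wp_New_to[where k = "3 + 3 * m"])
    apply (rule wp_Seq, rule wp_Write_to[where i = 0 and x = n and ys = "n # replicate (2 + 3 * m) 0"])
    apply (rule wp_Seq, rule wp_Write_to[where i = 1 and x = m and ys = "n # m # replicate (1 + 3 * m) 0"])
    apply (rule wp_Seq, rule wp_Write_to[where i = 2 and x = ?u and ys = "n # m # ?u # replicate (3 * m) 0"])
    apply (rule wp_conseq[OF c1[where t = "3 * m + 11"]])
    using len_z z_nth pos idx uvM one by (simp_all add: numeral_eq_Suc)
  then show "wp bfs_check_com (init (xs @ indicator_list m A @ [e])) ?Q" unfolding z_def .
  have "length z \<le> wmax" using len_z wmax_ge(6) by simp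
  moreover have "x \<le> wmax" if "x \<in> set z" for x
  proof -
    have "x \<in> set xs \<or> x \<le> 1 \<or> x = e" using that by (auto simp: z_def indicator_list_def)
    then show ?thesis using in_xs_less[of x] wmax_ge(2) one e idx by auto
  qed
  ultimately show "length (xs @ indicator_list m A @ [e]) \<le> wmax" "\<forall>x\<in>set (xs @ indicator_list m A @ [e]). x \<le> wmax"
    unfolding z_def by auto
qed

section \<open>Nontrivial edges by breadth-first searches\<close>

definition bflag :: "nat \<Rightarrow> nat" where
  "bflag i = (if ed i \<in> N then 1 else 0)"

lemma valid_bflags: "valid_flags (map bflag [0..<m])"
  by (auto simp: valid_flags_def bflag_def)

text \<open>Edge \<open>i\<close> joins two branches and closes a short cycle through \<open>s\<close>; then both neighbours of \<open>s\<close> on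
  this cycle are marked.\<close>

definition closing :: "nat \<Rightarrow> (nat \<Rightarrow> nat) \<Rightarrow> (nat \<Rightarrow> nat) \<Rightarrow> nat \<Rightarrow> bool" where
  "closing s D S i \<longleftrightarrow> src i \<noteq> s \<and> tgt i \<noteq> s \<and> S (src i) \<noteq> S (tgt i) \<and>
     den * (D (src i) + D (tgt i) - 2) \<le> num"

definition marked :: "nat \<Rightarrow> (nat \<Rightarrow> nat) \<Rightarrow> (nat \<Rightarrow> nat) \<Rightarrow> nat \<Rightarrow> nat set" where
  "marked s D S j = (\<Union>i\<in>{i. i < j \<and> closing s D S i}. {S (src i), S (tgt i)})"

lemma marked_Suc:
  "marked s D S (Suc j) = (if closing s D S j then insert (S (tgt j)) (insert (S (src j)) (marked s D S j)) else marked s D S j)"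
  by (auto simp: marked_def less_Suc_eq)

text \<open>An application of \<open>cert_alternative\<close>. A listed edge may enter the branch of
  the neighbour in either direction, which is why both of its labels get marked.\<close>

lemma nontrivial_by_bfs:
  assumes i: "i < m" "src i = s"
    and cert: "bfs_arcs.certificate n s
      (bfs_input.arcs src tgt (\<lambda>i. l (ed i) = 0) (2 * m)) (bfs_input.tg src tgt) D S"
  shows "ed i \<in> N \<longleftrightarrow> tgt i \<in> marked s D S m"
proof -
  let ?w = "tgt i"
  note uv = src_tgt[OF i(1), unfolded i(2)]
  have l': "l e \<le> 1" if "e \<in> E" for e using l_1[OF that] by simp
  interpret B: bfs_input wmax W "bzs s l" n m s src tgt "\<lambda>i. l (ed i) = 0"
    using bfs_input[of s l, OF uv(1) l'] .
  have live: "B.live = E" using live_eq[of s l, OF uv(1) l'] l_1 by auto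
  have e: "{s, ?w} \<in> E" using ed_in[OF i(1)] i(2) by (simp add: ed_def)
  \<comment> \<open>The largest number of edges on a settling path between adjacent nodes.\<close>
  define k where "k = num div den"
  have den: "0 < den" by (rule q_pos)
  have k: "den * a \<le> num \<longleftrightarrow> a \<le> k" for a
    unfolding k_def using den by (simp add: less_eq_div_iff_mult_less_eq mult.commute)
  have Dn: "D x \<noteq> 0" if x: "x < n" for x
  proof -
    obtain \<pi> where "simple_path E s x \<pi>" using path_exists[OF uv(1) x] .
    moreover have "D s = 1" using cert by (simp add: B.certificate_def)
    ultimately show ?thesis using B.cert_walk[OF cert, of s x \<pi>] live by (simp add: simple_path_walk)
  qed
  have D2: "2 \<le> D x" if "x < n" "x \<noteq> s" for x
    using B.cert_parent[OF cert that(1) Dn[OF that(1)] that(2)] by auto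
  have edi: "ed i = {s, ?w}" by (simp add: ed_def i)
  have "ed i \<in> N \<longleftrightarrow> (\<exists>\<pi>. simple_path (E - {{s, ?w}}) s ?w \<pi> \<and> den * (length \<pi> - 1) \<le> num)"
    unfolding edi nontrivial_iff[OF e] bypass_basic_iff[OF e] ..
  also have "\<dots> \<longleftrightarrow> (\<exists>\<pi>. simple_path (B.live - {{s, ?w}}) s ?w \<pi> \<and> length \<pi> \<le> k + 1)"
    unfolding live k le_diff_conv ..
  also have "\<dots> \<longleftrightarrow> (\<exists>x y. {x, y} \<in> E \<and> x \<noteq> s \<and> y \<noteq> s \<and> D x \<noteq> 0 \<and> S x \<noteq> ?w \<and> S y = ?w \<and> D x + D y \<le> k + 2)"
    using B.cert_alternative[OF cert, of ?w k] e uv unfolding live by auto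
  also have "\<dots> \<longleftrightarrow> ?w \<in> marked s D S m"
  proof
    assume "\<exists>x y. {x, y} \<in> E \<and> x \<noteq> s \<and> y \<noteq> s \<and> D x \<noteq> 0 \<and> S x \<noteq> ?w \<and> S y = ?w \<and> D x + D y \<le> k + 2"
    then obtain x y where xy: "{x, y} \<in> E" "x \<noteq> s" "y \<noteq> s" "S x \<noteq> ?w" "S y = ?w" "D x + D y \<le> k + 2" by blast
    then obtain j where j: "j < m" "{x, y} = ed j" using image_ed by blast
    then consider "x = src j" "y = tgt j" | "x = tgt j" "y = src j" by (auto simp: ed_def doubleton_eq_iff)
    then have "closing s D S j \<and> ?w \<in> {S (src j), S (tgt j)}"
      using xy by cases (auto simp: closing_def k)
    then show "?w \<in> marked s D S m" using j(1) unfolding marked_def by blast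
  next
    assume "?w \<in> marked s D S m"
    then obtain j where j: "j < m" "closing s D S j" "?w = S (src j) \<or> ?w = S (tgt j)" by (auto simp: marked_def)
    have nodes: "src j < n" "tgt j < n" using src_tgt[OF j(1)] by auto
    have E: "{src j, tgt j} \<in> E" "{tgt j, src j} \<in> E" using ed_in[OF j(1)] by (auto simp: ed_def insert_commute)
    have "D (src j) + D (tgt j) \<le> k + 2" using j(2) D2[OF nodes(1)] unfolding closing_def k by auto
    then show "\<exists>x y. {x, y} \<in> E \<and> x \<noteq> s \<and> y \<noteq> s \<and> D x \<noteq> 0 \<and> S x \<noteq> ?w \<and> S y = ?w \<and> D x + D y \<le> k + 2"
      using j(2,3) E Dn nodes unfolding closing_def by (metis add.commute)
  qed
  finally show ?thesis .
qed

text \<open>Needed because labels serve as array positions.\<close>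

lemma S_less:
  assumes "s < n" "x < n" "x \<noteq> s"
    and cert: "bfs_arcs.certificate n s
      (bfs_input.arcs src tgt (\<lambda>i. l (ed i) = 0) (2 * m)) (bfs_input.tg src tgt) D S"
  shows "S x < n"
proof -
  have l': "l e \<le> 1" if "e \<in> E" for e using l_1[OF that] by simp
  interpret B: bfs_input wmax W "bzs s l" n m s src tgt "\<lambda>i. l (ed i) = 0"
    using bfs_input[of s l, OF assms(1) l'] .
  have live: "B.live = E" using live_eq[of s l, OF assms(1) l'] l_1 by auto
  obtain \<pi> where "simple_path E s x \<pi>" using path_exists[OF assms(1,2)] .
  moreover have "D s = 1" using cert by (simp add: B.certificate_def)
  ultimately have "D x \<noteq> 0" using B.cert_walk[OF cert, of s x \<pi>] live by (simp add: simple_path_walk)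
  then have "{s, S x} \<in> B.live" using B.cert_branch[OF cert assms(2) _ assms(3)] by blast
  then show ?thesis using B.live_nodes by blast
qed

lemma bfs_flags:
  "computes W bfs_flags_com xs (n * (24 * n + 70 * m + 60) + 30 * m + 40) (\<lambda>ys. ys = map bflag [0..<m])"
proof (rule computesI)
  let ?cert = "\<lambda>s os. bfs_arcs.certificate n s (bfs_input.arcs src tgt (\<lambda>i. l (ed i) = 0) (2 * m)) (bfs_input.tg src tgt)
    (\<lambda>x. os ! (2 * x)) (\<lambda>x. os ! Suc (2 * x))"
  have l': "l e \<le> 1" if "e \<in> E" for e using l_1[OF that] by simp
  have idx: "3 + 3 * m \<le> wmax" "m \<le> wmax" "n \<le> wmax" "num \<le> wmax" "den \<le> wmax" "2 \<le> wmax"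
    using size_bounds wmax_ge(2) size_ge by auto
  have code: "xs ! (j + 2) = bzs 0 l ! j" if "3 \<le> j" "j < 3 + 3 * m" for j
  proof -
    define i where "i = j - 3"
    have i: "j + 2 = 5 + i" "j = 3 + i" using that by (auto simp: i_def)
    show ?thesis unfolding i(1) unfolding i(2) by (simp only: nth_xs_code nth_bzs_code)
  qed
  have "0 < n" using connected by (simp add: connected_graph_def)
  let ?fl = "\<lambda>P. map (\<lambda>i. if P i then bflag i else 0) [0..<m]"
  let ?base = "\<lambda>st :: state. snd st 0 = xs \<and> fst st 2 = m \<and> fst st 3 = n \<and> fst st 4 = num \<and> fst st 5 = den"
  let ?Q = "\<lambda>k st. k \<le> n * (24 * n + 70 * m + 60) + 30 * m + 40 \<and> result st = map bflag [0..<m]"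
  let ?b1 = "8 ::= Read 0 (Const 5 [+] Const 3 [*] Reg 6) ;;
         9 ::= Read 0 (Const 6 [+] Const 3 [*] Reg 6) ;;
         com.If (Reg 8 [=] Reg 7) skip_com (
         com.If (Reg 9 [=] Reg 7) skip_com (
           10 ::= Read 4 (Const 2 [*] Reg 8 [+] Const 1) ;;
           11 ::= Read 4 (Const 2 [*] Reg 9 [+] Const 1) ;;
           com.If (Reg 10 [=] Reg 11) skip_com (
           com.If (Reg 4 [<] Reg 5 [*] (Read 4 (Const 2 [*] Reg 8) [+] Read 4 (Const 2 [*] Reg 9) [-] Const 2)) skip_com
             (Write 5 (Reg 10) (Const 1) ;; Write 5 (Reg 11) (Const 1)))))"
  let ?b2 = "com.If (Read 0 (Const 5 [+] Const 3 [*] Reg 6) [=] Reg 7)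
           (Write 3 (Reg 6) (Read 5 (Read 0 (Const 6 [+] Const 3 [*] Reg 6)))) skip_com"
  let ?body = "Write 2 (Const 2) (Reg 7) ;; Call 4 bfs_com 2 ;; New 5 (Reg 3) ;;
       For 6 (Const 0) (Reg 2) ?b1 ;; For 6 (Const 0) (Reg 2) ?b2"
  \<comment> \<open>After the searches from all nodes below \<open>s\<close>, the edges with first
    endpoint below \<open>s\<close> have their final flags.\<close>
  let ?I = "\<lambda>s st. ?base st \<and> (\<exists>a. snd st 2 = bzs a l) \<and> snd st 3 = ?fl (\<lambda>i. src i < s)"
  let ?J = "\<lambda>s os j st. ?base st \<and> fst st 7 = s \<and> snd st 2 = bzs s l \<and> snd st 3 = ?fl (\<lambda>i. src i < s) \<and>
     snd st 4 = os \<and> snd st 5 = indicator_list n (marked s (\<lambda>x. os ! (2 * x)) (\<lambda>x. os ! Suc (2 * x)) j)"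
  have mark: "wp ?b1 st (\<lambda>k st'. k \<le> 11 \<and> fst st' 6 = j \<and> ?J s os (Suc j) ((fst st')(6 := Suc j), snd st'))"
    if *: "?J s os j st"
      and j: "fst st 6 = j" "j < m" and os: "length os = 2 * n" "?cert s os" and s: "s < n" for st j s os
  proof -
    let ?M = "marked s (\<lambda>x. os ! (2 * x)) (\<lambda>x. os ! Suc (2 * x))"
    note uv = src_tgt[OF j(2)]
    have uvM: "src j \<le> wmax" "tgt j \<le> wmax" using uv idx by auto
    have S: "src j \<noteq> s \<Longrightarrow> os ! Suc (2 * src j) < n" "tgt j \<noteq> s \<Longrightarrow> os ! Suc (2 * tgt j) < n"
      using S_less[OF s uv(1) _ os(2)] S_less[OF s uv(2) _ os(2)] by auto
    have SM: "src j \<noteq> s \<Longrightarrow> os ! Suc (2 * src j) \<le> wmax" "tgt j \<noteq> s \<Longrightarrow> os ! Suc (2 * tgt j) \<le> wmax"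
      using S idx by auto
    have upd: "src j \<noteq> s \<Longrightarrow> tgt j \<noteq> s \<Longrightarrow> ((indicator_list n (?M j))[os ! Suc (2 * src j) := Suc 0])[os ! Suc (2 * tgt j) := Suc 0] =
      indicator_list n (insert (os ! Suc (2 * tgt j)) (insert (os ! Suc (2 * src j)) (?M j)))"
      using indicator_list_update S by simp
    have M: "?M (Suc j) = (if src j \<noteq> s \<and> tgt j \<noteq> s \<and> os ! Suc (2 * src j) \<noteq> os ! Suc (2 * tgt j) \<and>
       den * (os ! (2 * src j) + os ! (2 * tgt j) - 2) \<le> num
       then insert (os ! Suc (2 * tgt j)) (insert (os ! Suc (2 * src j)) (?M j)) else ?M j)"
      unfolding marked_Suc closing_def ..
    let ?R = "\<lambda>k st'. k \<le> 11 \<and> fst st' 6 = j \<and> ?J s os (Suc j) ((fst st')(6 := Suc j), snd st')"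
    obtain rs as where st: "st = (rs, as)" by (cases st)
    let ?rs = "rs(8 := src j, 9 := tgt j)"
    let ?rs' = "?rs(10 := os ! Suc (2 * src j), 11 := os ! Suc (2 * tgt j))"
    have skip: "wp skip_com (rs', as) (\<lambda>k. ?R (c + k))"
      if "?M (Suc j) = ?M j" "c \<le> 8" "rs' \<in> {?rs, ?rs'}" for rs' c
      using * j that by (intro wp_Assign) (auto simp: st)
    have "wp ?b1 (rs, as) ?R"
    proof (rule wp_Seq, rule wp_Assign_to[where x = "src j"], rule wp_Seq, rule wp_Assign_to[where x = "tgt j"], rule wp_If)
      assume "val (?rs, as) (Reg 8 [=] Reg 7) \<noteq> 0"
      then have "src j = s" using * by (simp add: st split: if_splits)
      then have "?M (Suc j) = ?M j" unfolding M by simp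
      from skip[OF this, of "1 + (1 + 1)" ?rs] show "wp skip_com (?rs, as) (\<lambda>k. ?R (1 + (1 + (1 + k))))" by simp
    next
      assume "val (?rs, as) (Reg 8 [=] Reg 7) = 0"
      then have 1: "src j \<noteq> s" using * by (simp add: st split: if_splits)
      show "wp (com.If (Reg 9 [=] Reg 7) skip_com (
           10 ::= Read 4 (Const 2 [*] Reg 8 [+] Const 1) ;;
           11 ::= Read 4 (Const 2 [*] Reg 9 [+] Const 1) ;;
           com.If (Reg 10 [=] Reg 11) skip_com (
           com.If (Reg 4 [<] Reg 5 [*] (Read 4 (Const 2 [*] Reg 8) [+] Read 4 (Const 2 [*] Reg 9) [-] Const 2)) skip_com
             (Write 5 (Reg 10) (Const 1) ;; Write 5 (Reg 11) (Const 1))))) (?rs, as) (\<lambda>k. ?R (1 + (1 + (1 + k))))"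
      proof (rule wp_If)
        assume "val (?rs, as) (Reg 9 [=] Reg 7) \<noteq> 0"
        then have "tgt j = s" using * by (simp add: st split: if_splits)
        then have "?M (Suc j) = ?M j" unfolding M by simp
        from skip[OF this, of "1 + (1 + (1 + 1))" ?rs] show "wp skip_com (?rs, as) (\<lambda>k. ?R (1 + (1 + (1 + (1 + k)))))" by simp
      next
        assume "val (?rs, as) (Reg 9 [=] Reg 7) = 0"
        then have 2: "tgt j \<noteq> s" using * by (simp add: st split: if_splits)
        show "wp (10 ::= Read 4 (Const 2 [*] Reg 8 [+] Const 1) ;;
           11 ::= Read 4 (Const 2 [*] Reg 9 [+] Const 1) ;;
           com.If (Reg 10 [=] Reg 11) skip_com (
           com.If (Reg 4 [<] Reg 5 [*] (Read 4 (Const 2 [*] Reg 8) [+] Read 4 (Const 2 [*] Reg 9) [-] Const 2)) skip_com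
             (Write 5 (Reg 10) (Const 1) ;; Write 5 (Reg 11) (Const 1)))) (?rs, as) (\<lambda>k. ?R (1 + (1 + (1 + (1 + k)))))"
        proof (rule wp_Seq, rule wp_Assign_to[where x = "os ! Suc (2 * src j)"],
            rule wp_Seq, rule wp_Assign_to[where x = "os ! Suc (2 * tgt j)"], rule wp_If)
          assume "val (?rs', as) (Reg 10 [=] Reg 11) \<noteq> 0"
          then have "os ! Suc (2 * src j) = os ! Suc (2 * tgt j)" by (simp split: if_splits)
          then have "?M (Suc j) = ?M j" unfolding M by simp
          from skip[OF this, of "1 + (1 + (1 + (1 + (1 + (1 + 1)))))" ?rs']
          show "wp skip_com (?rs', as) (\<lambda>k. ?R (1 + (1 + (1 + (1 + (1 + (1 + (1 + k))))))))" by simp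
        next
          assume "val (?rs', as) (Reg 10 [=] Reg 11) = 0"
          then have 3: "os ! Suc (2 * src j) \<noteq> os ! Suc (2 * tgt j)" by (simp split: if_splits)
          have v: "val (?rs', as) (Reg 4 [<] Reg 5 [*] (Read 4 (Const 2 [*] Reg 8) [+] Read 4 (Const 2 [*] Reg 9) [-] Const 2))
            = (if num < den * (os ! (2 * src j) + os ! (2 * tgt j) - 2) then 1 else 0)"
            using * by (simp add: st)
          show "wp (com.If (Reg 4 [<] Reg 5 [*] (Read 4 (Const 2 [*] Reg 8) [+] Read 4 (Const 2 [*] Reg 9) [-] Const 2)) skip_com
             (Write 5 (Reg 10) (Const 1) ;; Write 5 (Reg 11) (Const 1))) (?rs', as)
             (\<lambda>k. ?R (1 + (1 + (1 + (1 + (1 + (1 + (1 + k))))))))"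
          proof (rule wp_If, unfold v)
            assume "(if num < den * (os ! (2 * src j) + os ! (2 * tgt j) - 2) then 1 else 0) \<noteq> (0::nat)"
            then have "?M (Suc j) = ?M j" unfolding M by (auto split: if_splits)
            from skip[OF this, of "1 + (1 + (1 + (1 + (1 + (1 + (1 + 1))))))" ?rs']
            show "wp skip_com (?rs', as) (\<lambda>k. ?R (1 + (1 + (1 + (1 + (1 + (1 + (1 + (1 + k)))))))))" by simp
          next
            assume "(if num < den * (os ! (2 * src j) + os ! (2 * tgt j) - 2) then 1 else 0) = (0::nat)"
            then have M': "?M (Suc j) = insert (os ! Suc (2 * tgt j)) (insert (os ! Suc (2 * src j)) (?M j))"
              using 1 2 3 unfolding M by (auto split: if_splits)
            show "wp (Write 5 (Reg 10) (Const 1) ;; Write 5 (Reg 11) (Const 1)) (?rs', as)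
              (\<lambda>k. ?R (1 + (1 + (1 + (1 + (1 + (1 + (1 + (1 + k)))))))))"
              by (rule wp_Seq, rule wp_Write_to[where i = "os ! Suc (2 * src j)" and x = 1 and
                  ys = "indicator_list n (insert (os ! Suc (2 * src j)) (?M j))"],
                rule wp_Write_to[where i = "os ! Suc (2 * tgt j)" and x = 1 and ys = "indicator_list n (?M (Suc j))"])
               (use * j 1 2 S M' idx indicator_list_update in \<open>auto simp: st\<close>)
          qed (use * os(1) uv in \<open>auto simp: st\<close>)
        qed (use * 1 2 os(1) uv SM in \<open>auto simp: st\<close>)
      qed auto
    qed (use * j nth_xs_edge[OF j(2)] uvM in \<open>auto simp: st\<close>)
    then show ?thesis by (simp only: st)
  qed
  have body: "wp ?body st (\<lambda>k st'. k \<le> 24 * n + 70 * m + 50 \<and> fst st' 7 = s \<and> ?I (Suc s) ((fst st')(7 := Suc s), snd st'))"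
    if I: "?I s st" "fst st 7 = s" and s: "s < n" for s st
  proof -
    interpret B: bfs_input wmax W "bzs s l" n m s src tgt "\<lambda>i. l (ed i) = 0"
      using bfs_input[of s l, OF s l'] .
    let ?R = "\<lambda>k st'. k \<le> 24 * n + 70 * m + 50 \<and> fst st' 7 = s \<and> ?I (Suc s) ((fst st')(7 := Suc s), snd st')"
    obtain a where a: "snd st 2 = bzs a l" using I by blast
    have a2: "(bzs a l)[2 := s] = bzs s l" by (simp add: bzs_def numeral_eq_Suc)
    obtain rs as where st: "st = (rs, as)" by (cases st)
    have "wp ?body (rs, as) ?R"
    proof (rule wp_Seq, rule wp_Write_to[where i = 2 and x = s and ys = "bzs s l"], rule wp_Seq, rule wp_Call)
      show "computes W bfs_com (snd (rs, as(2 := bzs s l)) 2) (20 * n + 40 * m + 30) (\<lambda>os. length os = 2 * n \<and>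
         B.certificate (\<lambda>x. os ! (2 * x)) (\<lambda>x. os ! Suc (2 * x)) \<and> (\<forall>z\<in>set os. z \<le> wmax))"
        using B.bfs_correct by simp
    next
      fix k :: nat and os :: "nat list"
      assume os: "length os = 2 * n \<and> B.certificate (\<lambda>x. os ! (2 * x)) (\<lambda>x. os ! Suc (2 * x)) \<and> (\<forall>z\<in>set os. z \<le> wmax)"
        and "k \<le> 1 + length (snd (rs, as(2 := bzs s l)) 2) + (20 * n + 40 * m + 30) + length os"
      then have k: "k \<le> 22 * n + 43 * m + 34" by simp
      let ?M = "marked s (\<lambda>x. os ! (2 * x)) (\<lambda>x. os ! Suc (2 * x))"
      let ?K = "\<lambda>j st. ?base st \<and> fst st 7 = s \<and> snd st 2 = bzs s l \<and> snd st 3 = ?fl (\<lambda>i. src i < s \<or> src i = s \<and> i < j) \<and>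
         snd st 5 = indicator_list n (?M m)"
      have M0: "?M 0 = {}" by (simp add: marked_def)
      let ?as = "as(2 := bzs s l, 4 := os)"
      have "wp (New 5 (Reg 3) ;; For 6 (Const 0) (Reg 2) ?b1 ;; For 6 (Const 0) (Reg 2) ?b2)
          (rs, ?as) (\<lambda>k'. ?R (1 + (k + k')))"
      proof (rule wp_Seq, rule wp_New_to[where k = n], rule wp_Seq, rule wp_For[where a = 0 and n = m and b = 11 and I = "?J s os"])
        fix j :: nat and st :: state
        assume "?J s os j st" "fst st 6 = j" "j < m"
        then show "wp ?b1 st (\<lambda>k s'. k \<le> 11 \<and> fst s' 6 = j \<and> ?J s os (Suc j) ((fst s')(6 := Suc j), snd s'))"
          by (rule mark) (use os s in auto)
      next
        fix k1 :: nat and st1 :: state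
        assume J: "?J s os m st1" and k1: "k1 \<le> (11 + 2) * (m - 0) + 2"
        show "wp (For 6 (Const 0) (Reg 2) ?b2) st1 (\<lambda>k'. ?R (1 + (k + (1 + n + (k1 + k')))))"
        proof (rule wp_For[where a = 0 and n = m and b = 2 and I = ?K])
          fix j :: nat and st :: state
          assume *: "?K j st" "fst st 6 = j" "j < m"
          note uv = src_tgt[OF *(3)]
          have mk: "src j = s \<Longrightarrow> indicator_list n (?M m) ! tgt j = bflag j"
            using nontrivial_by_bfs[OF *(3) _, of s] os uv by (auto simp: bflag_def)
          have upd: "src j = s \<Longrightarrow> (?fl (\<lambda>i. src i < s \<or> src i = s \<and> i < j))[j := bflag j] = ?fl (\<lambda>i. src i < s \<or> src i = s \<and> i < Suc j)"
            using *(3) by (intro nth_equalityI) (auto simp: nth_list_update less_Suc_eq)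
          have skip: "src j \<noteq> s \<Longrightarrow> ?fl (\<lambda>i. src i < s \<or> src i = s \<and> i < j) = ?fl (\<lambda>i. src i < s \<or> src i = s \<and> i < Suc j)"
            by (intro nth_equalityI) (auto simp: less_Suc_eq)
          have bM: "bflag j \<le> wmax" using idx by (simp add: bflag_def)
          show "wp ?b2 st (\<lambda>k s'. k \<le> 2 \<and> fst s' 6 = j \<and> ?K (Suc j) ((fst s')(6 := Suc j), snd s'))"
          proof (rule wp_If)
            assume "val st (Read 0 (Const 5 [+] Const 3 [*] Reg 6) [=] Reg 7) \<noteq> 0"
            then have sj: "src j = s" using * nth_xs_edge[OF *(3)] by (simp split: if_splits)
            have v: "val st (Read 5 (Read 0 (Const 6 [+] Const 3 [*] Reg 6))) = bflag j"
              using * nth_xs_edge[OF *(3)] mk[OF sj] by simp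
            show "wp (Write 3 (Reg 6) (Read 5 (Read 0 (Const 6 [+] Const 3 [*] Reg 6)))) st
               (\<lambda>k s'. 1 + k \<le> 2 \<and> fst s' 6 = j \<and> ?K (Suc j) ((fst s')(6 := Suc j), snd s'))"
            proof (rule wp_Write, unfold v)
              have "(snd st 3)[val st (Reg 6) := bflag j] = ?fl (\<lambda>i. src i < s \<or> src i = s \<and> i < Suc j)"
                using * upd[OF sj] by simp
              then show "1 + 1 \<le> (2::nat) \<and> fst (fst st, (snd st)(3 := (snd st 3)[val st (Reg 6) := bflag j])) 6 = j \<and>
                 ?K (Suc j) ((fst (fst st, (snd st)(3 := (snd st 3)[val st (Reg 6) := bflag j])))(6 := Suc j),
                   snd (fst st, (snd st)(3 := (snd st 3)[val st (Reg 6) := bflag j])))"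
                using * by simp
            qed (use * nth_xs_edge[OF *(3)] uv bM in auto)
          next
            assume "val st (Read 0 (Const 5 [+] Const 3 [*] Reg 6) [=] Reg 7) = 0"
            then have sj: "src j \<noteq> s" using * nth_xs_edge[OF *(3)] by (simp split: if_splits)
            show "wp skip_com st (\<lambda>k s'. 1 + k \<le> 2 \<and> fst s' 6 = j \<and> ?K (Suc j) ((fst s')(6 := Suc j), snd s'))"
              using * skip[OF sj] by (intro wp_Assign) auto
          qed (use * in auto)
        next
          fix k2 :: nat and st2 :: state
          assume K: "?K m st2" and k2: "k2 \<le> (2 + 2) * (m - 0) + 2"
          have "?fl (\<lambda>i. src i < s \<or> src i = s \<and> i < m) = ?fl (\<lambda>i. src i < Suc s)"
            by (auto simp: less_Suc_eq)
          then show "?R (1 + (k + (1 + n + (k1 + k2)))) st2" using K k k1 k2 by auto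
        qed (use J idx in auto)
      qed (use I st M0 idx in \<open>auto simp: indicator_list_empty\<close>)
      then show "wp (New 5 (Reg 3) ;; For 6 (Const 0) (Reg 2) ?b1 ;; For 6 (Const 0) (Reg 2) ?b2)
          (fst (rs, as(2 := bzs s l)), (snd (rs, as(2 := bzs s l)))(4 := os)) (\<lambda>k'. ?R (1 + (k + k')))"
        by (simp only: fst_conv snd_conv)
    qed (use I a a2 s st idx small in auto)
    then show ?thesis by (simp only: st)
  qed
  let ?c2 = "For 7 (Const 0) (Reg 3) ?body ;; Call 0 skip_com 3"
  have c2: "wp ?c2 st (\<lambda>k. ?Q (t + k))"
    if st: "?base st" "snd st 2 = bzs 0 l" "snd st 3 = replicate m 0" and t: "t \<le> 20 * m + 20" for st t
  proof (rule wp_Seq, rule wp_For[where a = 0 and n = n and b = "24 * n + 70 * m + 50" and I = ?I])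
    fix s :: nat and st :: state assume "?I s st" "fst st 7 = s" "s < n"
    then show "wp ?body st (\<lambda>k st'. k \<le> 24 * n + 70 * m + 50 \<and> fst st' 7 = s \<and> ?I (Suc s) ((fst st')(7 := Suc s), snd st'))"
      by (rule body)
  next
    fix k :: nat and st :: state
    assume I: "?I n st" and k: "k \<le> (24 * n + 70 * m + 50 + 2) * (n - 0) + 2"
    have "(24 * n + 70 * m + 50 + 2) * (n - 0) \<le> n * (24 * n + 70 * m + 60)"
      by (simp add: mult.commute)
    then have k': "k \<le> n * (24 * n + 70 * m + 60) + 2" using k by linarith
    have fl: "?fl (\<lambda>i. src i < n) = map bflag [0..<m]" using src_tgt(1) by simp
    show "wp (Call 0 skip_com 3) st (\<lambda>k'. ?Q (t + (k + k')))"
    proof (rule wp_Call[OF computes_skip])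
      show "length zs \<le> wmax \<and> (\<forall>y\<in>set zs. y \<le> wmax)" if "zs = snd st 3" for zs
        using that I idx fl by (auto simp: bflag_def)
    qed (use I k' t fl in auto)
  next
    show "?I 0 ((fst st)(7 := 0), snd st)" using st by (auto simp: map_replicate_const)
  qed (use idx in auto)
  let ?c1 = "For 6 (Const 3) (Len 2) (Write 2 (Reg 6) (Read 0 (Reg 6 [+] Const 2))) ;; New 3 (Reg 2) ;; ?c2"
  have c1: "wp ?c1 s (\<lambda>k. ?Q (t + k))"
    if s: "?base s" "snd s 2 = [n, m, 0] @ replicate (3 * m) 0" and t: "t \<le> 3 * m + 14" for s t
  proof (rule wp_Seq, rule wp_copy[where zs = "bzs 0 l"])
    fix k assume k: "k \<le> 3 * (length (bzs 0 l) - 3) + 2"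
    let ?s = "((fst s)(6 := length (bzs 0 l)), (snd s)(2 := bzs 0 l))"
    let ?s' = "(fst ?s, (snd ?s)(3 := replicate m 0))"
    have w: "wp ?c2 ?s' (\<lambda>k'. ?Q ((t + (k + (1 + m))) + k'))"
      using s t k by (intro c2) auto
    show "wp (New 3 (Reg 2) ;; ?c2) ?s (\<lambda>k'. ?Q (t + (k + k')))"
      unfolding fst_conv snd_conv
      by (rule wp_Seq, rule wp_New_to[where k = m], rule wp_conseq[OF w[unfolded fst_conv snd_conv]]) (use s idx in auto)
  next
    show "snd s 2 = take 3 (bzs 0 l) @ replicate (length (bzs 0 l) - 3) 0" using s by (simp add: bzs_def)
    show "j + 2 < length (snd s 0) \<and> snd s 0 ! (j + 2) = bzs 0 l ! j" if "3 \<le> j" "j < length (bzs 0 l)" for j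
      using that s(1) code[of j] by simp
    show "\<forall>x\<in>set (bzs 0 l). x \<le> wmax" using bzs_le[of 0 l, OF \<open>0 < n\<close> l'] .
  qed (use idx in auto)
  show "wp bfs_flags_com (init xs) ?Q"
    unfolding bfs_flags_com_def init_def
    apply (rule wp_Seq, rule wp_Assign_to[where x = m])
    apply (rule wp_Seq, rule wp_Assign_to[where x = n])
    apply (rule wp_Seq, rule wp_Assign_to[where x = num])
    apply (rule wp_Seq, rule wp_Assign_to[where x = den])
    apply (rule wp_Seq, rule wp_New_to[where k = "3 + 3 * m"])
    apply (rule wp_Seq, rule wp_Write_to[where i = 0 and x = n and ys = "n # replicate (2 + 3 * m) 0"])
    apply (rule wp_Seq, rule wp_Write_to[where i = 1 and x = m and ys = "n # m # replicate (1 + 3 * m) 0"])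
    apply (rule wp_conseq[OF c1[where t = "3 * m + 10"]])
    using idx nth_xs(5,6) by (simp_all add: numeral_eq_Suc)
  show "length xs \<le> wmax" using wmax_ge(6) by simp
  show "\<forall>x\<in>set xs. x \<le> wmax" using in_xs_less wmax_ge(2) by fastforce
qed

end

section \<open>Running times\<close>

text \<open>The parameter-dependent factor of both time bounds: the first entry is
  \<open>\<rho>\<close>, the second \<open>\<tau>\<close> or the numerator of
  \<open>\<alpha>\<close>. The added 1 lets it also multiply the summands that are free of the
  parameters.\<close>

definition power_fun :: "nat list \<Rightarrow> nat" where
  "power_fun ys = (if length ys < 2 then 0 else (ys ! 0) ^ (2 * ys ! 0 + 1) * (ys ! 1) ^ (2 * ys ! 0) + 1)"

text \<open>Both powers come from a single loop, by
  \<open>x ^ (2 * x + 1) * y ^ (2 * x) = (x * y) ^ (2 * x) * x\<close>.\<close>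

definition power_com :: com where
  "power_com = If (Len 0 [<] Const 2) (New 0 (Const 1))
     (2 ::= Read 0 (Const 0) ;; 3 ::= Read 0 (Const 1) ;; 4 ::= Const 1 ;;
      For 5 (Const 0) (Const 2 [*] Reg 2) (4 ::= Reg 4 [*] (Reg 2 [*] Reg 3)) ;;
      New 0 (Const 1) ;; Write 0 (Const 0) (Reg 4 [*] Reg 2 [+] Const 1))"

lemma computable_power_fun: "computable power_fun"
  unfolding computable_def
proof (intro exI[of _ power_com] allI)
  fix ys :: "nat list"
  define x where "x = ys ! 0"
  define y where "y = ys ! 1"
  \<comment> \<open>Raising the base by 1 makes the powers monotone even for
    \<open>x * y = 0\<close>, so that \<open>P\<close> bounds every intermediate result.\<close>
  define P where "P = (x * y + 1) ^ (2 * x) * (x + 1)"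
  define M where "M = 2 + length ys + Max (insert 0 (set ys)) + 2 * x + P"
  interpret machine M "(M + 2) ^ 12" by standard simp
  have ys: "\<forall>z\<in>set ys. z \<le> M"
  proof
    fix z assume "z \<in> set ys"
    then have "z \<le> Max (insert 0 (set ys))" by simp
    then show "z \<le> M" by (simp add: M_def)
  qed
  have pow: "(x * y) ^ i \<le> P" if "i \<le> 2 * x" for i
  proof -
    have "(x * y) ^ i \<le> (x * y + 1) ^ i" by (intro power_mono) auto
    also have "\<dots> \<le> (x * y + 1) ^ (2 * x)" using that by (intro power_increasing) auto
    also have "\<dots> \<le> P" by (simp add: P_def)
    finally show ?thesis .
  qed
  have powM: "(x * y) ^ i \<le> M" if "i \<le> 2 * x" for i using pow[OF that] by (simp add: M_def)
  have fin: "(x * y) ^ (2 * x) * x + 1 \<le> M"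
  proof -
    have "(x * y) ^ (2 * x) * x \<le> (x * y + 1) ^ (2 * x) * (x + 1)"
      by (intro mult_le_mono power_mono) auto
    then show ?thesis by (simp add: M_def P_def)
  qed
  have "computes ((M + 2) ^ 12) power_com ys (6 * x + 20) (\<lambda>zs. zs = [power_fun ys])"
  proof (rule computesI)
    let ?Q = "\<lambda>k s. k \<le> 6 * x + 20 \<and> result s = [power_fun ys]"
    let ?c = "2 ::= Read 0 (Const 0) ;; 3 ::= Read 0 (Const 1) ;; 4 ::= Const 1 ;;
      For 5 (Const 0) (Const 2 [*] Reg 2) (4 ::= Reg 4 [*] (Reg 2 [*] Reg 3)) ;;
      New 0 (Const 1) ;; Write 0 (Const 0) (Reg 4 [*] Reg 2 [+] Const 1)"
    have M2: "2 \<le> M" "2 * x \<le> M" by (auto simp: M_def)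
    show "wp power_com (init ys) ?Q"
      unfolding power_com_def init_def
    proof (rule wp_If)
      assume "val (\<lambda>_. 0, (\<lambda>_. [])(0 := ys)) (Len 0 [<] Const 2) \<noteq> 0"
      then have "power_fun ys = 0" by (simp add: power_fun_def split: if_splits)
      then show "wp (New 0 (Const 1)) (\<lambda>_. 0, (\<lambda>_. [])(0 := ys)) (\<lambda>k. ?Q (1 + k))"
        using M2 by (intro wp_New_to[where k = 1]) auto
    next
      assume "val (\<lambda>_. 0, (\<lambda>_. [])(0 := ys)) (Len 0 [<] Const 2) = 0"
      then have len: "2 \<le> length ys" by (simp split: if_splits)
      have xy: "x \<in> set ys" "y \<in> set ys"
        unfolding x_def y_def using nth_mem[of 0 ys] nth_mem[of 1 ys] len by linarith+
      have res: "power_fun ys = (x * y) ^ (2 * x) * x + 1"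
        using len by (simp add: power_fun_def x_def y_def power_mult_distrib)
      show "wp ?c (\<lambda>_. 0, (\<lambda>_. [])(0 := ys)) (\<lambda>k. ?Q (1 + k))"
      proof (rule wp_Seq, rule wp_Assign_to[where x = x], rule wp_Seq, rule wp_Assign_to[where x = y],
          rule wp_Seq, rule wp_Assign_to[where x = 1], rule wp_Seq,
          rule wp_For[where a = 0 and n = "2 * x" and b = 1 and
            I = "\<lambda>j s. fst s 2 = x \<and> fst s 3 = y \<and> fst s 4 = (x * y) ^ j"])
        fix j :: nat and s :: state
        assume "fst s 2 = x \<and> fst s 3 = y \<and> fst s 4 = (x * y) ^ j" "fst s 5 = j" "j < 2 * x"
        then show "wp (4 ::= Reg 4 [*] (Reg 2 [*] Reg 3)) s (\<lambda>k s'. k \<le> 1 \<and> fst s' 5 = j \<and>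
           fst ((fst s')(5 := Suc j), snd s') 2 = x \<and> fst ((fst s')(5 := Suc j), snd s') 3 = y \<and>
           fst ((fst s')(5 := Suc j), snd s') 4 = (x * y) ^ Suc j)"
          using powM[of "Suc j"] by (intro wp_Assign) (auto simp: algebra_simps)
      next
        fix k :: nat and s :: state
        assume "fst s 2 = x \<and> fst s 3 = y \<and> fst s 4 = (x * y) ^ (2 * x)" "k \<le> (1 + 2) * (2 * x - 0) + 2"
        then show "wp (New 0 (Const 1) ;; Write 0 (Const 0) (Reg 4 [*] Reg 2 [+] Const 1)) s
           (\<lambda>k'. ?Q (1 + (1 + (1 + (1 + (k + k'))))))"
          using fin M2 res by (intro wp_Seq wp_New wp_Write) auto
      qed (use len M2 ys xy in \<open>auto simp: x_def y_def\<close>)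
    qed auto
    show "length ys \<le> M" by (simp add: M_def)
  qed (rule ys)
  then show "\<exists>W t s. exec W power_com (init ys) t s \<and> result s = [power_fun ys]"
    unfolding computes_def by blast
qed

lemma poly_nat_mono: "x \<le> y \<Longrightarrow> poly p x \<le> poly p (y :: nat)"
  by (induction p) (auto intro!: add_mono mult_mono)

lemma length_le_enc_length: "length xs \<le> enc_length xs"
  unfolding enc_length_def by (induction xs) auto

lemma runs_within_mono:
  assumes "runs_within c D xs t Q" "t \<le> t'" "\<And>ys. Q ys \<Longrightarrow> Q' ys"
  shows "runs_within c D xs t' Q'"
  using assms unfolding runs_within_def by fastforce

lemma computes_runs_within:
  assumes "computes (word_bound D xs) c xs k Q" "\<And>ys. Q ys \<Longrightarrow> real (length xs + k + length ys) \<le> t"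
  shows "runs_within c D xs t Q"
  using assms unfolding computes_def runs_within_def by fastforce

text \<open>Deciding amounts to finding a witness and keeping the first entry of the output.\<close>

definition decide_com :: "com \<Rightarrow> com" where
  "decide_com c = (Call 0 c 0 ;; 2 ::= Read 0 (Const 0) ;; New 0 (Const 1) ;; Write 0 (Const 0) (Reg 2))"

lemma runs_within_decide:
  assumes "runs_within c D xs t Q" "\<And>ys. Q ys \<Longrightarrow> ys \<noteq> [] \<and> hd ys \<le> 1"
  shows "runs_within (decide_com c) D xs (2 * t + 6) (\<lambda>zs. \<exists>ys. Q ys \<and> zs = [hd ys])"
proof -
  let ?W = "word_bound D xs"
  have W: "1 \<le> ?W" by (simp add: word_bound_def)
  obtain k s where e: "exec ?W c (init xs) k s" "real (length xs + k + length (result s)) \<le> t" "Q (result s)"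
    using assms(1) unfolding runs_within_def by blast
  let ?y = "hd (result s)"
  have y: "result s \<noteq> []" "?y \<le> 1" using assms(2)[OF e(3)] by auto
  let ?s0 = "init xs"
  let ?s1 = "(fst ?s0, (snd ?s0)(0 := result s))"
  let ?s2 = "((fst ?s1)(2 := ?y), snd ?s1)"
  let ?s3 = "(fst ?s2, (snd ?s2)(0 := replicate 1 0))"
  let ?s4 = "(fst ?s3, (snd ?s3)(0 := (snd ?s3 0)[0 := ?y]))"
  have 1: "exec ?W (Call 0 c 0) ?s0 (1 + length (snd ?s0 0) + k + length (result s)) ?s1"
    using e(1) by (intro exec.Call) (simp add: init_def)
  have 2: "exec ?W (2 ::= Read 0 (Const 0)) ?s1 1 ?s2"
    using y W by (intro exec.Assign) (auto simp: word_def hd_conv_nth)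
  have 3: "exec ?W (New 0 (Const 1)) ?s2 (1 + 1) ?s3"
    using W by (intro exec.New) (auto simp: word_def)
  have 4: "exec ?W (Write 0 (Const 0) (Reg 2)) ?s3 1 ?s4"
    using y W by (intro exec.Write) (auto simp: word_def)
  have "exec ?W (decide_com c) ?s0 ((1 + length (snd ?s0 0) + k + length (result s)) + (1 + ((1 + 1) + 1))) ?s4"
    unfolding decide_com_def by (rule exec.Seq[OF 1 exec.Seq[OF 2 exec.Seq[OF 3 4]]])
  moreover have "result ?s4 = [?y]" by simp
  moreover have "snd ?s0 0 = xs" by (simp add: init_def)
  moreover have "real (length xs + ((1 + length xs + k + length (result s)) + (1 + ((1 + 1) + 1))) + 1) \<le> 2 * t + 6"
    using e(2) by simp
  ultimately show ?thesis
    unfolding runs_within_def using e(3) by (intro exI conjI) (assumption | auto)+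
qed

lemma power_3_le: "3 ^ r \<le> 9 * r ^ r" for r :: nat
proof (cases "r < 3")
  case True
  then have "r = 0 \<or> r = 1 \<or> r = 2" by auto
  then show ?thesis by auto
next
  case False
  then have "(3::nat) ^ r \<le> r ^ r" by (intro power_mono) auto
  then show ?thesis by simp
qed

text \<open>The slack between \<open>r ^ (2 * r)\<close> and \<open>r ^ r\<close> absorbs the constant \<open>3 ^ r\<close>.\<close>

lemma choose_le:
  fixes a :: real
  assumes "1 \<le> a" "real t \<le> a"
  shows "real (r * (2 * t + 1) choose r) \<le> 9 * real r ^ (2 * r) * a ^ (2 * r)"
proof -
  have "r * (2 * t + 1) choose r \<le> (r * (2 * t + 1)) ^ r" by (intro binomial_le_pow) auto
  then have "real (r * (2 * t + 1) choose r) \<le> real ((r * (2 * t + 1)) ^ r)" by (rule of_nat_mono)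
  also have "\<dots> = (real r * (2 * real t + 1)) ^ r"
    by (simp only: of_nat_power of_nat_mult of_nat_add of_nat_numeral of_nat_1)
  also have "\<dots> \<le> (real r * (3 * a)) ^ r"
    using assms by (intro power_mono mult_left_mono) auto
  also have "\<dots> = 3 ^ r * (real r ^ r * a ^ r)" by (simp add: power_mult_distrib)
  also have "\<dots> \<le> (9 * real r ^ r) * (real r ^ r * a ^ (2 * r))"
  proof (intro mult_mono)
    show "3 ^ r \<le> 9 * real r ^ r"
      using of_nat_mono[OF power_3_le[of r], where 'a = real] by simp
    show "a ^ r \<le> a ^ (2 * r)" using assms(1) by (intro power_increasing) auto
  qed (use assms in auto)
  also have "\<dots> = 9 * real r ^ (2 * r) * a ^ (2 * r)" by (simp add: mult_2 power_add)
  finally show ?thesis .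
qed

context coded
begin

text \<open>Fixes the exponent 60 of the word bound: \<open>wmax + 2\<close> is below the fifth
  power of \<open>size\<close>, and expressions have degree up to 12.\<close>

lemma word_size: "(wmax + 2) ^ 12 \<le> size ^ 60"
proof -
  have "wmax + 2 \<le> size ^ 5"
  proof -
    have "2 \<le> size ^ 4" using size_ge self_le_power[of size 4] by simp
    then have "size ^ 4 + 2 \<le> 2 * size ^ 4" by simp
    also have "\<dots> \<le> size * size ^ 4" using size_ge by (intro mult_le_mono1) simp
    finally show ?thesis by (simp add: wmax_def eval_nat_numeral)
  qed
  then have "(wmax + 2) ^ 12 \<le> (size ^ 5) ^ 12" by (rule power_mono) simp
  then show ?thesis by (simp flip: power_mult)
qed

lemma witness_length: "witness ys \<Longrightarrow> length ys \<le> m + 1 \<and> ys \<noteq> [] \<and> hd ys \<le> 1"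
  unfolding witness_def by (auto split: if_splits)

text \<open>The term \<open>A\<close> pays for the classification and for everything linear in
  \<open>m\<close>; only the enumeration with its checks is charged to the summand with
  \<open>S\<close>.\<close>

lemma runs_weighted:
  fixes S A :: nat
  assumes spsp: "\<And>l' s t. \<forall>e\<in>E. 1 \<le> l' e \<Longrightarrow> s < n \<Longrightarrow> t < n \<Longrightarrow>
      runs_within cs Ds ([n, m, s, t] @ edge_code l' es) (real S)
        (\<lambda>ys. \<exists>k. ys = [k] \<and> ereal (real k) = path_dist E l' s t)"
    and apsp: "\<And>l'. \<forall>e\<in>E. 1 \<le> l' e \<Longrightarrow>
      runs_within ca Da ([n, m] @ edge_code l' es) (real A)
        (\<lambda>ys. length ys = 2 * n * n \<and> (\<forall>u<n. \<forall>v<n. two_shortest E l' u v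
           (ys ! (2 * (u * n + v))) (ys ! (2 * (u * n + v) + 1))))"
  shows "runs_within (search_com (apsp_flags_com ca) (spsp_check_com cs)) (60 + 4 * Ds + 4 * Da) xs
    (real (300 * (\<rho> ^ (2 * \<rho> + 1) * tightness I ^ (2 * \<rho>) * S + A + 1))) witness"
proof (rule computes_runs_within)
  let ?W = "word_bound (60 + 4 * Ds + 4 * Da) xs"
  let ?\<tau> = "tightness I"
  have W: "(wmax + 2) ^ 12 \<le> ?W" "size ^ (4 * Ds) \<le> ?W" "size ^ (4 * Da) \<le> ?W"
  proof -
    have "size ^ a \<le> ?W" if "a \<le> 60 + 4 * Ds + 4 * Da" for a
      unfolding word_bound_size using that size_ge by (intro power_increasing) auto
    from this[of 60] this[of "4 * Ds"] this[of "4 * Da"]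
    show "(wmax + 2) ^ 12 \<le> ?W" "size ^ (4 * Ds) \<le> ?W" "size ^ (4 * Da) \<le> ?W"
      using word_size by auto
  qed
  interpret S: spsp_oracle I es cs Ds S ?W
    using spsp W by unfold_locales auto
  interpret A: apsp_oracle I es ca Da A ?W
    using apsp W by unfold_locales auto
  \<comment> \<open>The oracle reads the graph and writes the table, which bounds its time from
    below.\<close>
  obtain A: "2 * n * n + 3 * m + 2 \<le> A"
    using A.apsp_flags unfolding computes_def by blast
  \<comment> \<open>For \<open>\<tau> = 0\<close> no edge is critical and no flag is 1, so no check
    has to be paid; otherwise a check takes two calls of the oracle and linear overhead.\<close>
  let ?CC = "if ?\<tau> = 0 then 0 else 2 * S + 34 * m + 55"
  let ?k = "4 * A + 50 * m + 50 + 32 * m + 65 + (if \<rho> \<le> m then (\<rho> * (2 * ?\<tau> + 1) choose \<rho>) * ((16 + ?CC) * \<rho> + 14) else 0)"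
  show "computes ?W (search_com (apsp_flags_com ca) (spsp_check_com cs)) xs ?k witness"
  proof (rule computes_witness[OF W(1) wmax_ge(2) wmax_ge(6) A.valid_flags])
    show "computes ?W (apsp_flags_com ca) xs (4 * A + 50 * m + 50) (\<lambda>ys. ys = map A.flag [0..<m])"
      using A.apsp_flags by (rule computes_mono) auto
    show "computes ?W (spsp_check_com cs) (xs @ indicator_list m B @ [e]) (2 * S + 30 * m + 40)
       (\<lambda>ys. ys = [if bypass (ed ` B) (ed e) then 1 else 0])" if "B \<subseteq> {..<m}" "e \<in> B" for B e
    proof -
      have "e < m" using that by auto
      from S.spsp_check[OF that(1) this] show ?thesis by (rule computes_mono) auto
    qed
    show "2 * S + 30 * m + 40 + 4 * m + 15 \<le> ?CC" if "e < m" "map A.flag [0..<m] ! e = 1" for e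
      using A.flag_1_critical[OF that] tightness_pos by auto
  qed
  fix ys assume "witness ys"
  then have ys: "length ys \<le> m + 1" using witness_length by blast
  let ?T = "\<rho> ^ (2 * \<rho> + 1) * ?\<tau> ^ (2 * \<rho>) * S"
  have enum: "(\<rho> * (2 * ?\<tau> + 1) choose \<rho>) * ((16 + ?CC) * \<rho> + 14) \<le> 288 * ?T + 16 * m + 14" if "\<rho> \<le> m"
  proof -
    \<comment> \<open>In the first two cases the term with \<open>S\<close> vanishes. Then just one
      subset is tried, without any call of the oracle, at a cost linear in
      \<open>\<rho> \<le> m\<close>.\<close>
    consider "\<rho> = 0" | "?\<tau> = 0" | "1 \<le> \<rho>" "1 \<le> ?\<tau>" by linarith
    then show ?thesis
    proof cases
      case 2
      then show ?thesis using that by simp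
    next
      case 3
      have "0 < n" using connected by (simp add: connected_graph_def)
      moreover have "l e \<le> size ^ 3" if e: "e \<in> E" for e
      proof -
        obtain i where "i < m" "e = ed i" using e image_ed by blast
        then show ?thesis using size_bounds(7)[of i] self_le_power[of size 3] size_ge by simp
      qed
      \<comment> \<open>This run from node 0 to itself only serves to bound \<open>S\<close> from
        below by the length of the input and output of the oracle.\<close>
      ultimately have "computes ?W cs ([n, m, 0, 0] @ edge_code l es) S
          (\<lambda>ys. ys = [nat_dist E l 0 0] \<and> 4 + 3 * m + 1 \<le> S)"
        using S.spsp_computes[of l 0 0] len_pos by blast
      then have S: "4 + 3 * m + 1 \<le> S" unfolding computes_def by blast
      have "16 + ?CC \<le> 29 * S" using S 3 by simp
      then have "(16 + ?CC) * \<rho> \<le> 29 * S * \<rho>" by (rule mult_le_mono1)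
      moreover have "14 \<le> 3 * S * \<rho>"
      proof -
        have "14 \<le> 3 * S" using S by simp
        also have "\<dots> \<le> 3 * S * \<rho>" using 3 by simp
        finally show ?thesis .
      qed
      ultimately have "(16 + ?CC) * \<rho> + 14 \<le> 29 * S * \<rho> + 3 * S * \<rho>" by (rule add_mono)
      also have "\<dots> = 32 * S * \<rho>" by simp
      finally have "(16 + ?CC) * \<rho> + 14 \<le> 32 * S * \<rho>" .
      then have "real ((16 + ?CC) * \<rho> + 14) \<le> real (32 * S * \<rho>)" by (rule of_nat_mono)
      also have "\<dots> = 32 * real S * real \<rho>" by simp
      finally have "real ((16 + ?CC) * \<rho> + 14) \<le> 32 * real S * real \<rho>" .
      moreover have "real (\<rho> * (2 * ?\<tau> + 1) choose \<rho>) \<le> 9 * real \<rho> ^ (2 * \<rho>) * real ?\<tau> ^ (2 * \<rho>)"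
        using 3 by (intro choose_le) auto
      ultimately have "real (\<rho> * (2 * ?\<tau> + 1) choose \<rho>) * real ((16 + ?CC) * \<rho> + 14)
          \<le> (9 * real \<rho> ^ (2 * \<rho>) * real ?\<tau> ^ (2 * \<rho>)) * (32 * real S * real \<rho>)"
        by (intro mult_mono) auto
      also have "\<dots> = real (288 * ?T)" by simp
      finally have "real ((\<rho> * (2 * ?\<tau> + 1) choose \<rho>) * ((16 + ?CC) * \<rho> + 14)) \<le> real (288 * ?T)"
        by (simp only: of_nat_mult[where 'a = real])
      then have "(\<rho> * (2 * ?\<tau> + 1) choose \<rho>) * ((16 + ?CC) * \<rho> + 14) \<le> 288 * ?T"
        by (simp only: of_nat_le_iff)
      then show ?thesis by simp
    qed simp
  qed
  have "?k \<le> 4 * A + 98 * m + 129 + 288 * ?T"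
    using enum by (cases "\<rho> \<le> m") auto
  then have "length xs + ?k + length ys \<le> 300 * (?T + A + 1)"
    using ys A by simp
  then show "real (length xs + ?k + length ys) \<le> real (300 * (?T + A + 1))" by (rule of_nat_mono)
qed

end

text \<open>Subsets are enumerated only for \<open>\<rho> \<le> m\<close>. For positive
  \<open>\<rho>\<close> there is then an edge, so a breadth-first search costs O(m) by
  \<open>nodes_le\<close>.\<close>

lemma (in coded) runs_basic:
  assumes "basic_inst I"
  shows "runs_within (search_com bfs_flags_com bfs_check_com) 60 xs
    (3000 * (real \<rho> ^ (2 * \<rho> + 1) * \<alpha> ^ (2 * \<rho>) * real m + real (n * m) + 1)) witness"
proof (rule computes_runs_within)
  let ?W = "word_bound 60 xs"
  let ?\<tau> = "tightness I"
  have W: "(wmax + 2) ^ 12 \<le> ?W" using word_size by (simp add: word_bound_size)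
  interpret B: basic I es ?W
    using assms W by unfold_locales
  let ?CC = "24 * n + 84 * m + 95"
  let ?tf = "n * (24 * n + 70 * m + 60) + 30 * m + 40"
  let ?e = "(\<rho> * (2 * ?\<tau> + 1) choose \<rho>) * ((16 + ?CC) * \<rho> + 14)"
  let ?k = "?tf + 32 * m + 65 + (if \<rho> \<le> m then ?e else 0)"
  show "computes ?W (search_com bfs_flags_com bfs_check_com) xs ?k witness"
  proof (rule computes_witness[OF W wmax_ge(2) wmax_ge(6) B.valid_bflags B.bfs_flags])
    show "computes ?W bfs_check_com (xs @ indicator_list m A @ [e]) (24 * n + 80 * m + 80)
       (\<lambda>ys. ys = [if bypass (ed ` A) (ed e) then 1 else 0])" if "A \<subseteq> {..<m}" "e \<in> A" for A e
    proof -
      have "e < m" using that by auto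
      then show ?thesis by (rule B.bfs_check[OF that(1)])
    qed
  qed auto
  fix ys assume "witness ys"
  then have ys: "length ys \<le> m + 1" using witness_length by blast
  let ?T = "real \<rho> ^ (2 * \<rho> + 1) * \<alpha> ^ (2 * \<rho>) * real m"
  have T: "0 \<le> ?T" using alpha_ge by simp
  have enum: "real ?e \<le> 2600 * ?T + 14" if "\<rho> \<le> m"
  proof (cases "\<rho> = 0")
    case True
    then show ?thesis using T by simp
  next
    case False
    then have m: "1 \<le> m" "1 \<le> \<rho>" using that by auto
    have "16 + ?CC \<le> 270 * m" using nodes_le m by simp
    then have "(16 + ?CC) * \<rho> \<le> 270 * m * \<rho>" by (rule mult_le_mono1)
    moreover have "14 \<le> 14 * (m * \<rho>)" using m by simp
    ultimately have "(16 + ?CC) * \<rho> + 14 \<le> 270 * m * \<rho> + 14 * (m * \<rho>)" by (rule add_mono)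
    also have "\<dots> = 284 * m * \<rho>" by simp
    finally have "(16 + ?CC) * \<rho> + 14 \<le> 284 * m * \<rho>" .
    then have "real ((16 + ?CC) * \<rho> + 14) \<le> real (284 * m * \<rho>)" by (rule of_nat_mono)
    also have "\<dots> = 284 * real m * real \<rho>" by simp
    finally have "real ((16 + ?CC) * \<rho> + 14) \<le> 284 * real m * real \<rho>" .
    moreover have "real (\<rho> * (2 * ?\<tau> + 1) choose \<rho>) \<le> 9 * real \<rho> ^ (2 * \<rho>) * \<alpha> ^ (2 * \<rho>)"
      using alpha_ge B.tightness_le_alpha by (intro choose_le) auto
    ultimately have "real (\<rho> * (2 * ?\<tau> + 1) choose \<rho>) * real ((16 + ?CC) * \<rho> + 14)
        \<le> (9 * real \<rho> ^ (2 * \<rho>) * \<alpha> ^ (2 * \<rho>)) * (284 * real m * real \<rho>)"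
      using alpha_ge by (intro mult_mono) auto
    also have "\<dots> = 2556 * ?T" by simp
    also have "\<dots> \<le> 2600 * ?T" using T by (intro mult_right_mono) auto
    finally have "real ?e \<le> 2600 * ?T" by (simp only: of_nat_mult[where 'a = real])
    then show ?thesis by linarith
  qed
  \<comment> \<open>By \<open>nodes_le\<close> the \<open>n * n\<close> part of the searches is
    within a multiple of \<open>n * m\<close>, except for the graph with one node, where
    \<open>m = 0\<close> and the constant takes over.\<close>
  have rest: "?tf + 32 * m + 65 + (5 + 3 * m) + (m + 1) \<le> 300 * (n * m) + 300"
  proof -
    have "0 < n" using connected by (simp add: connected_graph_def)
    then have m: "m \<le> n * m" by simp
    have n: "n \<le> n * m + 1"
    proof (cases "m = 0")
      case False
      then have "1 \<le> m" by linarith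
      then have "n * 1 \<le> n * m" by (rule mult_le_mono2)
      then show ?thesis by linarith
    qed (use nodes_le in simp)
    have "n * n \<le> n * (2 * m + 1)" using nodes_le by (intro mult_le_mono2)
    then have nn: "n * n \<le> 2 * (n * m) + n" by (simp add: algebra_simps)
    have "?tf = 24 * (n * n) + 70 * (n * m) + 60 * n + 30 * m + 40" by (simp add: algebra_simps)
    then show ?thesis using m n nn by linarith
  qed
  have k: "real ?k \<le> real (?tf + 32 * m + 65) + (2600 * ?T + 14)"
    using enum T by (cases "\<rho> \<le> m") auto
  have "real (length xs + ?k + length ys) \<le> real (5 + 3 * m) + real ?k + real (m + 1)"
    using ys by simp
  also have "\<dots> \<le> real (?tf + 32 * m + 65 + (5 + 3 * m) + (m + 1)) + (2600 * ?T + 14)"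
    using k by simp
  also have "\<dots> \<le> real (300 * (n * m) + 300) + (2600 * ?T + 14)"
    using rest by (intro add_right_mono of_nat_mono)
  also have "\<dots> \<le> 3000 * (?T + real (n * m) + 1)"
    using T by (simp add: algebra_simps)
  finally show "real (length xs + ?k + length ys) \<le> 3000 * (?T + real (n * m) + 1)" .
qed

text \<open>Every number of the input contributes at least one symbol, and there are
  \<open>3 * m + 5\<close> of them; \<open>nodes_le\<close> covers \<open>n\<close>.\<close>

lemma (in coded) enc_length_ge: "m \<le> enc_length xs" "n + m \<le> enc_length xs"
  using length_le_enc_length[of xs] nodes_le by auto

lemma codedI: "unit_weight_inst I \<Longrightarrow> lists_edges es (edges I) \<Longrightarrow> coded I es"
  by unfold_locales

text \<open>The program and its word exponent must not depend on the instance, so the oracles are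
  obtained before an instance is fixed.\<close>

lemma weighted_algorithm:
  assumes "spsp_time SPSP" "apsp2_time APSP2"
  obtains c D where "\<And>I es. unit_weight_inst I \<Longrightarrow> lists_edges es (edges I) \<Longrightarrow>
    runs_within c D (inst_code I es)
      (real (300 * (removals I ^ (2 * removals I + 1) * tightness I ^ (2 * removals I) * SPSP (nodes I) (card (edges I))
        + APSP2 (nodes I) (card (edges I)) + 1))) (coded.witness I es)"
proof -
  obtain cs Ds where cs: "\<forall>n E l es s t.
        connected_graph n E \<and> (\<forall>e\<in>E. 1 \<le> l e) \<and> lists_edges es E \<and> s < n \<and> t < n \<longrightarrow>
        runs_within cs Ds ([n, length es, s, t] @ edge_code l es) (real (SPSP n (card E)))
          (\<lambda>ys. \<exists>k. ys = [k] \<and> ereal (real k) = path_dist E l s t)"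
    using assms(1) unfolding spsp_time_def by (elim exE) (rule that)
  obtain ca Da where ca: "\<forall>n E l es.
        connected_graph n E \<and> (\<forall>e\<in>E. 1 \<le> l e) \<and> lists_edges es E \<longrightarrow>
        runs_within ca Da ([n, length es] @ edge_code l es) (real (APSP2 n (card E)))
          (\<lambda>ys. length ys = 2 * n * n \<and>
             (\<forall>u<n. \<forall>v<n. two_shortest E l u v
                (ys ! (2 * (u * n + v))) (ys ! (2 * (u * n + v) + 1))))"
    using assms(2) unfolding apsp2_time_def by (elim exE) (rule that)
  show thesis
  proof (rule that)
    fix I es assume I: "unit_weight_inst I" "lists_edges es (edges I)"
    interpret coded I es using codedI[OF I] .
    show "runs_within (search_com (apsp_flags_com ca) (spsp_check_com cs)) (60 + 4 * Ds + 4 * Da) (inst_code I es)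
      (real (300 * (removals I ^ (2 * removals I + 1) * tightness I ^ (2 * removals I) * SPSP (nodes I) (card (edges I))
        + APSP2 (nodes I) (card (edges I)) + 1))) witness"
    proof (rule runs_weighted)
      show "runs_within cs Ds ([n, m, s, t] @ edge_code l' es) (real (SPSP n (card E)))
          (\<lambda>ys. \<exists>k. ys = [k] \<and> ereal (real k) = path_dist E l' s t)"
        if "\<forall>e\<in>E. 1 \<le> l' e" "s < n" "t < n" for l' s t
        by (rule mp[OF spec[OF spec[OF spec[OF spec[OF spec[OF spec[OF cs]]]]]]]) (use connected I(2) that in simp)
      show "runs_within ca Da ([n, m] @ edge_code l' es) (real (APSP2 n (card E)))
          (\<lambda>ys. length ys = 2 * n * n \<and> (\<forall>u<n. \<forall>v<n. two_shortest E l' u v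
             (ys ! (2 * (u * n + v))) (ys ! (2 * (u * n + v) + 1))))"
        if "\<forall>e\<in>E. 1 \<le> l' e" for l'
        by (rule mp[OF spec[OF spec[OF spec[OF spec[OF ca]]]]]) (use connected I(2) that in simp)
    qed
  qed
qed

lemma fptI:
  assumes "\<And>I es. X I \<Longrightarrow> lists_edges es (edges I) \<Longrightarrow> \<exists>t Q. runs_within c D (inst_code I es) t Q \<and>
     t \<le> real (power_fun (param I) * poly p (enc_length (inst_code I es)))"
  shows "fpt c X param"
  unfolding fpt_def
proof (intro exI[of _ D] exI[of _ power_fun] exI[of _ p] conjI allI impI computable_power_fun)
  fix I es assume "X I \<and> lists_edges es (edges I)"
  then obtain t Q where "runs_within c D (inst_code I es) t Q"
    "t \<le> real (power_fun (param I) * poly p (enc_length (inst_code I es)))" using assms by blast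
  then show "runs_within c D (inst_code I es) (real (power_fun (param I) * poly p (enc_length (inst_code I es)))) (\<lambda>_. True)"
    by (rule runs_within_mono) simp
qed

theorem corollary6:
  "(\<forall>SPSP APSP2 :: nat \<Rightarrow> nat \<Rightarrow> nat.
      spsp_time SPSP \<and> polynomially_bounded SPSP \<and>
      apsp2_time APSP2 \<and> polynomially_bounded APSP2 \<longrightarrow>
      (let n = nodes; m = (\<lambda>I. card (edges I)); \<rho> = removals; \<tau> = tightness;
           T = (\<lambda>I. real (\<rho> I ^ (2 * \<rho> I + 1) * \<tau> I ^ (2 * \<rho> I) * SPSP (n I) (m I)
                         + APSP2 (n I) (m I)))
       in \<exists>dec wit.
            decides_in dec unit_weight_inst T \<and>
            fpt dec unit_weight_inst (\<lambda>I. [\<rho> I, \<tau> I]) \<and>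
            finds_witness_in wit unit_weight_inst (\<lambda>I. T I + real ((n I)\<^sup>2 * (m I)\<^sup>2)) \<and>
            fpt wit unit_weight_inst (\<lambda>I. [\<rho> I, \<tau> I])))
   \<and>
   (let n = nodes; m = (\<lambda>I. card (edges I)); \<rho> = removals; \<alpha> = stretch
    in \<exists>alg.
         finds_witness_in alg basic_inst
           (\<lambda>I. real (\<rho> I) ^ (2 * \<rho> I + 1) * real_of_rat (\<alpha> I) ^ (2 * \<rho> I) * real (m I)
                + real (n I * m I)) \<and>
         fpt alg basic_inst (\<lambda>I. \<rho> I # rat_code (\<alpha> I)))"
proof (rule conjI, intro allI impI, unfold Let_def)
  fix SPSP APSP2 :: "nat \<Rightarrow> nat \<Rightarrow> nat"
  assume asm: "spsp_time SPSP \<and> polynomially_bounded SPSP \<and> apsp2_time APSP2 \<and> polynomially_bounded APSP2"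
  define T where "T I = removals I ^ (2 * removals I + 1) * tightness I ^ (2 * removals I) *
    SPSP (nodes I) (card (edges I)) + APSP2 (nodes I) (card (edges I))" for I
  obtain wit D where wit: "\<And>I es. unit_weight_inst I \<Longrightarrow> lists_edges es (edges I) \<Longrightarrow>
    runs_within wit D (inst_code I es) (real (300 * (T I + 1))) (coded.witness I es)"
  proof (rule weighted_algorithm[of SPSP APSP2])
    fix c D assume "\<And>I es. unit_weight_inst I \<Longrightarrow> lists_edges es (edges I) \<Longrightarrow>
      runs_within c D (inst_code I es)
        (real (300 * (removals I ^ (2 * removals I + 1) * tightness I ^ (2 * removals I) * SPSP (nodes I) (card (edges I))
          + APSP2 (nodes I) (card (edges I)) + 1))) (coded.witness I es)"
    then show thesis by (intro that[of c D]) (simp add: T_def)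
  qed (use asm in auto)
  let ?dec = "decide_com wit"
  \<comment> \<open>The factor 606 is \<open>2 * 300 + 6\<close>, according to
    \<open>runs_within_decide\<close>.\<close>
  have dec: "runs_within ?dec D (inst_code I es) (real (606 * (T I + 1))) (\<lambda>ys. ys = [if \<exists>F. solution I F then 1 else 0])"
    if I: "unit_weight_inst I" "lists_edges es (edges I)" for I es
  proof -
    interpret coded I es using codedI[OF I] .
    show ?thesis
    proof (rule runs_within_mono[OF runs_within_decide[OF wit[OF I]]])
      show "\<And>ys. witness ys \<Longrightarrow> ys \<noteq> [] \<and> hd ys \<le> 1" using witness_length by blast
      show "zs = [if \<exists>F. solution I F then 1 else 0]" if "\<exists>ys. witness ys \<and> zs = [hd ys]" for zs
        using that unfolding witness_def by (auto split: if_splits)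
    qed simp
  qed
  obtain pS pA :: "nat poly" where p: "\<And>n m. SPSP n m \<le> poly pS (n + m)" "\<And>n m. APSP2 n m \<le> poly pA (n + m)"
    using asm unfolding polynomially_bounded_def by metis
  have T_le: "606 * (T I + 1) \<le> power_fun [removals I, tightness I] * poly (smult 606 (pS + pA + 1)) (enc_length (inst_code I es))"
    if I: "unit_weight_inst I" "lists_edges es (edges I)" for I es
  proof -
    interpret coded I es using codedI[OF I] .
    let ?N = "enc_length xs"
    let ?f = "removals I ^ (2 * removals I + 1) * tightness I ^ (2 * removals I)"
    have "SPSP n (card E) \<le> poly pS ?N" "APSP2 n (card E) \<le> poly pA ?N"
      using p[of n m] poly_nat_mono[OF enc_length_ge(2)] m_eq by (metis le_trans)+
    then have "T I + 1 \<le> ?f * poly pS ?N + poly pA ?N + 1"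
      unfolding T_def by (intro add_mono mult_le_mono2) auto
    also have "\<dots> \<le> (?f + 1) * (poly pS ?N + poly pA ?N + 1)" by (simp add: algebra_simps)
    finally have "606 * (T I + 1) \<le> 606 * ((?f + 1) * (poly pS ?N + poly pA ?N + 1))" by (rule mult_le_mono2)
    also have "\<dots> = power_fun [removals I, tightness I] * poly (smult 606 (pS + pA + 1)) ?N"
      by (simp add: power_fun_def algebra_simps)
    finally show ?thesis .
  qed
  have "decides_in ?dec unit_weight_inst (\<lambda>I. real (T I))"
    unfolding decides_in_def using dec by (intro exI[of _ D] exI[of _ 606]) (auto simp: add.commute)
  moreover have "fpt ?dec unit_weight_inst (\<lambda>I. [removals I, tightness I])"
  proof (rule fptI)
    fix I es assume I: "unit_weight_inst I" "lists_edges es (edges I)"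
    show "\<exists>t Q. runs_within ?dec D (inst_code I es) t Q \<and> t \<le> real (power_fun [removals I, tightness I] *
      poly (smult 606 (pS + pA + 1)) (enc_length (inst_code I es)))"
      using dec[OF I] of_nat_mono[OF T_le[OF I]] by blast
  qed
  \<comment> \<open>The search stops with the removed set still marked in its array, so writing the
    witness takes a time linear in \<open>m\<close>, which the bound already contains.\<close>
  moreover have "finds_witness_in wit unit_weight_inst (\<lambda>I. real (T I) + real ((nodes I)\<^sup>2 * (card (edges I))\<^sup>2))"
    unfolding finds_witness_in_def
  proof (intro exI[of _ D] exI[of _ 300] allI impI)
    fix I es assume "unit_weight_inst I \<and> lists_edges es (edges I)"
    then have I: "unit_weight_inst I" "lists_edges es (edges I)" by auto
    interpret coded I es using codedI[OF I] .
    show "runs_within wit D xs (300 * (real (T I) + real (n\<^sup>2 * (card E)\<^sup>2) + 1)) (\<lambda>ys. if \<exists>F. solution I F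
             then \<exists>F. solution I F \<and> ys = 1 # map (\<lambda>(u, v). if {u, v} \<in> F then 1 else 0) es
             else ys = [0])"
      by (rule runs_within_mono[OF wit[OF I]]) (auto simp: witness_def)
  qed
  moreover have "fpt wit unit_weight_inst (\<lambda>I. [removals I, tightness I])"
  proof (rule fptI)
    fix I es assume I: "unit_weight_inst I" "lists_edges es (edges I)"
    have "real (300 * (T I + 1)) \<le> real (606 * (T I + 1))" by simp
    also have "\<dots> \<le> real (power_fun [removals I, tightness I] * poly (smult 606 (pS + pA + 1)) (enc_length (inst_code I es)))"
      by (rule of_nat_mono[OF T_le[OF I]])
    finally show "\<exists>t Q. runs_within wit D (inst_code I es) t Q \<and> t \<le> real (power_fun [removals I, tightness I] *
      poly (smult 606 (pS + pA + 1)) (enc_length (inst_code I es)))"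
      using wit[OF I] by blast
  qed
  ultimately show "\<exists>dec wit.
            decides_in dec unit_weight_inst (\<lambda>I. real (removals I ^ (2 * removals I + 1) * tightness I ^ (2 * removals I) *
              SPSP (nodes I) (card (edges I)) + APSP2 (nodes I) (card (edges I)))) \<and>
            fpt dec unit_weight_inst (\<lambda>I. [removals I, tightness I]) \<and>
            finds_witness_in wit unit_weight_inst (\<lambda>I. real (removals I ^ (2 * removals I + 1) * tightness I ^ (2 * removals I) *
              SPSP (nodes I) (card (edges I)) + APSP2 (nodes I) (card (edges I))) + real ((nodes I)\<^sup>2 * (card (edges I))\<^sup>2)) \<and>
            fpt wit unit_weight_inst (\<lambda>I. [removals I, tightness I])"
    unfolding T_def by blast
next
  let ?alg = "search_com bfs_flags_com bfs_check_com"
  let ?T = "\<lambda>I. real (removals I) ^ (2 * removals I + 1) * real_of_rat (stretch I) ^ (2 * removals I) * real (card (edges I))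
    + real (nodes I * card (edges I))"
  have alg: "runs_within ?alg 60 (inst_code I es) (3000 * (?T I + 1)) (coded.witness I es)"
    if I: "basic_inst I" "lists_edges es (edges I)" for I es
  proof -
    interpret coded I es using codedI I by (simp add: basic_inst_def)
    show ?thesis using runs_basic[OF I(1)] by (simp add: m_eq)
  qed
  have "finds_witness_in ?alg basic_inst ?T"
    unfolding finds_witness_in_def
  proof (intro exI[of _ "60 :: nat"] exI[of _ "3000 :: real"] allI impI)
    fix I es assume I: "basic_inst I \<and> lists_edges es (edges I)"
    interpret coded I es using codedI I by (simp add: basic_inst_def)
    show "runs_within ?alg 60 xs (3000 * (?T I + 1)) (\<lambda>ys. if \<exists>F. solution I F
             then \<exists>F. solution I F \<and> ys = 1 # map (\<lambda>(u, v). if {u, v} \<in> F then 1 else 0) es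
             else ys = [0])"
      by (rule runs_within_mono[OF alg]) (use I in \<open>auto simp: witness_def\<close>)
  qed
  moreover have "fpt ?alg basic_inst (\<lambda>I. removals I # rat_code (stretch I))"
  proof (rule fptI)
    fix I es assume I: "basic_inst I" "lists_edges es (edges I)"
    interpret coded I es using codedI I by (simp add: basic_inst_def)
    let ?N = "enc_length xs"
    let ?f = "\<rho> ^ (2 * \<rho> + 1) * num ^ (2 * \<rho>)"
    \<comment> \<open>The computable factor works on natural numbers, so \<open>\<alpha>\<close> is
      replaced by its numerator, which is at least as large because the denominator is at least
      1.\<close>
    have "\<alpha> \<le> real num"
    proof -
      have "real num / real den \<le> real num / 1" using q_pos by (intro divide_left_mono) auto
      then show ?thesis by (simp add: alpha_frac)
    qed
    then have "\<alpha> ^ (2 * \<rho>) \<le> real num ^ (2 * \<rho>)" using alpha_ge by (intro power_mono) auto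
    then have "real \<rho> ^ (2 * \<rho> + 1) * \<alpha> ^ (2 * \<rho>) * real m \<le> real \<rho> ^ (2 * \<rho> + 1) * real num ^ (2 * \<rho>) * real m"
      by (intro mult_right_mono mult_left_mono) auto
    then have "?T I + 1 \<le> real (?f * m + n * m + 1)" by (simp add: m_eq)
    also have "?f * m + n * m + 1 \<le> (?f + 1) * (m + n * m + 1)" by (simp add: algebra_simps)
    also have "m + n * m + 1 \<le> ?N + ?N * ?N + 1"
      using enc_length_ge by (intro add_mono mult_le_mono) auto
    finally have "3000 * (?T I + 1) \<le> real (3000 * ((?f + 1) * (?N + ?N * ?N + 1)))"
      by (simp only: of_nat_mult of_nat_numeral mult_le_cancel_left_pos)
    also have "3000 * ((?f + 1) * (?N + ?N * ?N + 1)) =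
      power_fun (\<rho> # rat_code (stretch I)) * poly [:3000, 3000, 3000:] ?N"
      by (simp add: power_fun_def rat_code_def algebra_simps)
    finally show "\<exists>t Q. runs_within ?alg 60 xs t Q \<and>
      t \<le> real (power_fun (\<rho> # rat_code (stretch I)) * poly [:3000, 3000, 3000:] ?N)"
      using alg[OF I] by blast
  qed
  ultimately show "\<exists>alg. finds_witness_in alg basic_inst ?T \<and> fpt alg basic_inst (\<lambda>I. removals I # rat_code (stretch I))"
    by blast
qed

end
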